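(* Let $(M,\varphi)$ be a closed $G_2$-manifold (compact without boundary). If a $2$-multivector field $Q\in\Omega^2(TM)$ is both Rochesterian and coRochesterian, then $Q\lrcorner\varphi=0$.
   Context: A $G_2$-structure on a smooth $7$-manifold $M$ is a smooth $3$-form $\varphi$ such that for every $p\in M$ the pair $(T_pM,\varphi_p)$ is isomorphic to $(\mathbb{R}^7,\varphi_0)$, where $$\varphi_0=dx^{123}+dx^{145}+dx^{167}+dx^{246}-dx^{257}-dx^{347}-dx^{356},\quad dx^{ijk}=dx^i\wedge dx^j\wedge dx^k.$$ It determines an orientation, a Riemannian metric $g_\varphi$ and its volume form $\mathrm{Vol}_\varphi$, characterized by $(X\lrcorner\varphi)\wedge(Y\lrcorner\varphi)\wedge\varphi=6g_\varphi(X,Y)\mathrm{Vol}_\varphi$ for all vector fields $X,Y$; $\star$ denotes the Hodge star of $g_\varphi$. $(M,\varphi)$ is a $G_2$-manifold if $\varphi$ is parallel for the Levi-Civita connection of $g_\varphi$ (equivalently $d\varphi=0$ and $d\star\varphi=0$). $\Omega^2(TM)$ denotes smooth $2$-multivector fields (sections of $\Lambda^2TM$), with contraction $(X_1\wedge X_2)\lrcorner\phi=X_2\lrcorner X_1\lrcorner\phi$ extended linearly. A $2$-multivector field $Q$ is Rochesterian if $Q\lrcorner\varphi=df$ for some smooth function $f$, and coRochesterian if $Q\lrcorner\star\varphi=d\alpha$ for some smooth $1$-form $\alpha$. *)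

theory Defs
  imports "HOL-Analysis.Analysis"
begin

section \<open>Exterior algebra of a seven-dimensional vector space\<close>

type_synonym vec7 = "real^7"

text \<open>
  A covariant tensor of degree k takes a list of k vectors. Being zero on lists of any other
  length is part of \<open>alt_form\<close>, so that k-forms are determined as functions on lists.
  The coordinates of \<open>real^7\<close> are indexed by the elements 1, ..., 7 of the type \<open>7\<close> (where 7 = 0).
\<close>

type_synonym cov = "vec7 list \<Rightarrow> real"

definition alt_form :: "nat \<Rightarrow> cov \<Rightarrow> bool" where
  "alt_form k \<omega> \<longleftrightarrow>
     (\<forall>vs. length vs \<noteq> k \<longrightarrow> \<omega> vs = 0) \<and>
     (\<forall>vs i. length vs = k \<and> i < k \<longrightarrow> linear (\<lambda>v. \<omega> (vs[i := v]))) \<and>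
     (\<forall>vs. length vs = k \<and> \<not> distinct vs \<longrightarrow> \<omega> vs = 0)"

text \<open>
  Shuffle formula, normalised by (dx \<open>\<and>\<close> dy)(u, v) = dx(u) dy(v) - dx(v) dy(u). The positions in
  \<open>S\<close> go to the first factor; the sign is that of the shuffle. If \<open>\<omega>\<close> is a k-form, then only the
  \<open>S\<close> with k elements contribute.
\<close>

definition wedge :: "cov \<Rightarrow> cov \<Rightarrow> cov" where
  "wedge \<omega> \<eta> vs =
     (\<Sum>S\<in>Pow {..<length vs}.
        (-1) ^ card {(i, j). i \<in> S \<and> j \<in> {..<length vs} - S \<and> j < i}
        * \<omega> (nths vs S) * \<eta> (nths vs (- S)))"

definition contract :: "vec7 \<Rightarrow> cov \<Rightarrow> cov" where
  "contract X \<omega> vs = \<omega> (X # vs)"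

text \<open>
  A 2-vector is represented by its skew matrix of components, B = sum over i < j of
  \<open>B $ i $ j\<close> times \<open>e\<^sub>i \<and> e\<^sub>j\<close>; the factor 1/2 below turns this sum into one over all i and j.
\<close>

type_synonym bivec7 = "real^7^7"

definition skew :: "bivec7 \<Rightarrow> bool" where
  "skew B \<longleftrightarrow> transpose B = - B"

definition biwedge :: "vec7 \<Rightarrow> vec7 \<Rightarrow> bivec7" where
  "biwedge X Y = (\<chi> i j. X $ i * Y $ j - X $ j * Y $ i)"

definition contract2 :: "bivec7 \<Rightarrow> cov \<Rightarrow> cov" where
  "contract2 B \<omega> vs = (\<Sum>i\<in>UNIV. \<Sum>j\<in>UNIV. B $ i $ j * \<omega> (axis i 1 # axis j 1 # vs)) / 2"

definition inner_product :: "(vec7 \<Rightarrow> vec7 \<Rightarrow> real) \<Rightarrow> bool" where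
  "inner_product g \<longleftrightarrow>
     bilinear g \<and> (\<forall>u v. g u v = g v u) \<and> (\<forall>u. u \<noteq> 0 \<longrightarrow> g u u > 0)"

text \<open>The volume form of \<open>g\<close> for one of the two orientations.\<close>

definition volume_form :: "(vec7 \<Rightarrow> vec7 \<Rightarrow> real) \<Rightarrow> cov \<Rightarrow> bool" where
  "volume_form g vol \<longleftrightarrow>
     alt_form 7 vol \<and>
     (\<forall>bs. length bs = 7 \<and> (\<forall>i<7. \<forall>j<7. g (bs ! i) (bs ! j) = (if i = j then 1 else 0))
        \<longrightarrow> \<bar>vol bs\<bar> = 1)"

text \<open>
  The vector metrically dual to the i-th coordinate form, i.e. the i-th column of the inverse of
  the Gram matrix of \<open>g\<close>.
\<close>

definition sharp_dx :: "(vec7 \<Rightarrow> vec7 \<Rightarrow> real) \<Rightarrow> 7 \<Rightarrow> vec7" where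
  "sharp_dx g i = matrix_inv (\<chi> k l. g (axis k 1) (axis l 1)) *v axis i 1"

text \<open>
  Hodge star of a k-form: contraction of the volume form with the k-form with raised indices, in
  its first k slots. It satisfies \<open>\<alpha> \<and> \<star>\<beta> = g(\<alpha>, \<beta>) vol\<close>.
\<close>

definition hodge_star :: "(vec7 \<Rightarrow> vec7 \<Rightarrow> real) \<Rightarrow> cov \<Rightarrow> nat \<Rightarrow> cov \<Rightarrow> cov" where
  "hodge_star g vol k \<beta> vs =
     (\<Sum>is | length is = k. \<beta> (map (sharp_dx g) is) * vol (map (\<lambda>i. axis i 1) is @ vs)) / fact k"


section \<open>Linear algebra of the model 3-form\<close>

definition dx :: "7 \<Rightarrow> cov" where
  "dx i vs = (if length vs = 1 then hd vs $ i else 0)"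

definition dx3 :: "7 \<Rightarrow> 7 \<Rightarrow> 7 \<Rightarrow> cov" where
  "dx3 i j k = wedge (dx i) (wedge (dx j) (dx k))"

definition phi0 :: cov where
  "phi0 vs = dx3 1 2 3 vs + dx3 1 4 5 vs + dx3 1 6 7 vs
     + dx3 2 4 6 vs - dx3 2 5 7 vs - dx3 3 4 7 vs - dx3 3 5 6 vs"

definition G2_form :: "cov \<Rightarrow> bool" where
  "G2_form \<phi> \<longleftrightarrow>
     (\<exists>L :: vec7 \<Rightarrow> vec7. linear L \<and> bij L \<and> (\<forall>vs. \<phi> vs = phi0 (map L vs)))"

text \<open>
  The positivity of \<open>g\<close> makes this equation select the orientation. For a G2 form there is exactly
  one such pair of an inner product and a volume form.
\<close>

definition G2_metric_volume :: "cov \<Rightarrow> (vec7 \<Rightarrow> vec7 \<Rightarrow> real) \<Rightarrow> cov \<Rightarrow> bool" where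
  "G2_metric_volume \<phi> g vol \<longleftrightarrow>
     inner_product g \<and> volume_form g vol \<and>
     (\<forall>X Y vs. wedge (wedge (contract X \<phi>) (contract Y \<phi>)) \<phi> vs = 6 * g X Y * vol vs)"

definition G2_metric :: "cov \<Rightarrow> vec7 \<Rightarrow> vec7 \<Rightarrow> real" where
  "G2_metric \<phi> = (THE g. \<exists>vol. G2_metric_volume \<phi> g vol)"

definition G2_volume :: "cov \<Rightarrow> cov" where
  "G2_volume \<phi> = (THE vol. \<exists>g. G2_metric_volume \<phi> g vol)"

definition G2_star :: "cov \<Rightarrow> cov" where
  "G2_star \<phi> = hodge_star (G2_metric \<phi>) (G2_volume \<phi>) 3 \<phi>"


section \<open>Smooth manifolds and tensor fields\<close>

text \<open>Meant for open \<open>S\<close>: all iterated directional derivatives up to order k are continuous.\<close>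

primrec Ck_on :: "nat \<Rightarrow> 'v::real_normed_vector set \<Rightarrow> ('v \<Rightarrow> 'w::real_normed_vector) \<Rightarrow> bool" where
  "Ck_on 0 S f \<longleftrightarrow> continuous_on S f"
| "Ck_on (Suc k) S f \<longleftrightarrow>
     (\<forall>x\<in>S. f differentiable (at x)) \<and> (\<forall>v. Ck_on k S (\<lambda>x. frechet_derivative f (at x) v))"

definition smooth_on :: "'v::real_normed_vector set \<Rightarrow> ('v \<Rightarrow> 'w::real_normed_vector) \<Rightarrow> bool" where
  "smooth_on S f \<longleftrightarrow> (\<forall>k. Ck_on k S f)"

text \<open>A chart is a pair of its domain and its coordinate map.\<close>

type_synonym 'a chart = "'a set \<times> ('a \<Rightarrow> vec7)"

abbreviation chart_dom :: "'a chart \<Rightarrow> 'a set" where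
  "chart_dom c \<equiv> fst c"

abbreviation coord :: "'a chart \<Rightarrow> 'a \<Rightarrow> vec7" where
  "coord c \<equiv> snd c"

definition param :: "'a chart \<Rightarrow> vec7 \<Rightarrow> 'a" where
  "param c = the_inv_into (chart_dom c) (coord c)"

definition chart_on :: "'a topology \<Rightarrow> 'a chart \<Rightarrow> bool" where
  "chart_on M c \<longleftrightarrow>
     openin M (chart_dom c) \<and> open (coord c ` chart_dom c) \<and>
     homeomorphic_map (subtopology M (chart_dom c)) (top_of_set (coord c ` chart_dom c)) (coord c)"

text \<open>A smooth manifold of dimension 7 without boundary; \<open>A\<close> is any atlas of its smooth structure.\<close>

definition smooth_manifold7 :: "'a topology \<Rightarrow> 'a chart set \<Rightarrow> bool" where
  "smooth_manifold7 M A \<longleftrightarrow>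
     Hausdorff_space M \<and> second_countable M \<and>
     (\<forall>c\<in>A. chart_on M c) \<and> topspace M = (\<Union>c\<in>A. chart_dom c) \<and>
     (\<forall>c\<in>A. \<forall>c'\<in>A.
        smooth_on (coord c ` (chart_dom c \<inter> chart_dom c')) (\<lambda>x. coord c' (param c x)))"

definition smooth_function :: "'a chart set \<Rightarrow> ('a \<Rightarrow> real) \<Rightarrow> bool" where
  "smooth_function A f \<longleftrightarrow> (\<forall>c\<in>A. smooth_on (coord c ` chart_dom c) (\<lambda>x. f (param c x)))"

text \<open>The differential at \<open>p\<close> of the transition map from \<open>c\<close> to \<open>c'\<close>.\<close>

definition transition_deriv :: "'a chart \<Rightarrow> 'a chart \<Rightarrow> 'a \<Rightarrow> vec7 \<Rightarrow> vec7" where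
  "transition_deriv c c' p = frechet_derivative (\<lambda>x. coord c' (param c x)) (at (coord c p))"

text \<open>
  A tensor field is given by its local representatives: the value at \<open>c\<close> and \<open>p\<close> is the tensor at
  \<open>p\<close> as seen through the identification of the tangent space at \<open>p\<close> with \<open>real^7\<close> provided by the
  chart \<open>c\<close> around \<open>p\<close>. The representatives in different charts are related by the transition maps.
\<close>

type_synonym 'a cov_field = "'a chart \<Rightarrow> 'a \<Rightarrow> cov"

definition smooth_form :: "'a chart set \<Rightarrow> nat \<Rightarrow> 'a cov_field \<Rightarrow> bool" where
  "smooth_form A k \<omega> \<longleftrightarrow>
     (\<forall>c\<in>A. \<forall>p\<in>chart_dom c. alt_form k (\<omega> c p)) \<and>
     (\<forall>c\<in>A. \<forall>vs. smooth_on (coord c ` chart_dom c) (\<lambda>x. \<omega> c (param c x) vs)) \<and>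
     (\<forall>c\<in>A. \<forall>c'\<in>A. \<forall>p\<in>chart_dom c \<inter> chart_dom c'. \<forall>vs.
        \<omega> c p vs = \<omega> c' p (map (transition_deriv c c' p) vs))"

type_synonym 'a bivec_field = "'a chart \<Rightarrow> 'a \<Rightarrow> bivec7"

definition smooth_bivector_field :: "'a chart set \<Rightarrow> 'a bivec_field \<Rightarrow> bool" where
  "smooth_bivector_field A Q \<longleftrightarrow>
     (\<forall>c\<in>A. \<forall>p\<in>chart_dom c. skew (Q c p)) \<and>
     (\<forall>c\<in>A. smooth_on (coord c ` chart_dom c) (\<lambda>x. Q c (param c x))) \<and>
     (\<forall>c\<in>A. \<forall>c'\<in>A. \<forall>p\<in>chart_dom c \<inter> chart_dom c'.
        Q c' p = matrix (transition_deriv c c' p) ** Q c p ** transpose (matrix (transition_deriv c c' p)))"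

definition field_eq :: "'a chart set \<Rightarrow> 'a cov_field \<Rightarrow> 'a cov_field \<Rightarrow> bool" where
  "field_eq A \<omega> \<eta> \<longleftrightarrow> (\<forall>c\<in>A. \<forall>p\<in>chart_dom c. \<omega> c p = \<eta> c p)"

definition zero_field :: "'a cov_field" where
  "zero_field c p vs = 0"

definition function_form :: "('a \<Rightarrow> real) \<Rightarrow> 'a cov_field" where
  "function_form f c p vs = (if vs = [] then f p else 0)"

definition contract2_field :: "'a bivec_field \<Rightarrow> 'a cov_field \<Rightarrow> 'a cov_field" where
  "contract2_field Q \<omega> c p = contract2 (Q c p) (\<omega> c p)"

text \<open>
  Derivative at \<open>p\<close>, in the direction \<open>u\<close>, of a function given near \<open>p\<close>, all in the chart \<open>c\<close>.
\<close>

definition chart_deriv :: "'a chart \<Rightarrow> 'a \<Rightarrow> vec7 \<Rightarrow> ('a \<Rightarrow> real) \<Rightarrow> real" where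
  "chart_deriv c p u h = frechet_derivative (\<lambda>x. h (param c x)) (at (coord c p)) u"

definition ext_d :: "'a cov_field \<Rightarrow> 'a cov_field" where
  "ext_d \<omega> c p vs =
     (\<Sum>i<length vs. (-1) ^ i * chart_deriv c p (vs ! i) (\<lambda>q. \<omega> c q (take i vs @ drop (Suc i) vs)))"

type_synonym 'a metric_field = "'a chart \<Rightarrow> 'a \<Rightarrow> vec7 \<Rightarrow> vec7 \<Rightarrow> real"

text \<open>
  The vector \<open>\<nabla>\<^sub>u v\<close> for constant coordinate fields \<open>u\<close> and \<open>v\<close>, where \<open>\<nabla>\<close> is the Levi-Civita
  connection of \<open>g\<close>; its components for basis vectors are the Christoffel symbols.
\<close>

definition christoffel :: "'a metric_field \<Rightarrow> 'a chart \<Rightarrow> 'a \<Rightarrow> vec7 \<Rightarrow> vec7 \<Rightarrow> vec7" where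
  "christoffel g c p u v =
     (\<Sum>l\<in>UNIV.
        ((chart_deriv c p u (\<lambda>q. g c q v (axis l 1)) + chart_deriv c p v (\<lambda>q. g c q u (axis l 1))
          - chart_deriv c p (axis l 1) (\<lambda>q. g c q u v)) / 2)
        *\<^sub>R sharp_dx (g c p) l)"

definition cov_deriv :: "'a metric_field \<Rightarrow> 'a cov_field \<Rightarrow> 'a chart \<Rightarrow> 'a \<Rightarrow> vec7 \<Rightarrow> cov" where
  "cov_deriv g \<omega> c p u vs =
     chart_deriv c p u (\<lambda>q. \<omega> c q vs)
     - (\<Sum>i<length vs. \<omega> c p (vs[i := christoffel g c p u (vs ! i)]))"

definition parallel :: "'a chart set \<Rightarrow> 'a metric_field \<Rightarrow> 'a cov_field \<Rightarrow> bool" where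
  "parallel A g \<omega> \<longleftrightarrow> (\<forall>c\<in>A. \<forall>p\<in>chart_dom c. \<forall>u vs. cov_deriv g \<omega> c p u vs = 0)"


section \<open>G2-manifolds\<close>

definition G2_structure :: "'a chart set \<Rightarrow> 'a cov_field \<Rightarrow> bool" where
  "G2_structure A \<phi> \<longleftrightarrow> smooth_form A 3 \<phi> \<and> (\<forall>c\<in>A. \<forall>p\<in>chart_dom c. G2_form (\<phi> c p))"

definition G2_metric_field :: "'a cov_field \<Rightarrow> 'a metric_field" where
  "G2_metric_field \<phi> c p = G2_metric (\<phi> c p)"

definition G2_star_field :: "'a cov_field \<Rightarrow> 'a cov_field" where
  "G2_star_field \<phi> c p = G2_star (\<phi> c p)"

definition G2_manifold :: "'a topology \<Rightarrow> 'a chart set \<Rightarrow> 'a cov_field \<Rightarrow> bool" where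
  "G2_manifold M A \<phi> \<longleftrightarrow>
     smooth_manifold7 M A \<and> G2_structure A \<phi> \<and> parallel A (G2_metric_field \<phi>) \<phi>"

definition closed_G2_manifold :: "'a topology \<Rightarrow> 'a chart set \<Rightarrow> 'a cov_field \<Rightarrow> bool" where
  "closed_G2_manifold M A \<phi> \<longleftrightarrow> G2_manifold M A \<phi> \<and> compact_space M"

definition Rochesterian :: "'a chart set \<Rightarrow> 'a cov_field \<Rightarrow> 'a bivec_field \<Rightarrow> bool" where
  "Rochesterian A \<phi> Q \<longleftrightarrow>
     (\<exists>f. smooth_function A f \<and> field_eq A (contract2_field Q \<phi>) (ext_d (function_form f)))"

definition coRochesterian :: "'a chart set \<Rightarrow> 'a cov_field \<Rightarrow> 'a bivec_field \<Rightarrow> bool" where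
  "coRochesterian A \<phi> Q \<longleftrightarrow>
     (\<exists>\<alpha>. smooth_form A 1 \<alpha> \<and> field_eq A (contract2_field Q (G2_star_field \<phi>)) (ext_d \<alpha>))"


section \<open>The contraction convention for 2-vectors\<close>

lemma alt_form_expand2:
  assumes "alt_form k \<omega>"
  shows "\<omega> (X # Y # vs) = (\<Sum>i\<in>UNIV. \<Sum>j\<in>UNIV. X $ i * Y $ j * \<omega> (axis i 1 # axis j 1 # vs))"
proof (cases "length vs + 2 = k")
  case False
  then show ?thesis using assms by (auto simp: alt_form_def)
next
  case True
  have lin: "linear (\<lambda>v. \<omega> (ws[i := v]))" if "length ws = k" "i < k" for ws i
    using assms that by (auto simp: alt_form_def)
  have l1: "linear (\<lambda>v. \<omega> (v # y # vs))" for y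
    using lin[of "0 # y # vs" 0] True by simp
  have l2: "linear (\<lambda>v. \<omega> (x # v # vs))" for x
    using lin[of "x # 0 # vs" 1] True by simp
  have e: "f v = (\<Sum>i\<in>UNIV. v $ i * f (axis i 1))" if "linear f" for f :: "vec7 \<Rightarrow> real" and v
  proof -
    have "f v = f (\<Sum>i\<in>UNIV. v $ i *s axis i 1)"
      by (simp add: basis_expansion)
    also have "\<dots> = (\<Sum>i\<in>UNIV. v $ i * f (axis i 1))"
      using that by (simp add: linear_sum scalar_mult_eq_scaleR linear_cmul)
    finally show ?thesis .
  qed
  have "\<omega> (X # Y # vs) = (\<Sum>i\<in>UNIV. X $ i * \<omega> (axis i 1 # Y # vs))"
    by (rule e[OF l1])
  also have "\<dots> = (\<Sum>i\<in>UNIV. X $ i * (\<Sum>j\<in>UNIV. Y $ j * \<omega> (axis i 1 # axis j 1 # vs)))"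
    by (subst e[OF l2]) simp
  finally show ?thesis
    by (simp add: sum_distrib_left mult.assoc)
qed

lemma alt_form_swap2:
  assumes "alt_form k \<omega>"
  shows "\<omega> (Y # X # vs) = - \<omega> (X # Y # vs)"
proof (cases "length vs + 2 = k")
  case False
  then show ?thesis using assms by (auto simp: alt_form_def)
next
  case True
  have lin: "linear (\<lambda>v. \<omega> (ws[i := v]))" if "length ws = k" "i < k" for ws i
    using assms that by (auto simp: alt_form_def)
  have l1: "linear (\<lambda>v. \<omega> (v # y # vs))" for y
    using lin[of "0 # y # vs" 0] True by simp
  have l2: "linear (\<lambda>v. \<omega> (x # v # vs))" for x
    using lin[of "x # 0 # vs" 1] True by simp
  have z: "\<omega> (x # x # vs) = 0" for x
    using assms True by (auto simp: alt_form_def)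
  have "\<omega> ((X + Y) # (X + Y) # vs) = \<omega> (X # Y # vs) + \<omega> (Y # X # vs)"
    unfolding linear_add[OF l1] linear_add[OF l2] by (simp add: z)
  then show ?thesis using z[of "X + Y"] by linarith
qed

lemma contract2_biwedge:
  assumes "alt_form k \<omega>"
  shows "contract2 (biwedge X Y) \<omega> = contract Y (contract X \<omega>)"
proof
  fix vs
  have "(\<Sum>i\<in>UNIV. \<Sum>j\<in>UNIV. biwedge X Y $ i $ j * \<omega> (axis i 1 # axis j 1 # vs))
      = \<omega> (X # Y # vs) - \<omega> (Y # X # vs)"
    unfolding alt_form_expand2[OF assms, of X Y vs] alt_form_expand2[OF assms, of Y X vs]
    by (simp add: biwedge_def sum_subtractf algebra_simps)
  then show "contract2 (biwedge X Y) \<omega> vs = contract Y (contract X \<omega>) vs"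
    by (simp add: contract2_def contract_def alt_form_swap2[OF assms, of Y X])
qed

end

(*
  Let df and d alpha be the contractions of Q with phi and with its star. In an orthonormal frame
  the identity phi_{ijw} (star phi)_{uvij} = 4 phi_{uvw} gives
    sum_{ij} phi_{wij} (d alpha)_{ij} = 4 (df)_w.
  Taking the divergence of both sides, the left hand side vanishes: phi is parallel, the Christoffel
  symbols are symmetric while phi and d alpha are alternating, and second partial derivatives
  commute. Hence f is harmonic. By Hopf's strong maximum principle the set where f attains its maximum
  on a connected component of M is open and closed, so f is locally constant and df = 0. No integration
  or orientation of M is involved.
*)

theory Submission
  imports Defs
begin

section \<open>Alternating forms and wedge products\<close>

text \<open>The metric, the volume form and the star are given only implicitly, through
  \<open>G2_metric_volume\<close>. At one point that equation is solved by a linear isomorphism with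
  the model, but the isomorphism is chosen point by point and has no regularity, so nothing may be
  differentiated in an adapted frame. This separates two kinds of argument. Differentiation happens
  in coordinates: solving the defining equation expresses the metric through determinants and a
  ninth root of polynomials in the components of \<phi>. This makes it C1, which is what Christoffel
  symbols and a maximum principle with continuous coefficients ask for. Algebra happens in a frame
  adapted at a single point and kept constant around it; the derivatives of the inverse metric then
  appear explicitly and have to cancel against those of \<phi>. The identities of the model form are
  finite statements about basis vectors and are evaluated; multilinearity does the rest. Finally, f
  is compared only within one component, while the maximum principle needs a full neighbourhood; so
  it is applied on chart balls whose image stays in that component.\<close>

lemma linear_const_mult: "linear f \<Longrightarrow> linear (\<lambda>x. c * f x)" for f :: "'v::real_vector \<Rightarrow> real"
  using linear_compose_scale_right[of f c] by simp

lemma linear_mult_const: "linear f \<Longrightarrow> linear (\<lambda>x. f x * c)" for f :: "'v::real_vector \<Rightarrow> real"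
  using linear_const_mult[of f c] by (simp add: mult.commute)

lemma alt_form_length: "alt_form k \<omega> \<Longrightarrow> length vs \<noteq> k \<Longrightarrow> \<omega> vs = 0"
  by (simp add: alt_form_def)

lemma alt_form_linear: "alt_form k \<omega> \<Longrightarrow> length vs = k \<Longrightarrow> i < k \<Longrightarrow> linear (\<lambda>v. \<omega> (vs[i := v]))"
  by (simp add: alt_form_def)

lemma alt_form_not_distinct: "alt_form k \<omega> \<Longrightarrow> \<not> distinct vs \<Longrightarrow> \<omega> vs = 0"
  by (cases "length vs = k") (auto simp: alt_form_def)

text \<open>Polarisation of F (a + b) (a + b) = 0. The vanishing is required for the single pair of
  positions i, j only, because \<open>alt_formI\<close> applies the lemma before alternation in
  general is known.\<close>

lemma multilinear_swap:
  fixes \<omega> :: cov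
  assumes lin: "\<And>vs i. length vs = k \<Longrightarrow> i < k \<Longrightarrow> linear (\<lambda>v. \<omega> (vs[i := v]))"
    and zero: "\<And>x. \<omega> (vs[i := x, j := x]) = 0"
    and "length vs = k" "i < j" "j < k"
  shows "\<omega> (vs[i := vs ! j, j := vs ! i]) = - \<omega> vs"
proof -
  define F where "F x y = \<omega> (vs[i := x, j := y])" for x y
  have l1: "linear (\<lambda>x. F x y)" for y
  proof -
    have "(\<lambda>x. F x y) = (\<lambda>x. \<omega> ((vs[j := y])[i := x]))"
      using assms by (auto simp: F_def list_update_swap)
    then show ?thesis using lin[of "vs[j := y]" i] assms by simp
  qed
  have l2: "linear (\<lambda>y. F x y)" for x
    using lin[of "vs[i := x]" j] assms by (simp add: F_def)
  have z: "F x x = 0" for x using zero by (simp add: F_def)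
  have "F (a + b) (a + b) = F a b + F b a" for a b
    unfolding linear_add[OF l1] linear_add[OF l2] by (simp add: z)
  then have "F (vs ! j) (vs ! i) = - F (vs ! i) (vs ! j)"
    using z by (metis add.commute add_eq_0_iff)
  then show ?thesis by (simp add: F_def)
qed

lemma alt_form_swap:
  assumes "alt_form k \<omega>" "i < j" "j < length vs"
  shows "\<omega> (vs[i := vs ! j, j := vs ! i]) = - \<omega> vs"
proof (cases "length vs = k")
  case False
  then show ?thesis using assms by (simp add: alt_form_length)
next
  case True
  show ?thesis
  proof (rule multilinear_swap[OF alt_form_linear[OF assms(1)]])
    fix x :: vec7
    have "\<not> distinct (vs[i := x, j := x])"
      using assms nth_eq_iff_index_eq[of "vs[i := x, j := x]" i j] by (auto simp: nth_list_update)
    then show "\<omega> (vs[i := x, j := x]) = 0" using alt_form_not_distinct[OF assms(1)] by blast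
  qed (use assms True in auto)
qed

text \<open>Swapping the right one of two equal entries with its left neighbour brings the two
  closer and costs only a sign, so alternation reduces to adjacent entries. That is the case in
  which shuffles cancel in pairs.\<close>

lemma alt_formI:
  assumes len: "\<And>vs. length vs \<noteq> k \<Longrightarrow> \<omega> vs = 0"
    and lin: "\<And>vs i. length vs = k \<Longrightarrow> i < k \<Longrightarrow> linear (\<lambda>v. \<omega> (vs[i := v]))"
    and adj: "\<And>vs i. length vs = k \<Longrightarrow> Suc i < k \<Longrightarrow> vs ! i = vs ! Suc i \<Longrightarrow> \<omega> vs = 0"
  shows "alt_form k \<omega>"
proof -
  have *: "\<omega> vs = 0" if "length vs = k" "i < k" "i + Suc d < k" "vs ! i = vs ! (i + Suc d)" for vs i d
    using that
  proof (induction d arbitrary: vs)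
    case 0
    then show ?case using adj by simp
  next
    case (Suc d)
    let ?a = "i + Suc d" and ?b = "Suc (i + Suc d)"
    let ?vs = "vs[?a := vs ! ?b, ?b := vs ! ?a]"
    have "\<omega> ?vs = - \<omega> vs"
    proof (rule multilinear_swap[OF lin])
      fix x
      show "\<omega> (vs[?a := x, ?b := x]) = 0"
        using Suc.prems by (intro adj[where i = ?a]) (auto simp: nth_list_update)
    qed (use Suc.prems in auto)
    moreover have "\<omega> ?vs = 0"
      using Suc.prems by (intro Suc.IH) (auto simp: nth_list_update)
    ultimately show ?case by simp
  qed
  have "\<omega> vs = 0" if len: "length vs = k" and nd: "\<not> distinct vs" for vs
  proof -
    obtain i j where "i < j" "j < k" "vs ! i = vs ! j"
    proof -
      obtain i j where "i < k" "j < k" "i \<noteq> j" "vs ! i = vs ! j"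
        using len nd by (auto simp: distinct_conv_nth)
      then show thesis using that[of i j] that[of j i] by (cases "i < j") auto
    qed
    moreover from \<open>i < j\<close> obtain d where "j = i + Suc d" by (metis less_imp_Suc_add add_Suc_right)
    ultimately show ?thesis using * len by auto
  qed
  then show ?thesis using len lin by (auto simp: alt_form_def)
qed

lemma alt_form_add:
  assumes "alt_form k \<omega>" "alt_form k \<eta>"
  shows "alt_form k (\<lambda>vs. \<omega> vs + \<eta> vs)"
  unfolding alt_form_def
  using assms by (simp add: alt_form_length alt_form_not_distinct alt_form_linear linear_compose_add)

lemma alt_form_scale:
  assumes "alt_form k \<omega>"
  shows "alt_form k (\<lambda>vs. a * \<omega> vs)"
proof -
  have "linear (\<lambda>v. a * \<omega> (vs[i := v]))" if "length vs = k" "i < k" for vs i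
    using linear_compose_scale_right[OF alt_form_linear[OF assms that], of a] by simp
  then show ?thesis
    unfolding alt_form_def using assms by (simp add: alt_form_length alt_form_not_distinct)
qed

lemma alt_form_diff:
  assumes "alt_form k \<omega>" "alt_form k \<eta>"
  shows "alt_form k (\<lambda>vs. \<omega> vs - \<eta> vs)"
  using alt_form_add[OF assms(1) alt_form_scale[OF assms(2), of "-1"]] by simp

lemma alt_form_pullback:
  assumes "alt_form k \<omega>" "linear L"
  shows "alt_form k (\<lambda>vs. \<omega> (map L vs))"
proof (rule alt_formI)
  fix vs :: "vec7 list" and i assume *: "length vs = k" "i < k"
  have "linear ((\<lambda>v. \<omega> ((map L vs)[i := v])) \<circ> L)"
    using * by (intro linear_compose assms(2) alt_form_linear[OF assms(1)]) auto
  then show "linear (\<lambda>v. \<omega> (map L (vs[i := v])))"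
    by (simp add: o_def map_update)
next
  fix vs :: "vec7 list" and i assume *: "length vs = k" "Suc i < k" "vs ! i = vs ! Suc i"
  then have "\<not> distinct (map L vs)"
    using nth_eq_iff_index_eq[of "map L vs" i "Suc i"] by auto
  then show "\<omega> (map L vs) = 0" using alt_form_not_distinct assms by blast
qed (simp add: alt_form_length[OF assms(1)])

lemma alt_form_contract:
  assumes "alt_form (Suc k) \<omega>"
  shows "alt_form k (contract X \<omega>)"
proof (rule alt_formI)
  fix vs :: "vec7 list" and i assume *: "length vs = k" "i < k"
  then show "linear (\<lambda>v. contract X \<omega> (vs[i := v]))"
    using alt_form_linear[OF assms, of "X # vs" "Suc i"] by (simp add: contract_def)
next
  fix vs :: "vec7 list" and i assume *: "length vs = k" "Suc i < k" "vs ! i = vs ! Suc i"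
  then have "\<not> distinct (X # vs)"
    using nth_eq_iff_index_eq[of "vs" i "Suc i"] by auto
  then show "contract X \<omega> vs = 0" using alt_form_not_distinct assms by (auto simp: contract_def)
qed (simp add: alt_form_length[OF assms] contract_def)

lemma linear_vec7_expand:
  fixes f :: "vec7 \<Rightarrow> real"
  assumes "linear f"
  shows "f v = (\<Sum>i\<in>UNIV. v $ i * f (axis i 1))"
proof -
  have "f v = f (\<Sum>i\<in>UNIV. v $ i *s axis i 1)"
    by (simp add: basis_expansion)
  also have "\<dots> = (\<Sum>i\<in>UNIV. v $ i * f (axis i 1))"
    using assms by (simp add: linear_sum scalar_mult_eq_scaleR linear_cmul)
  finally show ?thesis .
qed

lemma alt_form_zero_of_basis:
  assumes "alt_form k \<omega>"
    and zero: "\<And>is. length is = k \<Longrightarrow> \<omega> (map (\<lambda>i. axis i 1) is) = 0"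
  shows "\<omega> vs = 0"
proof -
  \<comment> \<open>\<open>m\<close> counts the leading entries that may still be arbitrary vectors;
    each step expands the last of them in the basis.\<close>
  have *: "\<omega> vs = 0" if "length vs = k" "m \<le> k" "\<And>i. m \<le> i \<Longrightarrow> i < k \<Longrightarrow> vs ! i \<in> range (\<lambda>i. axis i 1)"
    for m vs using that
  proof (induction m arbitrary: vs)
    case 0
    then have "\<forall>i<k. \<exists>j. vs ! i = axis j 1" by auto
    then obtain J where "\<forall>i<k. vs ! i = axis (J i) 1" by metis
    then have "vs = map (\<lambda>i. axis i 1) (map J [0..<k])"
      using 0 by (intro nth_equalityI) auto
    then show ?case using zero by (metis diff_zero length_map length_upt)
  next
    case (Suc m)
    have "\<omega> vs = \<omega> (vs[m := vs ! m])" by simp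
    also have "\<dots> = (\<Sum>i\<in>UNIV. (vs ! m) $ i * \<omega> (vs[m := axis i 1]))"
      using Suc.prems by (intro linear_vec7_expand alt_form_linear[OF assms(1)]) auto
    also have "\<dots> = 0"
    proof (rule sum.neutral, rule ballI)
      fix j :: 7
      have "\<omega> (vs[m := axis j 1]) = 0"
        using Suc.prems by (intro Suc.IH) (auto simp: nth_list_update)
      then show "(vs ! m) $ j * \<omega> (vs[m := axis j 1]) = 0" by simp
    qed
    finally show ?case .
  qed
  show ?thesis
    using *[of vs k] alt_form_length[OF assms(1)] by (cases "length vs = k") auto
qed

text \<open>Selection sort: one swap puts the next entry of \<open>us\<close> into its place and
  changes only the sign. In the induction, \<open>m\<close> counts the places not yet known to agree
  with \<open>us\<close>.\<close>

lemma alt_form_zero_of_perm: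
  assumes "alt_form k \<omega>" "\<omega> us = 0" "distinct us" "length vs = length us" "set us \<subseteq> set vs"
  shows "\<omega> vs = 0"
proof -
  have *: "\<omega> vs = 0" if "length vs = length us" "set us \<subseteq> set vs"
    "m \<le> length us" "take (length us - m) vs = take (length us - m) us" for m vs
    using that
  proof (induction m arbitrary: vs)
    case 0
    then show ?case using assms by simp
  next
    case (Suc m)
    define a where "a = length us - Suc m"
    have a: "a < length us" "length us - m = Suc a" using Suc.prems by (auto simp: a_def)
    have ta: "take a vs = take a us" using Suc.prems by (simp add: a_def)
    obtain j where j: "j < length vs" "vs ! j = us ! a"
      using Suc.prems a by (metis in_set_conv_nth nth_mem subsetD)
    have "j \<ge> a"
    proof (rule ccontr)
      assume "\<not> j \<ge> a"
      then have "us ! j = us ! a" using j ta by (metis nth_take not_le)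
      then show False using assms(3) a j Suc.prems \<open>\<not> j \<ge> a\<close> nth_eq_iff_index_eq by (metis order_refl)
    qed
    show ?case
    proof (cases "j = a")
      case True
      have "take (length us - m) vs = take (length us - m) us"
        using a ta j True Suc.prems by (simp add: take_Suc_conv_app_nth)
      then show ?thesis using Suc.IH Suc.prems by auto
    next
      case False
      let ?vs = "vs[a := vs ! j, j := vs ! a]"
      have "?vs ! i = us ! i" if "i < Suc a" for i
        using that j False \<open>j \<ge> a\<close> Suc.prems a ta
        by (cases "i = a") (auto simp: nth_list_update less_Suc_eq dest: arg_cong[where f = "\<lambda>xs. xs ! i"])
      then have "take (length us - m) ?vs = take (length us - m) us"
        using a Suc.prems by (intro nth_equalityI) auto
      moreover have "set ?vs = set vs"
        using j a Suc.prems by (intro set_swap) auto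
      ultimately have "\<omega> ?vs = 0" using Suc.prems by (intro Suc.IH) auto
      then show ?thesis using alt_form_swap[OF assms(1), of a j vs] False \<open>j \<ge> a\<close> j by simp
    qed
  qed
  show ?thesis using *[of vs "length us"] assms by simp
qed

definition std_basis :: "vec7 list" where
  "std_basis = map (\<lambda>i. axis i 1) [1, 2, 3, 4, 5, 6, 7]"

lemma UNIV_7: "(UNIV :: 7 set) = {1, 2, 3, 4, 5, 6, 7}"
proof -
  have "card {1, 2, 3, 4, 5, 6, 7 :: 7} = card (UNIV :: 7 set)" by simp
  then show ?thesis by (metis card_subset_eq finite subset_UNIV)
qed

lemma alt_form_7_zero:
  assumes "alt_form 7 \<omega>" "\<omega> std_basis = 0"
  shows "\<omega> vs = 0"
proof (rule alt_form_zero_of_basis[OF assms(1)])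
  fix "is" :: "7 list" assume len: "length is = 7"
  show "\<omega> (map (\<lambda>i. axis i 1) is) = 0"
  proof (cases "distinct is")
    case False
    then have "\<not> distinct (map (\<lambda>i. axis i 1 :: vec7) is)" by (auto simp: distinct_map)
    then show ?thesis using alt_form_not_distinct assms by blast
  next
    case True
    have "set is = UNIV"
      by (rule card_subset_eq) (use True len in \<open>auto simp: distinct_card\<close>)
    then show ?thesis
      by (intro alt_form_zero_of_perm[OF assms])
        (auto simp: len std_basis_def distinct_map axis_eq_axis inj_on_def)
  qed
qed

lemma alt_form_7_eq:
  assumes "alt_form 7 \<omega>" "alt_form 7 \<eta>" "\<omega> std_basis = \<eta> std_basis"
  shows "\<omega> = \<eta>"
proof
  fix vs
  show "\<omega> vs = \<eta> vs"
    using alt_form_7_zero[OF alt_form_diff[OF assms(1,2)]] assms(3) by simp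
qed

section \<open>Wedge products are alternating: shuffles and their signs\<close>

lemma nths_list_update:
  assumes "i < length xs" "i \<in> S"
  shows "\<exists>j<length (nths xs S). \<forall>v. nths (xs[i := v]) S = (nths xs S)[j := v]"
  using assms
proof (induction xs arbitrary: i S)
  case Nil
  then show ?case by simp
next
  case (Cons x xs)
  show ?case
  proof (cases i)
    case 0
    then show ?thesis using Cons.prems by (intro exI[of _ 0]) (auto simp: nths_Cons)
  next
    case (Suc i')
    then obtain j where "j < length (nths xs {j. Suc j \<in> S})"
      "\<forall>v. nths (xs[i' := v]) {j. Suc j \<in> S} = (nths xs {j. Suc j \<in> S})[j := v]"
      using Cons.IH[of i' "{j. Suc j \<in> S}"] Cons.prems by auto
    then show ?thesis
      using Suc by (intro exI[of _ "if 0 \<in> S then Suc j else j"]) (auto simp: nths_Cons)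
  qed
qed

lemma nths_list_update_notin: "i \<notin> S \<Longrightarrow> nths (xs[i := v]) S = nths xs S"
proof (induction xs arbitrary: i S)
  case (Cons x xs)
  then show ?case by (cases i) (auto simp: nths_Cons)
qed simp

lemma not_distinct_nths:
  "i < j \<Longrightarrow> j < length xs \<Longrightarrow> i \<in> S \<Longrightarrow> j \<in> S \<Longrightarrow> xs ! i = xs ! j \<Longrightarrow> \<not> distinct (nths xs S)"
proof (induction xs arbitrary: i j S)
  case (Cons x xs)
  obtain j' where j: "j = Suc j'" using Cons.prems by (cases j) auto
  show ?case
  proof (cases i)
    case 0
    then have "x \<in> set (nths xs {j. Suc j \<in> S})"
      using Cons.prems j by (auto simp: set_nths)
    then show ?thesis using Cons.prems 0 by (auto simp: nths_Cons)
  next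
    case (Suc i')
    then show ?thesis using Cons.IH[of i' j' "{j. Suc j \<in> S}"] Cons.prems j by (auto simp: nths_Cons)
  qed
qed simp

text \<open>One half of the pairing of shuffles: moving a selected position to an equal neighbour
  leaves the selected list as it was.\<close>

lemma nths_shift_one:
  "Suc i < length xs \<Longrightarrow> xs ! i = xs ! Suc i \<Longrightarrow> i \<in> S \<Longrightarrow> Suc i \<notin> S \<Longrightarrow>
    nths xs (insert (Suc i) (S - {i})) = nths xs S"
proof (induction xs arbitrary: i S)
  case (Cons x xs)
  show ?case
  proof (cases i)
    case 0
    then obtain ys where "xs = x # ys" using Cons.prems by (cases xs) auto
    then show ?thesis using Cons.prems 0 by (auto simp: nths_Cons intro: arg_cong[where f = "nths ys"])
  next
    case (Suc i')
    have "{j. Suc j \<in> insert (Suc i) (S - {i})} = insert (Suc i') ({j. Suc j \<in> S} - {i'})"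
      using Suc by auto
    then show ?thesis using Cons.IH[of i' "{j. Suc j \<in> S}"] Cons.prems Suc by (auto simp: nths_Cons)
  qed
qed simp

text \<open>The transposition \<tau> of i and Suc i maps the inversions of S bijectively to those of
  T other than (Suc i, i), which is new. So the two shuffles have opposite signs.\<close>

lemma shuffle_sign_shift_one:
  assumes "Suc i < n" "i \<in> S" "Suc i \<notin> S" "S \<subseteq> {..<n}"
    and T: "T = insert (Suc i) (S - {i})"
  shows "card {(a, b). a \<in> T \<and> b \<in> {..<n} - T \<and> b < a}
    = Suc (card {(a, b). a \<in> S \<and> b \<in> {..<n} - S \<and> b < a})"
proof -
  define I where "I S = {(a, b). a \<in> S \<and> b \<in> {..<n} - S \<and> b < a}" for S
  define \<tau> where "\<tau> x = (if x = i then Suc i else if x = Suc i then i else x)" for x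
  have \<tau>: "\<tau> i = Suc i" "\<tau> (Suc i) = i" "\<And>x. x \<noteq> i \<Longrightarrow> x \<noteq> Suc i \<Longrightarrow> \<tau> x = x" "inj \<tau>" "\<And>x. \<tau> (\<tau> x) = x"
    by (auto simp: \<tau>_def inj_def)
  have fin: "finite (I S)"
    by (rule finite_subset[of _ "{..<n} \<times> {..<n}"]) (use assms in \<open>auto simp: I_def\<close>)
  have "I T = insert (Suc i, i) (map_prod \<tau> \<tau> ` I S)"
  proof (intro set_eqI iffI)
    fix p assume "p \<in> I T"
    then obtain a b where p: "p = (a, b)" "a \<in> T" "b < n" "b \<notin> T" "b < a" by (auto simp: I_def)
    have "p = (Suc i, i) \<or> (\<tau> a, \<tau> b) \<in> I S"
      using p assms \<tau> unfolding I_def T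
      by (cases "a = Suc i"; cases "b = i"; cases "b = Suc i"; cases "a = i") auto
    moreover have "p = map_prod \<tau> \<tau> (\<tau> a, \<tau> b)" using p \<tau> by simp
    ultimately show "p \<in> insert (Suc i, i) (map_prod \<tau> \<tau> ` I S)" by blast
  next
    fix p assume "p \<in> insert (Suc i, i) (map_prod \<tau> \<tau> ` I S)"
    then consider "p = (Suc i, i)" | a b where "p = (\<tau> a, \<tau> b)" "(a, b) \<in> I S" by auto
    then show "p \<in> I T"
    proof cases
      case 1
      then show ?thesis using assms by (auto simp: I_def)
    next
      case 2
      then have "a \<in> S" "b < n" "b \<notin> S" "b < a" by (auto simp: I_def)
      then show ?thesis using 2 assms \<tau> unfolding I_def T
        by (cases "a = Suc i"; cases "b = i"; cases "b = Suc i"; cases "a = i") auto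
    qed
  qed
  moreover have "(Suc i, i) \<notin> map_prod \<tau> \<tau> ` I S"
  proof
    assume "(Suc i, i) \<in> map_prod \<tau> \<tau> ` I S"
    then obtain a b where "(a, b) \<in> I S" "\<tau> a = Suc i" "\<tau> b = i" by auto
    then have "a = i" "b = Suc i" using \<tau> by metis+
    then show False using \<open>(a, b) \<in> I S\<close> by (auto simp: I_def)
  qed
  moreover have "card (map_prod \<tau> \<tau> ` I S) = card (I S)"
    using \<tau>(4) by (intro card_image) (auto simp: inj_on_def)
  ultimately show ?thesis unfolding I_def[symmetric] using fin by simp
qed

lemma length_nths_subset: "S \<subseteq> {..<length vs} \<Longrightarrow> length (nths vs S) = card S"
  by (auto simp: length_nths intro: arg_cong[where f = card])

lemma length_nths_Compl:
  assumes "S \<subseteq> {..<length vs}" shows "length (nths vs (- S)) = length vs - card S"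
proof -
  have "{i. i < length vs \<and> i \<in> - S} = {..<length vs} - S" by auto
  then show ?thesis using assms by (simp add: length_nths card_Diff_subset finite_subset)
qed

text \<open>For equal neighbours i and Suc i, a shuffle that sends both to one factor contributes
  zero, as that factor is alternating. The others form pairs S, T S with equal values and opposite
  signs.\<close>

lemma alt_form_wedge:
  assumes om: "alt_form k \<omega>" and et: "alt_form l \<eta>"
  shows "alt_form (k + l) (wedge \<omega> \<eta>)"
proof (rule alt_formI)
  fix vs :: "vec7 list" assume len: "length vs \<noteq> k + l"
  have "\<omega> (nths vs S) * \<eta> (nths vs (- S)) = 0" if "S \<in> Pow {..<length vs}" for S
  proof -
    have "card S \<le> length vs" using that card_mono[of "{..<length vs}" S] by simp
    then have "length (nths vs S) \<noteq> k \<or> length (nths vs (- S)) \<noteq> l"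
      using that len length_nths_subset[of S vs] length_nths_Compl[of S vs] by auto
    then show ?thesis using om et by (auto simp: alt_form_length)
  qed
  then show "wedge \<omega> \<eta> vs = 0"
    unfolding wedge_def by (intro sum.neutral) (auto simp: mult.assoc)
next
  fix vs :: "vec7 list" and i assume len: "length vs = k + l" "i < k + l"
  have "linear (\<lambda>v. c * \<omega> (nths (vs[i := v]) S) * \<eta> (nths (vs[i := v]) (- S)))"
    if "S \<in> Pow {..<length vs}" for S c
  proof (cases "i \<in> S")
    case True
    then have "nths (vs[i := v]) (- S) = nths vs (- S)" for v by (simp add: nths_list_update_notin)
    moreover obtain j where "j < length (nths vs S)" "\<And>v. nths (vs[i := v]) S = (nths vs S)[j := v]"
      using nths_list_update[of i vs S] True len by auto
    moreover from this have "linear (\<lambda>v. \<omega> ((nths vs S)[j := v]))"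
      using alt_form_linear[OF om, of "nths vs S" j]
      by (cases "length (nths vs S) = k") (auto simp: alt_form_length[OF om] linear_zero)
    then have "linear (\<lambda>v. (c * \<eta> (nths vs (- S))) * \<omega> ((nths vs S)[j := v]))"
      using linear_compose_scale_right[where c = "c * \<eta> (nths vs (- S))"] by fastforce
    ultimately show ?thesis by (simp add: mult_ac)
  next
    case False
    then have "nths (vs[i := v]) S = nths vs S" for v by (simp add: nths_list_update_notin)
    moreover obtain j where "j < length (nths vs (- S))"
        "\<And>v. nths (vs[i := v]) (- S) = (nths vs (- S))[j := v]"
      using nths_list_update[of i vs "- S"] False len by auto
    moreover from this have "linear (\<lambda>v. \<eta> ((nths vs (- S))[j := v]))"
      using alt_form_linear[OF et, of "nths vs (- S)" j]
      by (cases "length (nths vs (- S)) = l") (auto simp: alt_form_length[OF et] linear_zero)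
    then have "linear (\<lambda>v. (c * \<omega> (nths vs S)) * \<eta> ((nths vs (- S))[j := v]))"
      using linear_compose_scale_right[where c = "c * \<omega> (nths vs S)"] by fastforce
    ultimately show ?thesis by (simp add: mult_ac)
  qed
  then show "linear (\<lambda>v. wedge \<omega> \<eta> (vs[i := v]))"
    unfolding wedge_def length_list_update by (intro linear_compose_sum) auto
next
  fix vs :: "vec7 list" and i
  assume len: "length vs = k + l" "Suc i < k + l" and eq: "vs ! i = vs ! Suc i"
  let ?n = "length vs"
  define f where "f S = (-1) ^ card {(i, j). i \<in> S \<and> j \<in> {..<length vs} - S \<and> j < i}
        * \<omega> (nths vs S) * \<eta> (nths vs (- S))" for S
  define A where "A = {S \<in> Pow {..<?n}. i \<in> S \<and> Suc i \<notin> S}"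
  define B where "B = {S \<in> Pow {..<?n}. i \<notin> S \<and> Suc i \<in> S}"
  define T where "T S = insert (Suc i) (S - {i})" for S
  have fT: "f (T S) = - f S" if "S \<in> A" for S
  proof -
    have S: "i \<in> S" "Suc i \<notin> S" "S \<subseteq> {..<?n}" using that by (auto simp: A_def)
    have "nths vs (T S) = nths vs S"
      unfolding T_def using S len eq by (intro nths_shift_one) auto
    \<comment> \<open>The complement of T S contains i and not Suc i, so the shift applies to it as
      well and leads back to the complement of S.\<close>
    moreover have "nths vs (insert (Suc i) (- T S - {i})) = nths vs (- T S)"
      using S len eq by (intro nths_shift_one) (auto simp: T_def)
    moreover have "insert (Suc i) (- T S - {i}) = - S" using S by (auto simp: T_def)
    ultimately show ?thesis
      using shuffle_sign_shift_one[of i ?n S "T S"] S len by (simp add: f_def T_def)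
  qed
  have other: "f S = 0" if "S \<in> Pow {..<?n} - (A \<union> B)" for S
  proof (cases "i \<in> S")
    case True
    then have "\<not> distinct (nths vs S)"
      using that len eq by (intro not_distinct_nths[of i "Suc i"]) (auto simp: A_def B_def)
    then show ?thesis using alt_form_not_distinct[OF om] by (simp add: f_def)
  next
    case False
    then have "\<not> distinct (nths vs (- S))"
      using that len eq by (intro not_distinct_nths[of i "Suc i"]) (auto simp: A_def B_def)
    then show ?thesis using alt_form_not_distinct[OF et] by (simp add: f_def)
  qed
  have "bij_betw T A B"
    by (rule bij_betw_byWitness[where f' = "\<lambda>S. insert i (S - {Suc i})"])
      (use len in \<open>auto simp: A_def B_def T_def\<close>)
  then have "sum f B = (\<Sum>S\<in>A. f (T S))"
    by (simp add: sum.reindex_bij_betw)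
  also have "\<dots> = - sum f A" using fT by (simp add: sum_negf)
  finally have "sum f (A \<union> B) = 0"
    by (subst sum.union_disjoint) (auto simp: A_def B_def)
  moreover have "sum f (Pow {..<?n}) = sum f (A \<union> B)"
    using other by (intro sum.mono_neutral_right) (auto simp: A_def B_def)
  ultimately show "wedge \<omega> \<eta> vs = 0" by (simp add: wedge_def f_def)
qed

lemma wedge_map:
  "wedge (\<lambda>vs. \<omega> (map L vs)) (\<lambda>vs. \<eta> (map L vs)) vs = wedge \<omega> \<eta> (map L vs)"
  by (simp add: wedge_def nths_map)

section \<open>The model 3-form on basis vectors\<close>

lemma wedge_Nil: "wedge \<omega> \<eta> [] = \<omega> [] * \<eta> []"
  by (simp add: wedge_def)

text \<open>Position 0 goes to one of the two factors. If it goes to the second, every element of S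
  has to pass it, which gives the sign (-1)^card S. As \<open>card S\<close> is the length of the
  list seen by the first factor, the sign can be stored in that factor without reference to a
  degree.\<close>

lemma wedge_Cons:
  "wedge \<omega> \<eta> (v # vs) =
    wedge (contract v \<omega>) \<eta> vs + wedge (\<lambda>us. (-1) ^ length us * \<omega> us) (contract v \<eta>) vs"
proof -
  let ?n = "length vs"
  define I where "I n S = {(i, j). i \<in> S \<and> j \<in> {..<n} - S \<and> j < i}" for n :: nat and S
  define f where "f S = (-1) ^ card (I (Suc ?n) S) * \<omega> (nths (v # vs) S) * \<eta> (nths (v # vs) (- S))" for S
  have I1: "card (I (Suc n) (insert 0 (Suc ` S))) = card (I n S)" for n S
  proof -
    have "I (Suc n) (insert 0 (Suc ` S)) = map_prod Suc Suc ` I n S"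
      by (auto simp: I_def image_iff less_Suc_eq_0_disj)
    then show ?thesis by (auto intro!: card_image inj_onI)
  qed
  have I2: "card (I (Suc n) (Suc ` S)) = card S + card (I n S)" if S: "S \<subseteq> {..<n}" for n S
  proof -
    have "I (Suc n) (Suc ` S) = map_prod Suc Suc ` I n S \<union> (\<lambda>i. (Suc i, 0)) ` S"
      by (auto simp: I_def image_iff less_Suc_eq_0_disj)
    moreover have "finite (I n S)" "finite S"
      by (rule finite_subset[of _ "{..<n} \<times> {..<n}"]) (use S finite_subset in \<open>auto simp: I_def\<close>)
    moreover have "card (map_prod Suc Suc ` I n S) = card (I n S)" "card ((\<lambda>i. (Suc i, 0::nat)) ` S) = card S"
      by (auto intro!: card_image inj_onI)
    moreover have "map_prod Suc Suc ` I n S \<inter> (\<lambda>i. (Suc i, 0)) ` S = {}" by auto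
    ultimately show ?thesis by (simp add: card_Un_disjoint)
  qed
  have "Pow {..<Suc ?n} = insert 0 ` Pow (Suc ` {..<?n}) \<union> Pow (Suc ` {..<?n})"
    by (simp only: lessThan_Suc_eq_insert_0 Pow_insert Un_commute)
  moreover have "Pow (Suc ` {..<?n}) = (`) Suc ` Pow {..<?n}"
    by (rule image_Pow_surj[OF refl, symmetric])
  ultimately have P: "Pow {..<Suc ?n} = (\<lambda>S. insert 0 (Suc ` S)) ` Pow {..<?n} \<union> (`) Suc ` Pow {..<?n}"
    by (simp add: image_image)
  have inj1: "inj_on (\<lambda>S. insert 0 (Suc ` S)) (Pow {..<?n})"
    by (auto simp: inj_on_def insert_ident inj_image_eq_iff)
  have inj2: "inj_on ((`) Suc) (Pow {..<?n})"
    by (auto simp: inj_on_def inj_image_eq_iff)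
  have c1: "{j. Suc j \<in> - insert 0 (Suc ` S)} = - S" "{j. Suc j \<in> - (Suc ` S)} = - S"
    "{j. Suc j \<in> insert 0 (Suc ` S)} = S" "{j. Suc j \<in> Suc ` S} = S"
    "{j. Suc j \<notin> Suc ` S} = - S" for S by auto
  have "wedge \<omega> \<eta> (v # vs) = sum f (Pow {..<Suc ?n})"
    by (simp add: wedge_def f_def I_def)
  also have "\<dots> = (\<Sum>S\<in>Pow {..<?n}. f (insert 0 (Suc ` S))) + (\<Sum>S\<in>Pow {..<?n}. f (Suc ` S))"
    unfolding P
    by (subst sum.union_disjoint) (auto simp: sum.reindex[OF inj1] sum.reindex[OF inj2])
  also have "(\<Sum>S\<in>Pow {..<?n}. f (insert 0 (Suc ` S))) = wedge (contract v \<omega>) \<eta> vs"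
    unfolding wedge_def f_def I1 by (simp add: nths_Cons c1 contract_def I_def)
  also have "(\<Sum>S\<in>Pow {..<?n}. f (Suc ` S)) = wedge (\<lambda>us. (-1) ^ length us * \<omega> us) (contract v \<eta>) vs"
    unfolding wedge_def f_def
    by (rule sum.cong[OF refl], subst I2)
      (auto simp: nths_Cons c1 contract_def I_def power_add length_nths_subset mult_ac)
  finally show ?thesis .
qed

lemma wedge_scale_left: "wedge (\<lambda>us. a * \<omega> us) \<eta> vs = a * wedge \<omega> \<eta> vs"
  by (simp add: wedge_def sum_distrib_left mult_ac)

text \<open>The part of \<open>alt_form\<close> that fixes the sign in \<open>wedge_Cons\<close>; it
  survives contraction.\<close>

definition homogeneous :: "nat \<Rightarrow> cov \<Rightarrow> bool" where
  "homogeneous k \<omega> \<longleftrightarrow> (\<forall>vs. length vs \<noteq> k \<longrightarrow> \<omega> vs = 0)"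

lemma homogeneous_contract: "homogeneous (Suc k) \<omega> \<Longrightarrow> homogeneous k (contract v \<omega>)"
  by (simp add: homogeneous_def contract_def)

lemma alt_form_homogeneous: "alt_form k \<omega> \<Longrightarrow> homogeneous k \<omega>"
  by (simp add: homogeneous_def alt_form_length)

lemma wedge_zero_left: "(\<And>us. \<omega> us = 0) \<Longrightarrow> wedge \<omega> \<eta> vs = 0"
  by (simp add: wedge_def)

lemma homogeneous_sign: "homogeneous k \<omega> \<Longrightarrow> (\<lambda>us. (-1) ^ length us * \<omega> us) = (\<lambda>us. (-1) ^ k * \<omega> us)"
  by (auto simp: homogeneous_def fun_eq_iff)

lemma wedge_homogeneous_0: "homogeneous 0 \<omega> \<Longrightarrow> wedge \<omega> \<eta> vs = \<omega> [] * \<eta> vs"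
proof (induction vs arbitrary: \<eta>)
  case Nil
  then show ?case by (simp add: wedge_Nil)
next
  case (Cons v vs)
  have "wedge (contract v \<omega>) \<eta> vs = 0"
    using Cons.prems by (intro wedge_zero_left) (simp add: homogeneous_def contract_def)
  then show ?case
    using Cons by (simp add: wedge_Cons homogeneous_sign[OF Cons.prems] contract_def)
qed

lemma wedge_homogeneous_Nil: "homogeneous (Suc k) \<omega> \<Longrightarrow> wedge \<omega> \<eta> [] = 0"
  by (simp add: wedge_Nil homogeneous_def)

lemma wedge_homogeneous_Cons:
  "homogeneous k \<omega> \<Longrightarrow> wedge \<omega> \<eta> (v # vs) =
    wedge (contract v \<omega>) \<eta> vs + (-1) ^ k * wedge \<omega> (contract v \<eta>) vs"
  by (simp add: wedge_Cons homogeneous_sign wedge_scale_left)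

section \<open>Evaluation on basis vectors, with an index type that computes by pattern
  matching\<close>

datatype idx = I1 | I2 | I3 | I4 | I5 | I6 | I7

primrec idx7 :: "idx \<Rightarrow> 7" where
  "idx7 I1 = 1" | "idx7 I2 = 2" | "idx7 I3 = 3" | "idx7 I4 = 4" | "idx7 I5 = 5" | "idx7 I6 = 6" | "idx7 I7 = 7"

definition idxs :: "idx list" where
  "idxs = [I1, I2, I3, I4, I5, I6, I7]"

lemma set_idxs: "set idxs = UNIV"
proof -
  have "x \<in> set idxs" for x by (cases x) (auto simp: idxs_def)
  then show ?thesis by auto
qed

lemma idx7_eq_iff: "idx7 a = idx7 b \<longleftrightarrow> a = b"
  by (cases a; cases b) simp_all

lemma bij_idx7: "bij idx7"
proof -
  have "range idx7 = UNIV"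
    unfolding set_idxs[symmetric] UNIV_7 by (simp add: idxs_def)
  then show ?thesis by (auto simp: bij_def inj_def idx7_eq_iff)
qed

lemma sum_UNIV_7: "(\<Sum>i\<in>UNIV. f i) = sum_list (map (\<lambda>a. f (idx7 a)) idxs)"
proof -
  have "(\<Sum>i\<in>UNIV. f i) = (\<Sum>a\<in>UNIV. f (idx7 a))"
    by (rule sum.reindex_bij_betw[OF bij_idx7, symmetric])
  also have "\<dots> = sum_list (map (\<lambda>a. f (idx7 a)) idxs)"
    unfolding set_idxs[symmetric] by (rule sum_list_distinct_conv_sum_set[symmetric]) (simp add: idxs_def)
  finally show ?thesis .
qed

abbreviation bvec :: "idx \<Rightarrow> vec7" where
  "bvec a \<equiv> axis (idx7 a) 1"

definition on_basis :: "cov \<Rightarrow> (idx list \<Rightarrow> int) \<Rightarrow> bool" where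
  "on_basis \<omega> F \<longleftrightarrow> (\<forall>is. \<omega> (map bvec is) = of_int (F is))"

lemma on_basis_contract: "on_basis \<omega> F \<Longrightarrow> on_basis (contract (bvec a) \<omega>) (\<lambda>is. F (a # is))"
  unfolding on_basis_def contract_def by (metis list.simps(9))

text \<open>
  Correct if \<open>F\<close> vanishes on lists of length other than \<open>k\<close>. Testing \<open>F []\<close> before evaluating \<open>G\<close>
  prunes almost all shuffles, which keeps the evaluations below feasible.
\<close>

fun wedge_code :: "nat \<Rightarrow> (idx list \<Rightarrow> int) \<Rightarrow> (idx list \<Rightarrow> int) \<Rightarrow> idx list \<Rightarrow> int" where
  "wedge_code 0 F G is = (let c = F [] in if c = 0 then 0 else c * G is)"
| "wedge_code (Suc k) F G [] = 0"
| "wedge_code (Suc k) F G (a # is) =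
     wedge_code k (\<lambda>js. F (a # js)) G is
     + (if even k then - 1 else 1) * wedge_code (Suc k) F (\<lambda>js. G (a # js)) is"

lemma wedge_code_correct:
  assumes "on_basis \<omega> F" "on_basis \<eta> G" "homogeneous k \<omega>"
  shows "on_basis (wedge \<omega> \<eta>) (wedge_code k F G)"
proof -
  have "wedge \<omega> \<eta> (map bvec is) = of_int (wedge_code k F G is)" for "is"
    using assms
  proof (induction k F G "is" arbitrary: \<omega> \<eta> rule: wedge_code.induct)
    case (1 F G "is")
    then have "\<omega> [] = of_int (F [])" "\<eta> (map bvec is) = of_int (G is)"
      by (auto simp: on_basis_def dest: spec[of _ "[]"])
    then show ?case using 1 by (simp add: wedge_homogeneous_0 Let_def)
  next
    case (2 k F G)
    then show ?case by (simp add: wedge_homogeneous_Nil)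
  next
    case (3 k F G a "is")
    show ?case
      using 3 by (simp add: wedge_homogeneous_Cons on_basis_contract homogeneous_contract)
  qed
  then show ?thesis by (simp add: on_basis_def)
qed

definition dx_code :: "idx \<Rightarrow> idx list \<Rightarrow> int" where
  "dx_code a is = (case is of [b] \<Rightarrow> (if a = b then 1 else 0) | _ \<Rightarrow> 0)"

lemma on_basis_dx: "on_basis (dx (idx7 a)) (dx_code a)"
  by (auto simp: on_basis_def dx_def dx_code_def axis_def idx7_eq_iff length_Suc_conv split: list.splits)

lemma alt_form_dx: "alt_form 1 (dx i)"
proof (rule alt_formI)
  fix vs :: "vec7 list" and j assume "length vs = 1" "j < (1::nat)"
  then show "linear (\<lambda>v. dx i (vs[j := v]))"
    by (cases vs) (auto simp: dx_def intro: linearI)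
qed (auto simp: dx_def)

lemma alt_form_dx3: "alt_form 3 (dx3 i j k)"
  using alt_form_wedge[OF alt_form_dx alt_form_wedge[OF alt_form_dx alt_form_dx]]
  by (simp add: dx3_def numeral_3_eq_3)

lemma alt_form_phi0: "alt_form 3 phi0"
proof -
  have eq: "phi0 = (\<lambda>vs. dx3 1 2 3 vs + dx3 1 4 5 vs + dx3 1 6 7 vs
     + dx3 2 4 6 vs - dx3 2 5 7 vs - dx3 3 4 7 vs - dx3 3 5 6 vs)"
    by (simp add: fun_eq_iff phi0_def)
  show ?thesis unfolding eq by (intro alt_form_add alt_form_diff alt_form_dx3)
qed

definition dx3_code :: "idx \<Rightarrow> idx \<Rightarrow> idx \<Rightarrow> idx list \<Rightarrow> int" where
  "dx3_code a b c = wedge_code 1 (dx_code a) (wedge_code 1 (dx_code b) (dx_code c))"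

lemma on_basis_dx3: "on_basis (dx3 (idx7 a) (idx7 b) (idx7 c)) (dx3_code a b c)"
  unfolding dx3_def dx3_code_def
  by (intro wedge_code_correct on_basis_dx alt_form_homogeneous alt_form_dx)

text \<open>
  \<open>phi0\<close> on \<open>e\<^sub>a, e\<^sub>b, e\<^sub>c\<close> is the coefficient of \<open>e\<^sub>c\<close> in the product of the imaginary octonion units
  \<open>e\<^sub>a\<close> and \<open>e\<^sub>b\<close>. The diagonal entries have coefficient 0, so that their second component is irrelevant.
\<close>

definition octonion :: "idx \<Rightarrow> idx \<Rightarrow> int \<times> idx" where
  "octonion a b = (case a of
       I1 \<Rightarrow> (case b of I1 \<Rightarrow> (0, I1) | I2 \<Rightarrow> (1, I3) | I3 \<Rightarrow> (- 1, I2) | I4 \<Rightarrow> (1, I5) | I5 \<Rightarrow> (- 1, I4) | I6 \<Rightarrow> (1, I7) | I7 \<Rightarrow> (- 1, I6))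
     | I2 \<Rightarrow> (case b of I1 \<Rightarrow> (- 1, I3) | I2 \<Rightarrow> (0, I1) | I3 \<Rightarrow> (1, I1) | I4 \<Rightarrow> (1, I6) | I5 \<Rightarrow> (- 1, I7) | I6 \<Rightarrow> (- 1, I4) | I7 \<Rightarrow> (1, I5))
     | I3 \<Rightarrow> (case b of I1 \<Rightarrow> (1, I2) | I2 \<Rightarrow> (- 1, I1) | I3 \<Rightarrow> (0, I1) | I4 \<Rightarrow> (- 1, I7) | I5 \<Rightarrow> (- 1, I6) | I6 \<Rightarrow> (1, I5) | I7 \<Rightarrow> (1, I4))
     | I4 \<Rightarrow> (case b of I1 \<Rightarrow> (- 1, I5) | I2 \<Rightarrow> (- 1, I6) | I3 \<Rightarrow> (1, I7) | I4 \<Rightarrow> (0, I1) | I5 \<Rightarrow> (1, I1) | I6 \<Rightarrow> (1, I2) | I7 \<Rightarrow> (- 1, I3))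
     | I5 \<Rightarrow> (case b of I1 \<Rightarrow> (1, I4) | I2 \<Rightarrow> (1, I7) | I3 \<Rightarrow> (1, I6) | I4 \<Rightarrow> (- 1, I1) | I5 \<Rightarrow> (0, I1) | I6 \<Rightarrow> (- 1, I3) | I7 \<Rightarrow> (- 1, I2))
     | I6 \<Rightarrow> (case b of I1 \<Rightarrow> (- 1, I7) | I2 \<Rightarrow> (1, I4) | I3 \<Rightarrow> (- 1, I5) | I4 \<Rightarrow> (- 1, I2) | I5 \<Rightarrow> (1, I3) | I6 \<Rightarrow> (0, I1) | I7 \<Rightarrow> (1, I1))
     | I7 \<Rightarrow> (case b of I1 \<Rightarrow> (1, I6) | I2 \<Rightarrow> (- 1, I5) | I3 \<Rightarrow> (- 1, I4) | I4 \<Rightarrow> (1, I3) | I5 \<Rightarrow> (1, I2) | I6 \<Rightarrow> (- 1, I1) | I7 \<Rightarrow> (0, I1)))"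

fun phi0_code :: "idx list \<Rightarrow> int" where
  "phi0_code [a, b, c] = (let (s, d) = octonion a b in if c = d then s else 0)"
| "phi0_code _ = 0"

definition phi0_naive :: "idx list \<Rightarrow> int" where
  "phi0_naive is = dx3_code I1 I2 I3 is + dx3_code I1 I4 I5 is + dx3_code I1 I6 I7 is
     + dx3_code I2 I4 I6 is - dx3_code I2 I5 I7 is - dx3_code I3 I4 I7 is - dx3_code I3 I5 I6 is"

text \<open>Check of the octonion table against the shuffle formula on all 343 triples; later
  evaluations use only the table.\<close>

lemma phi0_code_naive:
  "list_all (\<lambda>a. list_all (\<lambda>b. list_all (\<lambda>c. phi0_code [a, b, c] = phi0_naive [a, b, c]) idxs) idxs) idxs"
  by code_simp

lemma on_basis_phi0: "on_basis phi0 phi0_code"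
proof -
  have "on_basis phi0 phi0_naive"
    using on_basis_dx3[of I1 I2 I3] on_basis_dx3[of I1 I4 I5] on_basis_dx3[of I1 I6 I7]
     on_basis_dx3[of I2 I4 I6] on_basis_dx3[of I2 I5 I7] on_basis_dx3[of I3 I4 I7] on_basis_dx3[of I3 I5 I6]
    by (simp add: on_basis_def phi0_def phi0_naive_def)
  moreover have "phi0_naive [a, b, c] = phi0_code [a, b, c]" for a b c
    using phi0_code_naive by (simp add: list_all_iff set_idxs)
  moreover have "phi0 (map bvec is) = of_int (phi0_code is)" if "length is \<noteq> 3" for "is"
    using that alt_form_length[OF alt_form_phi0]
    by (cases "is" rule: phi0_code.cases) auto
  moreover have "\<exists>a b c. is = [a, b, c]" if "length is = 3" for "is" :: "idx list"
    using that by (auto simp: length_Suc_conv numeral_3_eq_3)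
  ultimately show ?thesis
    unfolding on_basis_def by (smt (verit, best))
qed

section \<open>The coordinate volume form through permutation signs\<close>

primrec dxs :: "idx list \<Rightarrow> cov" where
  "dxs [] = (\<lambda>vs. if vs = [] then 1 else 0)"
| "dxs (a # as) = wedge (dx (idx7 a)) (dxs as)"

lemma alt_form_dxs: "alt_form (length as) (dxs as)"
proof (induction as)
  case Nil
  then show ?case by (auto simp: alt_form_def)
next
  case (Cons a as)
  then show ?case using alt_form_wedge[OF alt_form_dx Cons] by simp
qed

text \<open>The boolean tells whether \<open>a\<close> is at an even position, i.e. whether moving it to the front is an even permutation.\<close>

fun pick :: "idx \<Rightarrow> idx list \<Rightarrow> (bool \<times> idx list) option" where
  "pick a [] = None"
| "pick a (b # is) = (if b = a then Some (True, is) else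
     (case pick a is of None \<Rightarrow> None | Some (s, js) \<Rightarrow> Some (\<not> s, b # js)))"

fun perm_sign :: "idx list \<Rightarrow> idx list \<Rightarrow> int" where
  "perm_sign [] is = (if is = [] then 1 else 0)"
| "perm_sign (a # as) is = (case pick a is of None \<Rightarrow> 0
     | Some (s, js) \<Rightarrow> if s then perm_sign as js else - perm_sign as js)"

lemma pick_eq_None: "a \<notin> set is \<Longrightarrow> pick a is = None"
  by (induction "is") auto

lemma set_pick: "pick a is = Some (s, js) \<Longrightarrow> set js \<subseteq> set is"
  by (induction "is" arbitrary: s js) (auto split: if_splits option.splits)

lemma distinct_pick: "pick a is = Some (s, js) \<Longrightarrow> distinct is \<Longrightarrow> distinct js"
  by (induction "is" arbitrary: s js) (auto split: if_splits option.splits dest: set_pick[THEN subsetD])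

text \<open>On distinct basis vectors at most one shuffle survives, the one that gives
  \<open>bvec a\<close> to the first factor. A linear search for \<open>a\<close> thus replaces the
  sum over shuffles, which keeps 7-forms cheap to evaluate.\<close>

lemma dx_wedge_pick:
  assumes "distinct is"
  shows "wedge (dx (idx7 a)) \<omega> (map bvec is) = (case pick a is of None \<Rightarrow> 0
     | Some (s, js) \<Rightarrow> if s then \<omega> (map bvec js) else - \<omega> (map bvec js))"
  using assms
proof (induction "is" arbitrary: \<omega>)
  case Nil
  then show ?case by (simp add: wedge_Nil dx_def)
next
  case (Cons b "is")
  have h: "homogeneous 1 (dx (idx7 a))" by (simp add: homogeneous_def dx_def)
  then have "homogeneous 0 (contract (bvec b) (dx (idx7 a)))"
    by (simp add: homogeneous_def dx_def contract_def)
  then have *: "wedge (contract (bvec b) (dx (idx7 a))) \<omega> vs = (if a = b then \<omega> vs else 0)" for vs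
    by (simp add: wedge_homogeneous_0 contract_def dx_def axis_def idx7_eq_iff)
  have "wedge (dx (idx7 a)) \<omega> (map bvec (b # is)) = (if a = b then \<omega> (map bvec is) else 0)
      - wedge (dx (idx7 a)) (contract (bvec b) \<omega>) (map bvec is)"
    by (simp add: wedge_homogeneous_Cons[OF h] *)
  also have "wedge (dx (idx7 a)) (contract (bvec b) \<omega>) (map bvec is) = (case pick a is of None \<Rightarrow> 0
     | Some (s, js) \<Rightarrow> if s then contract (bvec b) \<omega> (map bvec js) else - contract (bvec b) \<omega> (map bvec js))"
    using Cons.prems by (intro Cons.IH) simp
  also have "\<dots> = (case pick a is of None \<Rightarrow> 0
     | Some (s, js) \<Rightarrow> if s then \<omega> (map bvec (b # js)) else - \<omega> (map bvec (b # js)))"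
    by (simp add: contract_def split: option.split)
  finally show ?case
    using Cons.prems by (auto simp: pick_eq_None split: option.splits)
qed

lemma dxs_basis: "distinct is \<Longrightarrow> dxs as (map bvec is) = of_int (perm_sign as is)"
proof (induction as arbitrary: "is")
  case (Cons a as)
  then show ?case
    by (auto simp: dx_wedge_pick dest: distinct_pick split: option.splits)
qed simp

definition vol0 :: cov where
  "vol0 = dxs idxs"

lemma alt_form_vol0: "alt_form 7 vol0"
  using alt_form_dxs[of idxs] by (simp add: vol0_def idxs_def eval_nat_numeral del: dxs.simps)

text \<open>\<open>perm_sign\<close> is known to be correct on distinct lists only; on all others
  alternation forces the value 0.\<close>

definition vol0_code :: "idx list \<Rightarrow> int" where
  "vol0_code is = (if distinct is then perm_sign idxs is else 0)"

lemma on_basis_vol0: "on_basis vol0 vol0_code"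
proof -
  have "vol0 (map bvec is) = 0" if "\<not> distinct is" for "is"
    using that alt_form_not_distinct[OF alt_form_vol0] by (simp add: distinct_map)
  then show ?thesis by (simp add: on_basis_def vol0_code_def vol0_def dxs_basis)
qed

lemma std_basis_idxs: "std_basis = map bvec idxs"
  by (simp add: std_basis_def idxs_def)

lemma vol0_std_basis: "vol0 std_basis = 1"
proof -
  have "vol0_code idxs = 1" by code_simp
  then show ?thesis using on_basis_vol0 by (simp add: on_basis_def std_basis_idxs)
qed

text \<open>The 49 coefficients of the defining equation of the metric. A 7-form is determined by
  its value on the standard basis, hence the single argument \<open>idxs\<close>; 4 and 2 are the
  degrees of the left factors.\<close>

lemma phi0_metric_code:
  "list_all (\<lambda>a. list_all (\<lambda>b.
     wedge_code 4 (wedge_code 2 (\<lambda>js. phi0_code (a # js)) (\<lambda>js. phi0_code (b # js))) phi0_code idxs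
     = (if a = b then 6 else 0)) idxs) idxs"
  by code_simp


text \<open>The Hodge star of the model form for the standard metric, where raising an index changes
  nothing; 6 is the \<open>fact 3\<close> of \<open>hodge_star\<close>.\<close>

definition star0 :: cov where
  "star0 vs = (\<Sum>r\<in>UNIV. \<Sum>s\<in>UNIV. \<Sum>t\<in>UNIV.
     phi0 [axis r 1, axis s 1, axis t 1] * vol0 (axis r 1 # axis s 1 # axis t 1 # vs)) / 6"

lemma phi0_basis: "phi0 [bvec a, bvec b, bvec c] = of_int (phi0_code [a, b, c])"
  using on_basis_phi0[unfolded on_basis_def, rule_format, of "[a, b, c]"] by (simp del: phi0_code.simps)

text \<open>For given a and b at most one t contributes, the unit that occurs in the product of the
  a-th and b-th octonion units. This removes one summation from each contraction below.\<close>

lemma sum_phi0_basis: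
  "(\<Sum>t\<in>UNIV. phi0 [bvec a, bvec b, axis t 1] * f t)
    = (case octonion a b of (s, c) \<Rightarrow> of_int s * f (idx7 c))"
proof -
  obtain s c where "octonion a b = (s, c)" by fastforce
  then show ?thesis
    by (cases c) (simp_all add: sum_UNIV_7 idxs_def phi0_basis)
qed

lemma sum_sum_phi0_basis:
  "(\<Sum>s\<in>UNIV. \<Sum>t\<in>UNIV. phi0 [bvec a, axis s 1, axis t 1] * f s t)
    = sum_list (map (\<lambda>b. case octonion a b of (s, c) \<Rightarrow> of_int s * f (idx7 b) (idx7 c)) idxs)"
  by (subst sum_UNIV_7) (simp only: sum_phi0_basis)

text \<open>The seven triples are the lines of the Fano plane. The six orders of a line contribute
  equally, since \<open>phi0\<close> and \<open>vol0\<close> both change sign under a transposition;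
  this cancels the 6.\<close>

lemma star0_lines:
  fixes vs :: "vec7 list"
  defines "T \<equiv> \<lambda>a b c. vol0 (bvec a # bvec b # bvec c # vs)"
  shows "star0 vs = T I1 I2 I3 + T I1 I4 I5 + T I1 I6 I7 + T I2 I4 I6 - T I2 I5 I7 - T I3 I4 I7 - T I3 I5 I6"
proof -
  have s1: "T b a c = - T a b c" for a b c
    unfolding T_def by (rule alt_form_swap2[OF alt_form_vol0])
  have s2: "T a c b = - T a b c" for a b c
    using alt_form_swap[OF alt_form_vol0, of 1 2 "bvec a # bvec b # bvec c # vs"]
    by (simp add: T_def numeral_2_eq_2)
  have s3: "T b a c = - T a b c \<and> T a c b = - T a b c \<and> T b c a = T a b c \<and> T c a b = T a b c
     \<and> T c b a = - T a b c" for a b c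
    using s1[of a b c] s2[of a b c] s1[of b c a] s2[of b a c] s1[of a c b] s2[of c a b] s2[of b c a] by linarith
  have "star0 vs = (\<Sum>r\<in>UNIV. \<Sum>s\<in>UNIV. \<Sum>t\<in>UNIV.
     phi0 [axis r 1, axis s 1, axis t 1] * vol0 (axis r 1 # axis s 1 # axis t 1 # vs)) / 6"
    by (simp add: star0_def)
  also have "\<dots> = sum_list (map (\<lambda>a. sum_list (map (\<lambda>b.
      case octonion a b of (s, c) \<Rightarrow> of_int s * T a b c) idxs)) idxs) / 6"
    unfolding T_def by (subst sum_UNIV_7) (simp only: sum_sum_phi0_basis)
  also have "\<dots> = T I1 I2 I3 + T I1 I4 I5 + T I1 I6 I7 + T I2 I4 I6 - T I2 I5 I7 - T I3 I4 I7 - T I3 I5 I6"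
    using s3[where a = I1 and b = I2 and c = I3] s3[where a = I1 and b = I4 and c = I5] s3[where a = I1 and b = I6 and c = I7] s3[where a = I2 and b = I4 and c = I6]
      s3[where a = I2 and b = I5 and c = I7] s3[where a = I3 and b = I4 and c = I7] s3[where a = I3 and b = I5 and c = I6]
    by (simp add: idxs_def octonion_def)
  finally show ?thesis .
qed

definition star0_code :: "idx list \<Rightarrow> int" where
  "star0_code is =
     vol0_code (I1 # I2 # I3 # is) + vol0_code (I1 # I4 # I5 # is) + vol0_code (I1 # I6 # I7 # is)
     + vol0_code (I2 # I4 # I6 # is) - vol0_code (I2 # I5 # I7 # is)
     - vol0_code (I3 # I4 # I7 # is) - vol0_code (I3 # I5 # I6 # is)"

lemma on_basis_star0: "on_basis star0 star0_code"
proof -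
  have "vol0 (bvec a # bvec b # bvec c # map bvec is) = of_int (vol0_code (a # b # c # is))" for a b c "is"
    using on_basis_vol0[unfolded on_basis_def, rule_format, of "a # b # c # is"] by simp
  then show ?thesis by (simp add: on_basis_def star0_lines star0_code_def del: idx7.simps)
qed

definition contraction_code :: "idx \<Rightarrow> idx \<Rightarrow> idx \<Rightarrow> int" where
  "contraction_code u v w = sum_list (map (\<lambda>i. case octonion w i of (c, j) \<Rightarrow>
     if c = 0 then 0 else c * star0_code [u, v, i, j]) idxs)"

lemma contraction_code:
  "list_all (\<lambda>u. list_all (\<lambda>v. list_all (\<lambda>w.
     contraction_code u v w = 4 * phi0_code [u, v, w]) idxs) idxs) idxs"
  by code_simp

text \<open>Only i is summed in \<open>contraction_code\<close>, because j can be read off from the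
  product of the units w and i. The constant 4 is confirmed by evaluating all 343 cases.\<close>

lemma phi0_star0_basis:
  "(\<Sum>i\<in>UNIV. \<Sum>j\<in>UNIV. phi0 [bvec w, axis i 1, axis j 1] * star0 [bvec u, bvec v, axis i 1, axis j 1])
    = 4 * phi0 [bvec u, bvec v, bvec w]"
proof -
  have star: "star0 [bvec u, bvec v, bvec i, bvec j] = of_int (star0_code [u, v, i, j])" for i j
    using on_basis_star0[unfolded on_basis_def, rule_format, of "[u, v, i, j]"] by simp
  have "(\<Sum>i\<in>UNIV. \<Sum>j\<in>UNIV. phi0 [bvec w, axis i 1, axis j 1] * star0 [bvec u, bvec v, axis i 1, axis j 1])
    = sum_list (map (\<lambda>i. case octonion w i of (c, j) \<Rightarrow> of_int c * star0 [bvec u, bvec v, bvec i, bvec j]) idxs)"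
    by (rule sum_sum_phi0_basis)
  also have "\<dots> = of_int (contraction_code u v w)"
    unfolding contraction_code_def idxs_def star by (simp split: prod.split)
  also have "\<dots> = of_int (4 * phi0_code [u, v, w])"
    using contraction_code by (simp add: list_all_iff set_idxs)
  finally show ?thesis by (simp add: phi0_basis)
qed

lemma alt_form_3_linear:
  assumes "alt_form 3 \<omega>"
  shows "linear (\<lambda>x. \<omega> [x, y, z])" "linear (\<lambda>y. \<omega> [x, y, z])" "linear (\<lambda>z. \<omega> [x, y, z])"
  using alt_form_linear[OF assms, of "[x, y, z]" 0] alt_form_linear[OF assms, of "[x, y, z]" 1]
    alt_form_linear[OF assms, of "[x, y, z]" 2] by simp_all

lemma linear_eq_on_bvec:
  fixes f g :: "vec7 \<Rightarrow> real"
  assumes "linear f" "linear g" "\<And>a. f (bvec a) = g (bvec a)"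
  shows "f v = g v"
proof -
  have "f (axis i 1) = g (axis i 1)" for i
    using assms(3) bij_idx7 by (metis bij_def surjD)
  then show ?thesis by (simp add: linear_vec7_expand[OF assms(1), of v] linear_vec7_expand[OF assms(2), of v])
qed

lemma linear_star0: "linear (\<lambda>u. star0 [u, v, x, y])" "linear (\<lambda>v. star0 [u, v, x, y])"
proof -
  have "linear (\<lambda>u. vol0 [a, b, c, u, v, x, y])" "linear (\<lambda>v. vol0 [a, b, c, u, v, x, y])" for a b c
    using alt_form_linear[OF alt_form_vol0, of "[a, b, c, u, v, x, y]" 3]
      alt_form_linear[OF alt_form_vol0, of "[a, b, c, u, v, x, y]" 4]
    by (simp_all add: eval_nat_numeral)
  then show "linear (\<lambda>u. star0 [u, v, x, y])" "linear (\<lambda>v. star0 [u, v, x, y])"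
    unfolding star0_lines by (intro linear_compose_add linear_compose_sub; simp)+
qed

lemma phi0_star0:
  "(\<Sum>i\<in>UNIV. \<Sum>j\<in>UNIV. phi0 [w, axis i 1, axis j 1] * star0 [u, v, axis i 1, axis j 1])
    = 4 * phi0 [u, v, w]"
proof -
  note l = alt_form_3_linear[OF alt_form_phi0] linear_star0
  define F where "F u v w = (\<Sum>i\<in>UNIV. \<Sum>j\<in>UNIV.
     phi0 [w, axis i 1, axis j 1] * star0 [u, v, axis i 1, axis j 1])" for u v w
  have F: "linear (\<lambda>u. F u v w)" "linear (\<lambda>v. F u v w)" "linear (\<lambda>w. F u v w)" for u v w
    unfolding F_def by (intro linear_compose_sum ballI linear_const_mult linear_mult_const l)+
  have 1: "F (bvec a) (bvec b) w = 4 * phi0 [bvec a, bvec b, w]" for a b w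
    by (rule linear_eq_on_bvec[OF F(3)]) (auto intro: linear_const_mult l simp: F_def phi0_star0_basis)
  have 2: "F (bvec a) v w = 4 * phi0 [bvec a, v, w]" for a v w
    by (rule linear_eq_on_bvec[OF F(2)]) (auto intro: linear_const_mult l simp: 1)
  have "F u v w = 4 * phi0 [u, v, w]"
    by (rule linear_eq_on_bvec[OF F(1)]) (auto intro: linear_const_mult l simp: 2)
  then show ?thesis by (simp add: F_def)
qed

section \<open>The defining equation of the metric for the model form\<close>

lemma linear_wedge_left:
  assumes "\<And>us. linear (\<lambda>x. \<omega> x us)" shows "linear (\<lambda>x. wedge (\<omega> x) \<eta> vs)"
proof -
  have "linear (\<lambda>x. (c * b) * \<omega> x us)" for c b us
    using linear_compose_scale_right[OF assms, of "c * b"] by simp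
  then have "linear (\<lambda>x. c * \<omega> x us * b)" for c b us by (simp add: mult_ac)
  then show ?thesis unfolding wedge_def by (intro linear_compose_sum ballI)
qed

lemma linear_wedge_right:
  assumes "\<And>us. linear (\<lambda>x. \<eta> x us)" shows "linear (\<lambda>x. wedge \<omega> (\<eta> x) vs)"
proof -
  have "linear (\<lambda>x. c * \<eta> x us)" for c us
    using linear_compose_scale_right[OF assms, of c] by simp
  then show ?thesis unfolding wedge_def by (intro linear_compose_sum ballI)
qed

lemma linear_contract:
  assumes "alt_form (Suc k) \<omega>" shows "linear (\<lambda>x. contract x \<omega> us)"
proof (cases "length us = k")
  case True
  then show ?thesis using alt_form_linear[OF assms, of "0 # us" 0] by (simp add: contract_def)
next
  case False
  then show ?thesis using alt_form_length[OF assms] by (simp add: contract_def linear_zero)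
qed

text \<open>Both sides are 7-forms, so they need to be compared only on the standard basis. There
  both are bilinear in X and Y, and the basis values are those of
  \<open>phi0_metric_code\<close>.\<close>

lemma phi0_metric_volume:
  "wedge (wedge (contract X phi0) (contract Y phi0)) phi0 vs = 6 * (X \<bullet> Y) * vol0 vs"
proof -
  have a3: "alt_form (Suc 2) phi0" using alt_form_phi0 by (simp add: eval_nat_numeral)
  note ac = alt_form_contract[OF a3]
  define B where "B X Y = wedge (wedge (contract X phi0) (contract Y phi0)) phi0" for X Y
  have alt: "alt_form 7 (B X Y)" for X Y
    using alt_form_wedge[OF alt_form_wedge[OF ac ac] alt_form_phi0] by (simp add: B_def)
  have basis: "B (bvec a) (bvec b) std_basis = (if a = b then 6 else 0)" for a b
  proof -
    have "on_basis (B (bvec a) (bvec b)) (wedge_code 4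
        (wedge_code 2 (\<lambda>js. phi0_code (a # js)) (\<lambda>js. phi0_code (b # js))) phi0_code)"
      unfolding B_def using alt_form_wedge[OF ac ac, of "bvec a" "bvec b"]
      by (intro wedge_code_correct on_basis_contract on_basis_phi0 alt_form_homogeneous ac) simp
    then show ?thesis
      using phi0_metric_code by (simp add: on_basis_def std_basis_idxs list_all_iff set_idxs)
  qed
  have l: "linear (\<lambda>X. B X Y vs)" "linear (\<lambda>Y. B X Y vs)" for X Y vs
    unfolding B_def by (intro linear_wedge_left linear_wedge_right linear_contract[OF a3])+
  have i: "linear (\<lambda>X. 6 * (X \<bullet> Y))" "linear (\<lambda>Y. 6 * (X \<bullet> Y))" for X Y :: vec7
    by (auto intro!: linearI simp: inner_simps algebra_simps)
  have 1: "B (bvec a) Y std_basis = 6 * (bvec a \<bullet> Y)" for a Y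
    by (rule linear_eq_on_bvec[OF l(2) i(2)]) (auto simp: basis inner_axis_axis idx7_eq_iff)
  have 2: "B X Y std_basis = 6 * (X \<bullet> Y)" for X Y
    by (rule linear_eq_on_bvec[OF l(1) i(1)]) (rule 1)
  have "B X Y = (\<lambda>vs. 6 * (X \<bullet> Y) * vol0 vs)"
    by (rule alt_form_7_eq[OF alt alt_form_scale[OF alt_form_vol0]]) (simp add: 2 vol0_std_basis)
  then show ?thesis by (simp add: B_def fun_eq_iff)
qed

section \<open>Metric, volume form and star of a G2 form\<close>

primrec idx_pos :: "idx \<Rightarrow> nat" where
  "idx_pos I1 = 0" | "idx_pos I2 = 1" | "idx_pos I3 = 2" | "idx_pos I4 = 3"
| "idx_pos I5 = 4" | "idx_pos I6 = 5" | "idx_pos I7 = 6"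

text \<open>Translates matrix indices into list positions. The index 7 is the residue 0 but has the
  last position, so this is not the order of the residues.\<close>

definition pos7 :: "7 \<Rightarrow> nat" where
  "pos7 i = idx_pos (inv idx7 i)"

lemma pos7_idx7: "pos7 (idx7 a) = idx_pos a"
  using bij_idx7 by (simp add: pos7_def bij_def)

lemma idx7_cases: obtains a where "i = idx7 a"
  using bij_idx7 by (metis bij_def surjD)

lemma pos7_less: "pos7 i < 7"
  by (rule idx7_cases[of i], rename_tac a, case_tac a) (simp_all add: pos7_idx7 del: idx7.simps)

lemma pos7_eq_iff: "pos7 i = pos7 j \<longleftrightarrow> i = j"
proof -
  obtain a b where "i = idx7 a" "j = idx7 b" by (metis idx7_cases)
  then show ?thesis
    by (cases a; cases b) (simp_all add: pos7_idx7 idx7_eq_iff del: idx7.simps)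
qed

lemma pos7_surj: "k < 7 \<Longrightarrow> \<exists>i. pos7 i = k"
proof -
  assume "k < 7"
  have "pos7 ` UNIV = {..<7}"
    by (rule card_subset_eq) (auto simp: pos7_less card_image inj_on_def pos7_eq_iff)
  then show ?thesis using \<open>k < 7\<close> by (metis imageE lessThan_iff)
qed

lemma std_basis_pos7: "std_basis ! pos7 i = axis i 1"
proof -
  obtain a where "i = idx7 a" by (metis idx7_cases)
  then show ?thesis by (cases a) (simp_all add: pos7_idx7 std_basis_idxs idxs_def del: idx7.simps)
qed

definition det_form :: cov where
  "det_form vs = (if length vs = 7 then det ((\<chi> i. vs ! pos7 i) :: real^7^7) else 0)"

lemma alt_form_det_form: "alt_form 7 det_form"
proof (rule alt_formI)
  fix vs :: "vec7 list" and k :: nat assume *: "length vs = 7" "k < 7"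
  obtain i0 where i0: "pos7 i0 = k" using * pos7_surj by blast
  have eq: "vs[k := v] ! pos7 i = (if i = i0 then v else vs ! pos7 i)" for i v
    using i0 * pos7_eq_iff[of i i0] by (auto simp: nth_list_update)
  show "linear (\<lambda>v. det_form (vs[k := v]))"
    using * det_row_mul[of i0 _ "\<lambda>_. _" "\<lambda>i. vs ! pos7 i"]
    by (intro linearI) (simp_all add: det_form_def eq det_row_add flip: scalar_mult_eq_scaleR)
next
  fix vs :: "vec7 list" and k :: nat assume *: "length vs = 7" "Suc k < 7" "vs ! k = vs ! Suc k"
  obtain i j where ij: "pos7 i = k" "pos7 j = Suc k" using * pos7_surj[of k] pos7_surj[of "Suc k"] by auto
  then have "i \<noteq> j" by auto
  then have "det ((\<chi> i. vs ! pos7 i) :: real^7^7) = 0"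
    by (rule det_identical_rows) (use ij * in \<open>simp add: row_def vec_eq_iff\<close>)
  then show "det_form vs = 0" by (simp add: det_form_def)
qed (simp add: det_form_def)

lemma vol0_eq_det: "vol0 = det_form"
proof (rule alt_form_7_eq[OF alt_form_vol0 alt_form_det_form])
  have "((\<chi> i. std_basis ! pos7 i) :: real^7^7) = mat 1"
    by (simp add: std_basis_pos7 vec_eq_iff mat_def axis_def eq_commute)
  then show "vol0 std_basis = det_form std_basis"
    by (simp add: vol0_std_basis det_form_def) (simp add: std_basis_def)
qed

text \<open>The Gram determinant. It yields the normalisation demanded by \<open>volume_form\<close>
  as well as the relation between volume and metric from which the metric is recovered
  later.\<close>

lemma vol0_sq:
  assumes "length vs = 7"
  shows "(vol0 vs)\<^sup>2 = det (\<chi> i j. vs ! pos7 i \<bullet> vs ! pos7 j)"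
proof -
  define A :: "real^7^7" where "A = (\<chi> i. vs ! pos7 i)"
  have "A ** transpose A = (\<chi> i j. vs ! pos7 i \<bullet> vs ! pos7 j)"
    by (simp add: A_def matrix_matrix_mult_def transpose_def inner_vec_def vec_eq_iff)
  then have "det (\<chi> i j. vs ! pos7 i \<bullet> vs ! pos7 j) = (det A)\<^sup>2"
    by (metis det_mul det_transpose power2_eq_square)
  then show ?thesis using assms by (simp add: vol0_eq_det det_form_def A_def)
qed

lemma alt_form_scale_all:
  assumes "alt_form k \<omega>" "length vs = k"
  shows "\<omega> (map (\<lambda>v. c *\<^sub>R v) vs) = c ^ k * \<omega> vs"
proof -
  have "\<omega> (map (\<lambda>v. c *\<^sub>R v) (take m vs) @ drop m vs) = c ^ m * \<omega> vs" if "m \<le> k" for m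
    using that
  proof (induction m)
    case (Suc m)
    let ?us = "map (\<lambda>v. c *\<^sub>R v) (take m vs) @ drop m vs"
    have "map (\<lambda>v. c *\<^sub>R v) (take (Suc m) vs) @ drop (Suc m) vs = ?us[m := c *\<^sub>R (vs ! m)]"
      using Suc.prems assms(2)
      by (simp add: take_Suc_conv_app_nth list_update_append Cons_nth_drop_Suc[symmetric])
    moreover have "?us[m := vs ! m] = ?us"
      using Suc.prems assms(2) by (simp add: list_update_append Cons_nth_drop_Suc[symmetric])
    moreover have "linear (\<lambda>v. \<omega> (?us[m := v]))"
      using Suc.prems assms by (intro alt_form_linear) auto
    ultimately show ?case
      using linear_cmul[of "\<lambda>v. \<omega> (?us[m := v])" c "vs ! m"] Suc by simp
  qed simp
  from this[of k] show ?thesis using assms(2) by simp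
qed

text \<open>
  Two solutions satisfy \<open>g' = \<mu> g\<close> and \<open>v' = v / \<mu>\<close>. Rescaling a g-orthonormal basis to a g'-orthonormal
  one, the normalisation of the volume forms becomes \<open>\<mu> powr (9 / 2) = 1\<close>.
\<close>

lemma G2_metric_volume_unique:
  assumes "G2_metric_volume \<phi> g v" "G2_metric_volume \<phi> g' v'"
    and bs: "length bs = 7" "\<And>i j. i < 7 \<Longrightarrow> j < 7 \<Longrightarrow> g (bs ! i) (bs ! j) = (if i = j then 1 else 0)"
  shows "g' = g \<and> v' = v"
proof -
  have ip: "inner_product g" "inner_product g'" and vf: "volume_form g v" "volume_form g' v'"
    using assms(1,2) by (auto simp: G2_metric_volume_def)
  have eq: "g X Y * v vs = g' X Y * v' vs" for X Y vs
  proof -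
    have "6 * g X Y * v vs = 6 * g' X Y * v' vs"
      using assms(1,2) unfolding G2_metric_volume_def by metis
    then show ?thesis by simp
  qed
  define b where "b = bs ! 0"
  define \<mu> where "\<mu> = g' b b"
  define r where "r = 1 / sqrt \<mu>"
  have bl: "bilinear g" "bilinear g'" using ip by (auto simp: inner_product_def)
  have gb: "g b b = 1" using bs(2)[of 0 0] by (simp add: b_def)
  then have "b \<noteq> 0" using bilinear_lzero[OF bl(1), of b] by auto
  then have \<mu>: "\<mu> > 0" using ip by (auto simp: \<mu>_def inner_product_def)
  have vb: "\<bar>v bs\<bar> = 1" using vf(1) bs by (auto simp: volume_form_def)
  have v'b: "v' bs = v bs / \<mu>" using eq[of b b bs] gb \<mu> by (simp add: \<mu>_def field_simps)
  have g': "g' X Y = \<mu> * g X Y" for X Y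
  proof -
    have "g X Y * v bs = g' X Y * v bs / \<mu>" using eq[of X Y bs] v'b by simp
    moreover have "v bs \<noteq> 0" using vb by auto
    ultimately show ?thesis using \<mu> by (simp add: field_simps)
  qed
  have "g' (r *\<^sub>R x) (r *\<^sub>R y) = g x y" for x y
    using \<mu> by (simp add: g' bilinear_lmul[OF bl(1)] bilinear_rmul[OF bl(1)] r_def)
  then have "\<bar>v' (map (\<lambda>x. r *\<^sub>R x) bs)\<bar> = 1"
    using vf(2) bs by (auto simp: volume_form_def)
  moreover have "v' (map (\<lambda>x. r *\<^sub>R x) bs) = r ^ 7 * v' bs"
    using vf(2) bs by (intro alt_form_scale_all) (auto simp: volume_form_def)
  moreover have "1 / \<mu> = r ^ 2" using \<mu> by (simp add: r_def power_divide)
  then have "v' bs = r ^ 2 * v bs" using v'b by (metis times_divide_eq_left mult_1)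
  moreover have r: "r > 0" using \<mu> by (simp add: r_def)
  ultimately have "r ^ 7 * (r ^ 2 * \<bar>v bs\<bar>) = 1"
    by (simp only: abs_mult power_abs abs_of_pos[OF r])
  then have "r ^ 7 * r ^ 2 = 1" using vb by simp
  then have "r ^ 9 = 1" by (simp flip: power_add)
  then have "r = 1" using r power_eq_1_iff[of r 9] by simp
  then have "\<mu> = 1" using \<mu> by (simp add: r_def)
  then have "g' = g" using g' by (simp add: fun_eq_iff)
  moreover have "v' vs = v vs" for vs using eq[of b b vs] gb \<open>g' = g\<close> by simp
  ultimately show ?thesis by (simp add: fun_eq_iff)
qed

lemma sum_lists_3:
  "(\<Sum>is | length is = 3. f is) = (\<Sum>i\<in>UNIV. \<Sum>j\<in>UNIV. \<Sum>k\<in>UNIV. f [i, j, k :: 7])"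
proof -
  have "bij_betw (\<lambda>(i, j, k). [i, j, k]) UNIV {is :: 7 list. length is = 3}"
    by (rule bij_betw_byWitness[where f' = "\<lambda>is. (is ! 0, is ! 1, is ! 2)"])
      (auto simp: length_Suc_conv eval_nat_numeral)
  from sum.reindex_bij_betw[OF this, of f, symmetric]
  show ?thesis by (simp add: sum.cartesian_product case_prod_beta' flip: UNIV_Times_UNIV)
qed

lemma sum_swap4:
  "(\<Sum>i\<in>A. \<Sum>j\<in>B. \<Sum>a\<in>C. \<Sum>b\<in>D. f i j a b) = (\<Sum>a\<in>C. \<Sum>b\<in>D. \<Sum>i\<in>A. \<Sum>j\<in>B. f i j a b)"
proof -
  have "(\<Sum>i\<in>A. \<Sum>j\<in>B. \<Sum>a\<in>C. \<Sum>b\<in>D. f i j a b) = (\<Sum>i\<in>A. \<Sum>a\<in>C. \<Sum>j\<in>B. \<Sum>b\<in>D. f i j a b)"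
    by (rule sum.cong[OF refl], rule sum.swap)
  also have "\<dots> = (\<Sum>a\<in>C. \<Sum>i\<in>A. \<Sum>j\<in>B. \<Sum>b\<in>D. f i j a b)"
    by (rule sum.swap)
  also have "\<dots> = (\<Sum>a\<in>C. \<Sum>i\<in>A. \<Sum>b\<in>D. \<Sum>j\<in>B. f i j a b)"
    by (rule sum.cong[OF refl], rule sum.cong[OF refl], rule sum.swap)
  also have "\<dots> = (\<Sum>a\<in>C. \<Sum>b\<in>D. \<Sum>i\<in>A. \<Sum>j\<in>B. f i j a b)"
    by (rule sum.cong[OF refl], rule sum.swap)
  finally show ?thesis .
qed

text \<open>A G2 form with one of its many isomorphisms to the model. The metric and the volume form
  do not depend on this choice, by \<open>G2_metric_volume_unique\<close>.\<close>

locale G2_linear =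
  fixes \<phi> :: cov and L :: "vec7 \<Rightarrow> vec7"
  assumes lin: "linear L" and bij: "bij L" and phi: "\<And>vs. \<phi> vs = phi0 (map L vs)"
begin

definition frame :: "7 \<Rightarrow> vec7" where
  "frame i = inv L (axis i 1)"

lemma L_frame: "L (frame i) = axis i 1"
  using bij by (simp add: frame_def bij_is_surj surj_f_inv_f)

lemma inner_product_L: "inner_product (\<lambda>u v. L u \<bullet> L v)"
proof -
  have "L u \<noteq> 0" if "u \<noteq> 0" for u
    using that bij lin by (metis bij_is_inj injD linear_0)
  then have "L u \<bullet> L u > 0" if "u \<noteq> 0" for u
    using that by simp
  moreover have "linear (\<lambda>u. L u \<bullet> L v)" "linear (\<lambda>u. L v \<bullet> L u)" for v
    by (rule linearI; simp add: linear_add[OF lin] linear_cmul[OF lin] inner_add_left inner_add_right)+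
  ultimately show ?thesis
    by (simp add: inner_product_def bilinear_def inner_commute)
qed

lemma G2_metric_volume_L: "G2_metric_volume \<phi> (\<lambda>u v. L u \<bullet> L v) (\<lambda>vs. vol0 (map L vs))"
proof -
  have "\<bar>vol0 (map L bs)\<bar> = 1"
    if bs: "length bs = 7" "\<forall>i<7. \<forall>j<7. L (bs ! i) \<bullet> L (bs ! j) = (if i = j then 1 else 0)" for bs
  proof -
    have "(vol0 (map L bs))\<^sup>2 = det (mat 1 :: real^7^7)"
      using bs by (simp add: vol0_sq pos7_less pos7_eq_iff mat_def)
    then show ?thesis by (simp add: power2_eq_1_iff) linarith
  qed
  then have "volume_form (\<lambda>u v. L u \<bullet> L v) (\<lambda>vs. vol0 (map L vs))"
    using alt_form_pullback[OF alt_form_vol0 lin] by (auto simp: volume_form_def)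
  moreover have "wedge (wedge (contract X \<phi>) (contract Y \<phi>)) \<phi> vs = 6 * (L X \<bullet> L Y) * vol0 (map L vs)" for X Y vs
  proof -
    have "contract X \<phi> = (\<lambda>vs. contract (L X) phi0 (map L vs))" for X
      by (simp add: fun_eq_iff contract_def phi)
    moreover have "\<phi> = (\<lambda>vs. phi0 (map L vs))" by (simp add: fun_eq_iff phi)
    moreover have "wedge (\<lambda>vs. \<omega> (map L vs)) (\<lambda>vs. \<eta> (map L vs)) = (\<lambda>vs. wedge \<omega> \<eta> (map L vs))" for \<omega> \<eta>
      by (simp add: fun_eq_iff wedge_map)
    ultimately show ?thesis by (simp add: phi0_metric_volume)
  qed
  ultimately show ?thesis using inner_product_L by (simp add: G2_metric_volume_def)
qed

text \<open>The uniqueness lemma asks for a basis orthonormal for one of the two metrics; the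
  preimages of the standard basis serve for the metric pulled back by L.\<close>

lemma G2_metric_volume_eq:
  assumes "G2_metric_volume \<phi> g v"
  shows "g = (\<lambda>u v. L u \<bullet> L v)" "v = (\<lambda>vs. vol0 (map L vs))"
proof -
  define bs where "bs = map (\<lambda>a. frame (idx7 a)) idxs"
  have b: "length bs = 7" by (simp add: bs_def idxs_def)
  have "L (bs ! i) \<bullet> L (bs ! j) = (if i = j then 1 else 0)" if "i < 7" "j < 7" for i j
  proof -
    have d: "distinct idxs" "length idxs = 7" by (simp_all add: idxs_def)
    have "L (bs ! i) \<bullet> L (bs ! j) = bvec (idxs ! i) \<bullet> bvec (idxs ! j)"
      using that d by (simp add: bs_def L_frame)
    also have "\<dots> = (if i = j then 1 else 0)"
      using that d by (auto simp: inner_axis_axis idx7_eq_iff nth_eq_iff_index_eq)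
    finally show ?thesis .
  qed
  from G2_metric_volume_unique[OF G2_metric_volume_L assms b this]
  show "g = (\<lambda>u v. L u \<bullet> L v)" "v = (\<lambda>vs. vol0 (map L vs))" by auto
qed

lemma G2_metric_L: "G2_metric \<phi> = (\<lambda>u v. L u \<bullet> L v)"
  unfolding G2_metric_def
proof (rule the_equality)
  show "\<exists>vol. G2_metric_volume \<phi> (\<lambda>u v. L u \<bullet> L v) vol"
    by (rule exI[where x = "\<lambda>vs. vol0 (map L vs)"], rule G2_metric_volume_L)
qed (erule exE, erule G2_metric_volume_eq)

lemma G2_volume_L: "G2_volume \<phi> = (\<lambda>vs. vol0 (map L vs))"
  unfolding G2_volume_def
proof (rule the_equality)
  show "\<exists>g. G2_metric_volume \<phi> g (\<lambda>vs. vol0 (map L vs))"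
    by (rule exI[where x = "\<lambda>u v. L u \<bullet> L v"], rule G2_metric_volume_L)
qed (erule exE, erule G2_metric_volume_eq)

lemma frame_orthonormal: "G2_metric \<phi> (frame i) (frame j) = (if i = j then 1 else 0)"
  by (simp add: G2_metric_L L_frame inner_axis_axis)

lemma frame_expand: "v = (\<Sum>i\<in>UNIV. G2_metric \<phi> v (frame i) *\<^sub>R frame i)"
proof -
  have "L v = L (\<Sum>i\<in>UNIV. G2_metric \<phi> v (frame i) *\<^sub>R frame i)"
    unfolding linear_sum[OF lin] linear_cmul[OF lin] L_frame G2_metric_L
    using basis_expansion[of "L v"] by (simp add: inner_axis scalar_mult_eq_scaleR)
  then show ?thesis using bij by (metis bij_is_inj injD)
qed

text \<open>Completeness of an orthonormal frame: the sum N of the matrices \<open>frame r\<close>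
  times its transpose inverts the Gram matrix, because G ** N evaluates the expansion
  \<open>frame_expand\<close> on coordinate vectors.\<close>

lemma sharp_dx_frame: "sharp_dx (G2_metric \<phi>) i = (\<Sum>r\<in>UNIV. frame r $ i *\<^sub>R frame r)"
proof -
  let ?g = "G2_metric \<phi>"
  define G :: "real^7^7" where "G = (\<chi> k l. ?g (axis k 1) (axis l 1))"
  define N :: "real^7^7" where "N = (\<chi> k l. \<Sum>r\<in>UNIV. frame r $ k * frame r $ l)"
  have e: "L v = (\<Sum>m\<in>UNIV. v $ m *\<^sub>R L (axis m 1))" for v
  proof -
    have "L v = L (\<Sum>m\<in>UNIV. v $ m *\<^sub>R axis m 1)"
      using basis_expansion[of v] by (simp add: scalar_mult_eq_scaleR)
    then show ?thesis by (simp add: linear_sum[OF lin] linear_cmul[OF lin])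
  qed
  have "(G ** N) $ k $ l = mat 1 $ k $ l" for k l
  proof -
    have "(G ** N) $ k $ l = (\<Sum>m\<in>UNIV. \<Sum>r\<in>UNIV. ?g (axis k 1) (axis m 1) * (frame r $ m * frame r $ l))"
      by (simp add: matrix_matrix_mult_def G_def N_def sum_distrib_left)
    also have "\<dots> = (\<Sum>r\<in>UNIV. (\<Sum>m\<in>UNIV. ?g (axis k 1) (axis m 1) * frame r $ m) * frame r $ l)"
      by (subst sum.swap) (simp add: sum_distrib_right sum_distrib_left mult_ac)
    also have "\<dots> = (\<Sum>r\<in>UNIV. ?g (axis k 1) (frame r) * frame r $ l)"
      unfolding G2_metric_L using e[of "frame _"] by (simp add: inner_sum_right mult.commute)
    also have "\<dots> = (\<Sum>r\<in>UNIV. ?g (axis k 1) (frame r) *\<^sub>R frame r) $ l" by simp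
    also have "\<dots> = axis k 1 $ l" by (simp only: frame_expand[symmetric])
    finally show ?thesis by (simp add: axis_def mat_def eq_commute)
  qed
  then have GN: "G ** N = mat 1" by (simp add: vec_eq_iff)
  then have NG: "N ** G = mat 1" by (simp add: matrix_left_right_inverse)
  \<comment> \<open>\<open>matrix_inv\<close> is a choice of some two-sided inverse; multiplication
    with G ** N identifies it as N.\<close>
  have "G ** matrix_inv G = mat 1 \<and> matrix_inv G ** G = mat 1"
    unfolding matrix_inv_def by (rule someI[of _ N]) (simp add: GN NG)
  then have "matrix_inv G ** (G ** N) = N" by (simp add: matrix_mul_assoc)
  then have "matrix_inv G = N" by (simp add: GN)
  then show ?thesis
    unfolding sharp_dx_def G_def[symmetric]
    by (simp add: matrix_vector_mult_basis column_def N_def vec_eq_iff mult.commute)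
qed

text \<open>Contraction of one index raised in coordinates is a trace over the frame. Used once for
  each of the three indices in the Hodge star.\<close>

lemma sum_sharp_dx:
  fixes F :: "vec7 \<Rightarrow> vec7 \<Rightarrow> real"
  assumes "\<And>v. linear (\<lambda>u. F u v)" "\<And>u. linear (\<lambda>v. F u v)"
  shows "(\<Sum>i\<in>UNIV. F (sharp_dx (G2_metric \<phi>) i) (axis i 1)) = (\<Sum>r\<in>UNIV. F (frame r) (frame r))"
proof -
  have "(\<Sum>i\<in>UNIV. F (sharp_dx (G2_metric \<phi>) i) (axis i 1))
      = (\<Sum>i\<in>UNIV. \<Sum>r\<in>UNIV. frame r $ i * F (frame r) (axis i 1))"
    by (simp add: sharp_dx_frame linear_sum[OF assms(1)] linear_cmul[OF assms(1)])
  also have "\<dots> = (\<Sum>r\<in>UNIV. F (frame r) (frame r))"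
    by (subst sum.swap) (simp add: linear_vec7_expand[OF assms(2), symmetric])
  finally show ?thesis .
qed

lemma G2_star_L: "G2_star \<phi> vs = star0 (map L vs)"
proof -
  let ?s = "sharp_dx (G2_metric \<phi>)"
  let ?v = "\<lambda>vs. vol0 (map L vs)"
  \<comment> \<open>Each summation index occurs in both factors; giving its two occurrences separate
    arguments makes F linear in each, so that the indices can be transformed one at a time, the
    innermost first.\<close>
  define F where "F a a' b b' c c' = \<phi> [a, b, c] * ?v (a' # b' # c' # vs)" for a a' b b' c c'
  have phi': "\<phi> = (\<lambda>vs. phi0 (map L vs))" by (simp add: fun_eq_iff phi)
  have a3: "alt_form 3 \<phi>" unfolding phi' by (rule alt_form_pullback[OF alt_form_phi0 lin])
  have a7: "alt_form 7 ?v" by (rule alt_form_pullback[OF alt_form_vol0 lin])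
  have l7: "linear (\<lambda>x. ?v (x # b # c # vs))" "linear (\<lambda>x. ?v (a # x # c # vs))" "linear (\<lambda>x. ?v (a # b # x # vs))" for a b c
  proof -
    have "linear (\<lambda>x. ?v ((a # b # c # vs)[i := x]))" if "i < 3" for i
    proof (cases "length (a # b # c # vs) = 7")
      case True
      then show ?thesis using that by (intro alt_form_linear[OF a7]) auto
    next
      case False
      then have "?v ((a # b # c # vs)[i := x]) = 0" for x
        by (intro alt_form_length[OF a7]) (simp only: length_list_update not_False_eq_True)
      then show ?thesis by (simp only: linear_zero)
    qed
    from this[of 0] this[of 1] this[of 2]
    show "linear (\<lambda>x. ?v (x # b # c # vs))" "linear (\<lambda>x. ?v (a # x # c # vs))" "linear (\<lambda>x. ?v (a # b # x # vs))"
      by (simp_all add: eval_nat_numeral)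
  qed
  note l = linear_mult_const linear_const_mult l7 alt_form_3_linear[OF a3]
  have FL: "linear (\<lambda>x. F x a' b b' c c')" "linear (\<lambda>x. F a x b b' c c')" "linear (\<lambda>x. F a a' x b' c c')"
    "linear (\<lambda>x. F a a' b x c c')" "linear (\<lambda>x. F a a' b b' x c')" "linear (\<lambda>x. F a a' b b' c x)"
    for a a' b b' c c'
    unfolding F_def by (intro l)+
  have "hodge_star (G2_metric \<phi>) ?v 3 \<phi> vs
      = (\<Sum>i\<in>UNIV. \<Sum>j\<in>UNIV. \<Sum>k\<in>UNIV. F (?s i) (axis i 1) (?s j) (axis j 1) (?s k) (axis k 1)) / 6"
    by (simp add: hodge_star_def sum_lists_3 F_def fact_numeral)
  also have "\<dots> = (\<Sum>i\<in>UNIV. \<Sum>j\<in>UNIV. \<Sum>k\<in>UNIV. F (?s i) (axis i 1) (?s j) (axis j 1) (frame k) (frame k)) / 6"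
    by (subst sum_sharp_dx[where F = "F _ _ _ _"]) (rule FL refl)+
  also have "\<dots> = (\<Sum>i\<in>UNIV. \<Sum>j\<in>UNIV. \<Sum>k\<in>UNIV. F (?s i) (axis i 1) (frame j) (frame j) (frame k) (frame k)) / 6"
    by (subst sum_sharp_dx[where F = "\<lambda>a b. \<Sum>k\<in>UNIV. F _ _ a b (frame k) (frame k)"])
      (rule linear_compose_sum[OF ballI] FL refl)+
  also have "\<dots> = (\<Sum>i\<in>UNIV. \<Sum>j\<in>UNIV. \<Sum>k\<in>UNIV. F (frame i) (frame i) (frame j) (frame j) (frame k) (frame k)) / 6"
    by (subst sum_sharp_dx[where F = "\<lambda>a b. \<Sum>j\<in>UNIV. \<Sum>k\<in>UNIV. F a b (frame j) (frame j) (frame k) (frame k)"])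
      (rule linear_compose_sum[OF ballI] FL refl)+
  also have "\<dots> = star0 (map L vs)"
    by (simp add: F_def star0_def phi L_frame)
  finally show ?thesis by (simp add: G2_star_def G2_volume_L)
qed

text \<open>\<open>phi0_star0\<close> multiplied by the components of B and summed; the factor 1/2
  of \<open>contract2\<close> occurs on both sides.\<close>

lemma contract2_star_frame:
  "(\<Sum>i\<in>UNIV. \<Sum>j\<in>UNIV. \<phi> [w, frame i, frame j] * contract2 B (G2_star \<phi>) [frame i, frame j])
    = 4 * contract2 B \<phi> [w]"
proof -
  have "(\<Sum>i\<in>UNIV. \<Sum>j\<in>UNIV. \<phi> [w, frame i, frame j] * contract2 B (G2_star \<phi>) [frame i, frame j])
    = (\<Sum>i\<in>UNIV. \<Sum>j\<in>UNIV. \<Sum>a\<in>UNIV. \<Sum>b\<in>UNIV. B $ a $ b *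
       (phi0 [L w, axis i 1, axis j 1] * star0 [L (axis a 1), L (axis b 1), axis i 1, axis j 1])) / 2"
    by (simp add: contract2_def G2_star_L L_frame phi sum_distrib_left sum_divide_distrib mult_ac)
  also have "\<dots> = (\<Sum>a\<in>UNIV. \<Sum>b\<in>UNIV. \<Sum>i\<in>UNIV. \<Sum>j\<in>UNIV. B $ a $ b *
       (phi0 [L w, axis i 1, axis j 1] * star0 [L (axis a 1), L (axis b 1), axis i 1, axis j 1])) / 2"
    by (rule arg_cong[where f = "\<lambda>x. x / 2"], rule sum_swap4)
  also have "\<dots> = (\<Sum>a\<in>UNIV. \<Sum>b\<in>UNIV. B $ a $ b * (4 * phi0 [L (axis a 1), L (axis b 1), L w])) / 2"
    by (simp only: sum_distrib_left[symmetric] phi0_star0)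
  also have "\<dots> = 4 * contract2 B \<phi> [w]"
    by (simp add: contract2_def phi sum_distrib_left mult_ac)
  finally show ?thesis .
qed

text \<open>The relations between metric and 3-form with L eliminated: v is the value of the volume
  form on the standard basis. They are solved for the metric in
  \<open>G2_form_metric_root\<close>.\<close>

lemma metric_volume_determinant:
  "\<exists>v. v \<noteq> 0 \<and> v\<^sup>2 = det ((\<chi> i j. G2_metric \<phi> (axis i 1) (axis j 1)) :: real^7^7) \<and>
    (\<forall>X Y. wedge (wedge (contract X \<phi>) (contract Y \<phi>)) \<phi> std_basis = 6 * v * G2_metric \<phi> X Y)"
proof (intro exI conjI)
  let ?v = "vol0 (map L std_basis)"
  have len: "length std_basis = 7" by (simp add: std_basis_def)
  show "?v\<^sup>2 = det ((\<chi> i j. G2_metric \<phi> (axis i 1) (axis j 1)) :: real^7^7)"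
    using vol0_sq[of "map L std_basis"] len by (simp add: pos7_less std_basis_pos7 G2_metric_L)
  show "\<forall>X Y. wedge (wedge (contract X \<phi>) (contract Y \<phi>)) \<phi> std_basis = 6 * ?v * G2_metric \<phi> X Y"
    using G2_metric_volume_L by (simp add: G2_metric_volume_def G2_metric_L mult_ac)
  show "?v \<noteq> 0"
  proof
    assume v0: "?v = 0"
    have "alt_form 7 (\<lambda>vs. vol0 (map L vs))" by (rule alt_form_pullback[OF alt_form_vol0 lin])
    from alt_form_7_zero[OF this v0] have "vol0 (map L vs) = 0" for vs .
    from this[of "map (inv L) std_basis"] show False
      using bij by (simp add: vol0_std_basis o_def bij_is_surj surj_f_inv_f)
  qed
qed

end

section \<open>Continuously differentiable functions and the metric\<close>

abbreviation pd :: "('v::real_normed_vector \<Rightarrow> 'w::real_normed_vector) \<Rightarrow> 'v \<Rightarrow> 'v \<Rightarrow> 'w" where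
  "pd f x u \<equiv> frechet_derivative f (at x) u"

lemma pd_eq: "(f has_derivative f') (at x) \<Longrightarrow> pd f x u = f' u"
  using frechet_derivative_at by metis

lemma pd_cong:
  assumes "open S" "x \<in> S" "\<And>y. y \<in> S \<Longrightarrow> f y = g y"
  shows "pd f x u = pd g x u"
proof -
  have "(f has_derivative f') (at x) \<longleftrightarrow> (g has_derivative f') (at x)" for f'
    using assms has_derivative_transform_within_open[of f f' x UNIV S g]
      has_derivative_transform_within_open[of g f' x UNIV S f] by auto
  then show ?thesis by (simp add: frechet_derivative_def)
qed

lemma pd_add:
  assumes "f differentiable (at x)" "g differentiable (at x)"
  shows "pd (\<lambda>x. f x + g x) x u = pd f x u + pd g x u"
  by (rule pd_eq) (intro has_derivative_add assms[unfolded frechet_derivative_works])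

lemma pd_diff:
  assumes "f differentiable (at x)" "g differentiable (at x)"
  shows "pd (\<lambda>x. f x - g x) x u = pd f x u - pd g x u"
  by (rule pd_eq) (intro has_derivative_diff assms[unfolded frechet_derivative_works])

lemma pd_mult:
  fixes f g :: "'v::real_normed_vector \<Rightarrow> real"
  assumes "f differentiable (at x)" "g differentiable (at x)"
  shows "pd (\<lambda>x. f x * g x) x u = pd f x u * g x + f x * pd g x u"
  using pd_eq[OF has_derivative_mult[OF assms[unfolded frechet_derivative_works]]] by (simp add: add.commute)

lemma pd_cmult:
  fixes f :: "'v::real_normed_vector \<Rightarrow> real"
  assumes "f differentiable (at x)"
  shows "pd (\<lambda>x. c * f x) x u = c * pd f x u"
  using pd_mult[OF differentiable_const assms, of c] by simp

lemma pd_sum: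
  assumes "\<And>i. i \<in> I \<Longrightarrow> f i differentiable (at x)"
  shows "pd (\<lambda>x. \<Sum>i\<in>I. f i x) x u = (\<Sum>i\<in>I. pd (f i) x u)"
  by (rule pd_eq) (intro has_derivative_sum assms[unfolded frechet_derivative_works])

lemma linear_pd: "f differentiable (at x) \<Longrightarrow> linear (pd f x)"
  by (rule linear_frechet_derivative)

text \<open>The metric is differentiated only once, in the Christoffel symbols and in the product
  rule for its inverse, so this class suffices for everything built from it.\<close>

definition C1_on :: "'v::real_normed_vector set \<Rightarrow> ('v \<Rightarrow> real) \<Rightarrow> bool" where
  "C1_on S f \<longleftrightarrow> (\<forall>x\<in>S. f differentiable (at x)) \<and> (\<forall>u. continuous_on S (\<lambda>x. pd f x u))"

lemma C1_on_differentiable: "C1_on S f \<Longrightarrow> x \<in> S \<Longrightarrow> f differentiable (at x)"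
  by (simp add: C1_on_def)

lemma C1_on_pd: "C1_on S f \<Longrightarrow> continuous_on S (\<lambda>x. pd f x u)"
  by (simp add: C1_on_def)

lemma C1_on_continuous: "C1_on S f \<Longrightarrow> continuous_on S f"
  by (meson C1_on_def continuous_at_imp_continuous_on differentiable_imp_continuous_within)

lemma C1_onI:
  assumes "\<And>x. x \<in> S \<Longrightarrow> (f has_derivative D x) (at x)" "\<And>u. continuous_on S (\<lambda>x. D x u)"
  shows "C1_on S f"
proof -
  have "continuous_on S (\<lambda>x. pd f x u)" for u
    using assms(2)[of u] by (rule continuous_on_eq) (simp add: pd_eq[OF assms(1)])
  then show ?thesis using assms(1) by (auto simp: C1_on_def differentiable_def)
qed

lemma C1_on_deriv: "C1_on S f \<Longrightarrow> x \<in> S \<Longrightarrow> (f has_derivative pd f x) (at x)"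
  using C1_on_differentiable frechet_derivative_works by blast

lemma C1_on_const: "C1_on S (\<lambda>x. c)"
  by (rule C1_onI) (auto intro: has_derivative_const continuous_on_const)

lemma C1_on_add: "C1_on S f \<Longrightarrow> C1_on S g \<Longrightarrow> C1_on S (\<lambda>x. f x + g x)"
  by (rule C1_onI) (auto intro: has_derivative_add C1_on_deriv continuous_on_add C1_on_pd)

lemma C1_on_mult:
  assumes "C1_on S f" "C1_on S g" shows "C1_on S (\<lambda>x. f x * g x)"
proof (rule C1_onI)
  show "((\<lambda>x. f x * g x) has_derivative (\<lambda>u. f x * pd g x u + pd f x u * g x)) (at x)" if "x \<in> S" for x
    using that assms by (intro has_derivative_mult C1_on_deriv)
  show "continuous_on S (\<lambda>x. f x * pd g x u + pd f x u * g x)" for u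
    by (rule continuous_on_add; rule continuous_on_mult) (rule C1_on_pd C1_on_continuous assms)+
qed

lemma C1_on_sum: "(\<And>i. i \<in> I \<Longrightarrow> C1_on S (f i)) \<Longrightarrow> C1_on S (\<lambda>x. \<Sum>i\<in>I. f i x)"
  by (induction I rule: infinite_finite_induct) (auto intro: C1_on_const C1_on_add)

lemma C1_on_prod: "(\<And>i. i \<in> I \<Longrightarrow> C1_on S (f i)) \<Longrightarrow> C1_on S (\<lambda>x. \<Prod>i\<in>I. f i x)"
  by (induction I rule: infinite_finite_induct) (auto intro: C1_on_const C1_on_mult)

lemma C1_on_compose:
  assumes "C1_on S f" "\<And>x. x \<in> S \<Longrightarrow> DERIV h (f x) :> h' (f x)" "continuous_on (f ` S) h'"
  shows "C1_on S (\<lambda>x. h (f x))"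
proof (rule C1_onI)
  show "((\<lambda>x. h (f x)) has_derivative (\<lambda>u. h' (f x) * pd f x u)) (at x)" if "x \<in> S" for x
    using has_derivative_compose[OF C1_on_deriv[OF assms(1) that] assms(2)[OF that, unfolded has_field_derivative_def]]
    by simp
  show "continuous_on S (\<lambda>x. h' (f x) * pd f x u)" for u
    using assms(1,3) by (intro continuous_on_mult C1_on_pd continuous_on_compose2[OF assms(3) C1_on_continuous]) auto
qed

lemma C1_on_inverse:
  assumes "C1_on S f" "\<And>x. x \<in> S \<Longrightarrow> f x \<noteq> 0" shows "C1_on S (\<lambda>x. inverse (f x))"
proof (rule C1_on_compose[OF assms(1), where h' = "\<lambda>y. - (inverse y * inverse y)"])
  show "DERIV inverse (f x) :> - (inverse (f x) * inverse (f x))" if "x \<in> S" for x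
    using DERIV_inverse[OF assms(2)[OF that]] by (simp add: eval_nat_numeral)
qed (use assms(2) in \<open>auto intro!: continuous_intros\<close>)

text \<open>Odd roots are differentiable at negative arguments too. This matters because a chart may
  have either orientation, so that the volume form may be negative on the standard basis.\<close>

lemma C1_on_root:
  assumes "C1_on S f" "\<And>x. x \<in> S \<Longrightarrow> f x \<noteq> 0" "odd n" shows "C1_on S (\<lambda>x. root n (f x))"
proof (rule C1_on_compose[OF assms(1), where h' = "\<lambda>y. inverse (real n * root n y ^ (n - Suc 0))"])
  have n: "n > 0" using assms(3) odd_pos by blast
  show "DERIV (root n) (f x) :> inverse (real n * root n (f x) ^ (n - Suc 0))" if "x \<in> S" for x
    using assms that n by (intro DERIV_odd_real_root) auto
  show "continuous_on (f ` S) (\<lambda>y. inverse (real n * root n y ^ (n - Suc 0)))"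
    using assms(2) n by (intro continuous_intros) auto
qed

lemma C1_on_det:
  fixes A :: "'v::real_normed_vector \<Rightarrow> real^'n^'n"
  assumes "\<And>i j. C1_on S (\<lambda>x. A x $ i $ j)"
  shows "C1_on S (\<lambda>x. det (A x))"
  unfolding det_def by (intro C1_on_sum C1_on_mult C1_on_const C1_on_prod assms)

lemma C1_on_cong: "open S \<Longrightarrow> (\<And>x. x \<in> S \<Longrightarrow> f x = g x) \<Longrightarrow> C1_on S f \<Longrightarrow> C1_on S g"
  by (rule C1_onI[where D = "pd f"])
    (auto intro: has_derivative_transform_within_open[OF C1_on_deriv] C1_on_pd)

text \<open>Cramer's rule writes an entry of the inverse as a quotient of determinants of C1
  matrices.\<close>

lemma C1_on_matrix_inv:
  fixes A :: "'v::real_normed_vector \<Rightarrow> real^'n^'n"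
  assumes "open S" "\<And>i j. C1_on S (\<lambda>x. A x $ i $ j)" "\<And>x. x \<in> S \<Longrightarrow> invertible (A x)"
  shows "C1_on S (\<lambda>x. matrix_inv (A x) $ i $ j)"
proof (rule C1_on_cong[OF assms(1)])
  let ?C = "\<lambda>x. (\<chi> k l. if l = i then axis j 1 $ k else A x $ k $ l) :: real^'n^'n"
  have "C1_on S (\<lambda>x. ?C x $ k $ l)" for k l
    using assms(2) by (cases "l = i") (simp_all add: C1_on_const)
  then show "C1_on S (\<lambda>x. det (?C x) * inverse (det (A x)))"
    using assms by (intro C1_on_mult C1_on_inverse C1_on_det) (auto simp: invertible_det_nz)
  fix x assume "x \<in> S"
  then have "invertible (A x)" by (rule assms)
  then have "A x ** matrix_inv (A x) = mat 1"
    unfolding matrix_inv_def invertible_def by (rule someI2_ex) auto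
  then have "A x *v (matrix_inv (A x) *v axis j 1) = axis j 1"
    by (simp add: matrix_vector_mul_assoc)
  then have "matrix_inv (A x) *v axis j 1
      = (\<chi> k. det ((\<chi> a l. if l = k then axis j 1 $ a else A x $ a $ l) :: real^'n^'n) / det (A x))"
    using cramer \<open>invertible (A x)\<close> invertible_det_nz by blast
  then have "(matrix_inv (A x) *v axis j 1) $ i = det (?C x) / det (A x)" by simp
  then show "det (?C x) * inverse (det (A x)) = matrix_inv (A x) $ i $ j"
    by (simp add: matrix_vector_mult_basis column_def divide_inverse)
qed

lemma Ck_on_1_C1_on: "Ck_on (Suc 0) S f \<Longrightarrow> C1_on S f"
  by (simp add: C1_on_def)

lemma smooth_on_C1_on: "smooth_on S f \<Longrightarrow> C1_on S f"
  unfolding smooth_on_def by (blast intro: Ck_on_1_C1_on)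

lemma smooth_on_pd: "smooth_on S f \<Longrightarrow> smooth_on S (\<lambda>x. pd f x u)"
  unfolding smooth_on_def by (metis Ck_on.simps(2))

text \<open>The second difference f(x + hu + hv) - f(x + hu) - f(x + hv) + f(x) is symmetric in u
  and v. Applying the mean value theorem twice makes it h^2 times either mixed derivative at a point
  near x, and continuity lets h tend to 0.\<close>

lemma pd_swap:
  fixes f :: "'v::real_normed_vector \<Rightarrow> real"
  assumes "open S" "smooth_on S f" "x \<in> S"
  shows "pd (\<lambda>x. pd f x u) x v = pd (\<lambda>x. pd f x v) x u"
proof -
  have d1: "(f has_derivative pd f y) (at y)" if "y \<in> S" for y
    using C1_on_deriv smooth_on_C1_on assms(2) that by blast
  have d2: "((\<lambda>x. pd f x a) has_derivative pd (\<lambda>x. pd f x a) y) (at y)" if "y \<in> S" for y a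
    using C1_on_deriv smooth_on_C1_on smooth_on_pd assms(2) that by blast
  have cont: "continuous_on S (\<lambda>y. pd (\<lambda>x. pd f x a) y b)" for a b
    using C1_on_pd smooth_on_C1_on smooth_on_pd assms(2) by blast
  obtain r where r: "r > 0" "ball x r \<subseteq> S" using assms open_contains_ball by blast
  define K where "K = norm u + norm v + 1"
  have K: "K > 0" by (simp add: K_def add_nonneg_pos)
  have inS: "x + s *\<^sub>R a + t *\<^sub>R b \<in> S"
    if "0 \<le> s" "s \<le> h" "0 \<le> t" "t \<le> h" "h * K < r" "{a, b} = {u, v}" for s t h a b
  proof -
    have "norm (s *\<^sub>R a + t *\<^sub>R b) \<le> s * norm a + t * norm b"
      using norm_triangle_ineq[of "s *\<^sub>R a" "t *\<^sub>R b"] that by simp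
    also have "\<dots> \<le> h * norm a + h * norm b"
      using that by (intro add_mono mult_right_mono) auto
    also have "\<dots> \<le> h * K"
      using that by (auto simp: K_def doubleton_eq_iff algebra_simps)
    finally show ?thesis using that r by (auto simp: dist_norm norm_minus_commute algebra_simps subset_iff)
  qed
  have mvt: "\<exists>s t. 0 \<le> s \<and> s \<le> h \<and> 0 \<le> t \<and> t \<le> h \<and>
      f (x + h *\<^sub>R a + h *\<^sub>R b) - f (x + h *\<^sub>R a) - f (x + h *\<^sub>R b) + f x
       = h * (h * pd (\<lambda>x. pd f x a) (x + s *\<^sub>R a + t *\<^sub>R b) b)"
    if h: "h > 0" "h * K < r" and ab: "{a, b} = {u, v}" for h a b
  proof -
    define G where "G s = f (x + s *\<^sub>R a + h *\<^sub>R b) - f (x + s *\<^sub>R a)" for s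
    have "DERIV G s :> pd f (x + s *\<^sub>R a + h *\<^sub>R b) a - pd f (x + s *\<^sub>R a) a" if "0 \<le> s" "s \<le> h" for s
    proof -
      have 1: "((\<lambda>s. f (x + s *\<^sub>R a + t *\<^sub>R b)) has_derivative (\<lambda>d. d * pd f (x + s *\<^sub>R a + t *\<^sub>R b) a)) (at s)"
        if "0 \<le> t" "t \<le> h" for t
      proof -
        have "((\<lambda>s. x + s *\<^sub>R a + t *\<^sub>R b) has_derivative (\<lambda>d. d *\<^sub>R a)) (at s)"
          by (auto intro!: derivative_eq_intros)
        moreover have S': "x + s *\<^sub>R a + t *\<^sub>R b \<in> S"
          using inS[of s h t a b] h ab that \<open>0 \<le> s\<close> \<open>s \<le> h\<close> by auto
        ultimately have "((\<lambda>s. f (x + s *\<^sub>R a + t *\<^sub>R b)) has_derivative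
            (\<lambda>d. pd f (x + s *\<^sub>R a + t *\<^sub>R b) (d *\<^sub>R a))) (at s)"
          using has_derivative_compose d1 by blast
        moreover have "linear (pd f (x + s *\<^sub>R a + t *\<^sub>R b))"
          using d1[OF S'] has_derivative_linear by blast
        ultimately show ?thesis by (simp add: linear_cmul)
      qed
      have "((\<lambda>s. f (x + s *\<^sub>R a + h *\<^sub>R b) - f (x + s *\<^sub>R a + 0 *\<^sub>R b)) has_derivative
          (\<lambda>d. d * pd f (x + s *\<^sub>R a + h *\<^sub>R b) a - d * pd f (x + s *\<^sub>R a + 0 *\<^sub>R b) a)) (at s)"
        using h by (intro has_derivative_diff 1) auto
      moreover have "(\<lambda>d. d * p - d * q) = (*) (p - q)" for p q :: real
        by (simp add: fun_eq_iff algebra_simps)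
      ultimately show ?thesis
        unfolding G_def has_field_derivative_def by simp
    qed
    from MVT2[OF h(1), of G, OF this] obtain s where s: "0 < s" "s < h"
      "G h - G 0 = h * (pd f (x + s *\<^sub>R a + h *\<^sub>R b) a - pd f (x + s *\<^sub>R a) a)" by auto
    have "DERIV (\<lambda>t. pd f (x + s *\<^sub>R a + t *\<^sub>R b) a) t :> pd (\<lambda>x. pd f x a) (x + s *\<^sub>R a + t *\<^sub>R b) b"
      if "0 \<le> t" "t \<le> h" for t
    proof -
      have "((\<lambda>t. x + s *\<^sub>R a + t *\<^sub>R b) has_derivative (\<lambda>d. d *\<^sub>R b)) (at t)"
        by (auto intro!: derivative_eq_intros)
      moreover have S': "x + s *\<^sub>R a + t *\<^sub>R b \<in> S"
        using inS[of s h t a b] h ab that s by auto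
      ultimately have "((\<lambda>t. pd f (x + s *\<^sub>R a + t *\<^sub>R b) a) has_derivative
          (\<lambda>d. pd (\<lambda>x. pd f x a) (x + s *\<^sub>R a + t *\<^sub>R b) (d *\<^sub>R b))) (at t)"
        by (rule has_derivative_compose[OF _ d2])
      moreover have "linear (pd (\<lambda>x. pd f x a) (x + s *\<^sub>R a + t *\<^sub>R b))"
        using d2[OF S'] has_derivative_linear by blast
      moreover have "(\<lambda>d. d * p) = (*) p" for p :: real
        by (simp add: fun_eq_iff)
      ultimately show ?thesis by (simp add: has_field_derivative_def linear_cmul)
    qed
    from MVT2[OF h(1) this] obtain t where t: "0 < t" "t < h"
      "pd f (x + s *\<^sub>R a + h *\<^sub>R b) a - pd f (x + s *\<^sub>R a + 0 *\<^sub>R b) a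
        = h * pd (\<lambda>x. pd f x a) (x + s *\<^sub>R a + t *\<^sub>R b) b" by auto
    show ?thesis using s t by (intro exI[of _ s] exI[of _ t]) (auto simp: G_def)
  qed
  show ?thesis
  proof (rule ccontr)
    let ?P = "\<lambda>y. pd (\<lambda>x. pd f x u) y v" and ?Q = "\<lambda>y. pd (\<lambda>x. pd f x v) y u"
    assume ne: "?P x \<noteq> ?Q x"
    define e where "e = \<bar>?P x - ?Q x\<bar> / 2"
    have e: "e > 0" using ne by (simp add: e_def)
    obtain d1 where d1: "d1 > 0" "\<And>y. y \<in> S \<Longrightarrow> dist y x < d1 \<Longrightarrow> dist (?P y) (?P x) < e"
      using cont[of u v] assms(3) e unfolding continuous_on_iff by blast
    obtain d2 where d2: "d2 > 0" "\<And>y. y \<in> S \<Longrightarrow> dist y x < d2 \<Longrightarrow> dist (?Q y) (?Q x) < e"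
      using cont[of v u] assms(3) e unfolding continuous_on_iff by blast
    \<comment> \<open>The factor 2 makes all three bounds on h * K strict.\<close>
    define h where "h = min r (min d1 d2) / (2 * K)"
    have h: "h > 0" "h * K < r" "h * K < d1" "h * K < d2"
      using r d1 d2 K by (auto simp: h_def min_def)
    obtain s t where st: "0 \<le> s" "s \<le> h" "0 \<le> t" "t \<le> h"
      "f (x + h *\<^sub>R u + h *\<^sub>R v) - f (x + h *\<^sub>R u) - f (x + h *\<^sub>R v) + f x = h * (h * ?P (x + s *\<^sub>R u + t *\<^sub>R v))"
      using mvt[of h u v] h by auto
    obtain s' t' where st': "0 \<le> s'" "s' \<le> h" "0 \<le> t'" "t' \<le> h"
      "f (x + h *\<^sub>R v + h *\<^sub>R u) - f (x + h *\<^sub>R v) - f (x + h *\<^sub>R u) + f x = h * (h * ?Q (x + s' *\<^sub>R v + t' *\<^sub>R u))"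
      using mvt[of h v u] h by (auto simp: insert_commute)
    have "h * (h * ?P (x + s *\<^sub>R u + t *\<^sub>R v)) = h * (h * ?Q (x + s' *\<^sub>R v + t' *\<^sub>R u))"
      using st(5) st'(5) by (simp add: algebra_simps)
    then have "?P (x + s *\<^sub>R u + t *\<^sub>R v) = ?Q (x + s' *\<^sub>R v + t' *\<^sub>R u)" using h by simp
    moreover have near: "dist (x + p *\<^sub>R a + q *\<^sub>R b) x \<le> h * K"
      if "0 \<le> p" "p \<le> h" "0 \<le> q" "q \<le> h" "{a, b} = {u, v}" for p q a b
    proof -
      have "norm (p *\<^sub>R a + q *\<^sub>R b) \<le> p * norm a + q * norm b"
        using norm_triangle_ineq[of "p *\<^sub>R a" "q *\<^sub>R b"] that by simp
      also have "\<dots> \<le> h * norm a + h * norm b"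
        using that by (intro add_mono mult_right_mono) auto
      also have "\<dots> \<le> h * K"
        using that h by (auto simp: K_def doubleton_eq_iff algebra_simps)
      finally show ?thesis by (simp add: dist_norm add.assoc)
    qed
    have "dist (?P (x + s *\<^sub>R u + t *\<^sub>R v)) (?P x) < e"
      using near[of s t u v] st h inS[of s h t u v] by (intro d1) auto
    moreover have "dist (?Q (x + s' *\<^sub>R v + t' *\<^sub>R u)) (?Q x) < e"
      using near[of s' t' v u] st' h inS[of s' h t' v u] by (intro d2) (auto simp: insert_commute)
    ultimately show False by (simp add: e_def dist_real_def abs_if split: if_splits)
  qed
qed

lemma alt_form_3_swap12: "alt_form 3 \<omega> \<Longrightarrow> \<omega> [y, x, z] = - \<omega> [x, y, z]"
  by (rule alt_form_swap2)

lemma alt_form_3_swap23: "alt_form 3 \<omega> \<Longrightarrow> \<omega> [x, z, y] = - \<omega> [x, y, z]"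
  using alt_form_swap[of 3 \<omega> 1 2 "[x, y, z]"] by (simp add: numeral_2_eq_2)

text \<open>
  With \<open>v\<close> the value of the volume form on the standard basis, \<open>B = 6 v g\<close> and \<open>v\<^sup>2 = det g\<close>, hence
  \<open>det B = 6\<^sup>7 v\<^sup>9\<close>. This makes the metric a differentiable function of the 3-form.
\<close>

lemma G2_form_metric_root:
  fixes \<phi> :: cov
  defines "B \<equiv> \<lambda>X Y. wedge (wedge (contract X \<phi>) (contract Y \<phi>)) \<phi> std_basis"
  defines "b \<equiv> det ((\<chi> i j. B (axis i 1) (axis j 1)) :: real^7^7)"
  assumes "G2_form \<phi>"
  shows "b \<noteq> 0" "G2_metric \<phi> X Y = B X Y * inverse (6 * root 9 (b / 6 ^ 7))"
proof -
  obtain L where "G2_linear \<phi> L"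
    using assms(3) unfolding G2_form_def G2_linear_def by blast
  then interpret G2_linear \<phi> L .
  obtain v where v: "v \<noteq> 0" "v\<^sup>2 = det ((\<chi> i j. G2_metric \<phi> (axis i 1) (axis j 1)) :: real^7^7)"
    "\<And>X Y. B X Y = 6 * v * G2_metric \<phi> X Y"
    using metric_volume_determinant unfolding B_def by blast
  have "b = (6 * v) ^ 7 * v\<^sup>2"
  proof -
    have "((\<chi> i j. B (axis i 1) (axis j 1)) :: real^7^7)
        = (\<chi> i. (6 * v) *s ((\<chi> i j. G2_metric \<phi> (axis i 1) (axis j 1)) :: real^7^7) $ i)"
      by (simp add: v(3) vec_eq_iff)
    then show ?thesis unfolding b_def v(2) by (simp only: det_rows_mul) simp
  qed
  then have b: "b = 6 ^ 7 * v ^ 9" by (simp add: power_mult_distrib flip: power_add)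
  then have "root 9 (b / 6 ^ 7) = v" by (simp add: odd_real_root_power_cancel)
  then show "b \<noteq> 0" "G2_metric \<phi> X Y = B X Y * inverse (6 * root 9 (b / 6 ^ 7))"
    using v b by (simp_all add: field_simps)
qed

text \<open>\<open>B\<close> is polynomial in the components of the 3-form and its determinant has
  no zero on S, so the root and the inverse in \<open>G2_form_metric_root\<close> preserve
  C1.\<close>

lemma C1_on_G2_metric:
  assumes S: "open S" and G2: "\<And>x. x \<in> S \<Longrightarrow> G2_form (\<phi> x)" and C1: "\<And>vs. C1_on S (\<lambda>x. \<phi> x vs)"
  shows "C1_on S (\<lambda>x. G2_metric (\<phi> x) X Y)"
proof -
  define B where "B x X Y = wedge (wedge (contract X (\<phi> x)) (contract Y (\<phi> x))) (\<phi> x) std_basis" for x X Y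
  define b where "b x = det ((\<chi> i j. B x (axis i 1) (axis j 1)) :: real^7^7)" for x
  have B: "C1_on S (\<lambda>x. B x X Y)" for X Y
    unfolding B_def wedge_def contract_def by (intro C1_on_sum C1_on_mult C1_on_const C1)
  have b: "C1_on S b" unfolding b_def by (rule C1_on_det) (simp add: B)
  have nz: "b x \<noteq> 0" if "x \<in> S" for x
    using G2_form_metric_root(1)[OF G2[OF that]] by (simp add: b_def B_def)
  have r: "root 9 (b x / 6 ^ 7) \<noteq> 0" if "x \<in> S" for x using nz[OF that] by simp
  have "C1_on S (\<lambda>x. B x X Y * inverse (6 * root 9 (b x * (1 / 6 ^ 7))))"
    by (intro C1_on_mult B C1_on_inverse C1_on_const C1_on_root b) (use nz r in auto)
  then show ?thesis
    by (rule C1_on_cong[OF S, rotated]) (simp add: G2_form_metric_root(2)[OF G2] B_def b_def)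
qed

section \<open>The Laplace equation in a chart\<close>

text \<open>A predicate on constant vectors: n is adapted to the form at one point, and stays fixed
  while the form varies around that point.\<close>

definition G2_frame :: "cov \<Rightarrow> (7 \<Rightarrow> vec7) \<Rightarrow> bool" where
  "G2_frame \<phi> n \<longleftrightarrow>
     (\<forall>i j. G2_metric \<phi> (n i) (n j) = (if i = j then 1 else 0)) \<and>
     (\<forall>v. v = (\<Sum>i\<in>UNIV. G2_metric \<phi> v (n i) *\<^sub>R n i)) \<and>
     (\<forall>i. sharp_dx (G2_metric \<phi>) i = (\<Sum>r\<in>UNIV. n r $ i *\<^sub>R n r)) \<and>
     (\<forall>B w. (\<Sum>i\<in>UNIV. \<Sum>j\<in>UNIV. \<phi> [w, n i, n j] * contract2 B (G2_star \<phi>) [n i, n j])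
        = 4 * contract2 B \<phi> [w])"

lemma G2_form_frame: "G2_form \<phi> \<Longrightarrow> \<exists>n. G2_frame \<phi> n"
proof -
  assume "G2_form \<phi>"
  then obtain L where "G2_linear \<phi> L" unfolding G2_form_def G2_linear_def by blast
  then interpret G2_linear \<phi> L .
  have "G2_frame \<phi> frame"
    unfolding G2_frame_def
    by (intro conjI allI frame_orthonormal frame_expand sharp_dx_frame contract2_star_frame)
  then show ?thesis by (rule exI[of _ frame])
qed

lemma G2_form_alt: "G2_form \<phi> \<Longrightarrow> alt_form 3 \<phi>"
proof -
  assume "G2_form \<phi>"
  then obtain L where "linear L" "\<phi> = (\<lambda>vs. phi0 (map L vs))" unfolding G2_form_def by blast
  then show ?thesis using alt_form_pullback[OF alt_form_phi0] by simp
qed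

lemma G2_form_inner_product: "G2_form \<phi> \<Longrightarrow> inner_product (G2_metric \<phi>)"
proof -
  assume "G2_form \<phi>"
  then obtain L where "G2_linear \<phi> L" unfolding G2_form_def G2_linear_def by blast
  then interpret G2_linear \<phi> L .
  show ?thesis using inner_product_L by (simp add: G2_metric_L)
qed

lemma G2_form_gram_invertible:
  "G2_form \<phi> \<Longrightarrow> invertible ((\<chi> k l. G2_metric \<phi> (axis k 1) (axis l 1)) :: real^7^7)"
proof -
  assume "G2_form \<phi>"
  then obtain L where "G2_linear \<phi> L" unfolding G2_form_def G2_linear_def by blast
  then interpret G2_linear \<phi> L .
  show ?thesis using metric_volume_determinant by (auto simp: invertible_det_nz)
qed

lemma linear_pd_param:
  fixes F :: "'v::real_normed_vector \<Rightarrow> 'w::real_vector \<Rightarrow> real"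
  assumes "open U" "x \<in> U" "\<And>y. y \<in> U \<Longrightarrow> linear (F y)" "\<And>v. (\<lambda>y. F y v) differentiable (at x)"
  shows "linear (\<lambda>v. pd (\<lambda>y. F y v) x u)"
proof (rule linearI)
  fix v w
  have "pd (\<lambda>y. F y (v + w)) x u = pd (\<lambda>y. F y v + F y w) x u"
    by (rule pd_cong[OF assms(1,2)]) (simp add: linear_add[OF assms(3)])
  then show "pd (\<lambda>y. F y (v + w)) x u = pd (\<lambda>y. F y v) x u + pd (\<lambda>y. F y w) x u"
    by (simp add: pd_add assms(4))
next
  fix c v
  have "pd (\<lambda>y. F y (c *\<^sub>R v)) x u = pd (\<lambda>y. c * F y v) x u"
    by (rule pd_cong[OF assms(1,2)]) (simp add: linear_cmul[OF assms(3)])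
  then show "pd (\<lambda>y. F y (c *\<^sub>R v)) x u = c *\<^sub>R pd (\<lambda>y. F y v) x u"
    by (simp add: pd_cmult assms(4))
qed

text \<open>The contraction of F with a contravariant 2-tensor whose components in the frame n are
  m; coordinate sums on the left become frame sums on the right.\<close>

lemma bilinear_frame_sum:
  fixes F :: "vec7 \<Rightarrow> vec7 \<Rightarrow> real" and n :: "7 \<Rightarrow> vec7"
  assumes "\<And>v. linear (\<lambda>u. F u v)" "\<And>u. linear (\<lambda>v. F u v)"
  shows "(\<Sum>a\<in>UNIV. \<Sum>b\<in>UNIV. (\<Sum>r\<in>UNIV. \<Sum>s\<in>UNIV. n r $ a * n s $ b * m r s) * F (axis a 1) (axis b 1))
    = (\<Sum>r\<in>UNIV. \<Sum>s\<in>UNIV. m r s * F (n r) (n s))"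
proof -
  have F: "F (n r) (n s) = (\<Sum>a\<in>UNIV. \<Sum>b\<in>UNIV. n r $ a * n s $ b * F (axis a 1) (axis b 1))" for r s
    unfolding linear_vec7_expand[OF assms(1), of "n r"] linear_vec7_expand[OF assms(2), of _ "n s"]
    by (subst sum.swap) (simp add: sum_distrib_left mult_ac)
  show ?thesis
    unfolding F sum_distrib_left sum_distrib_right
    by (subst sum_swap4) (simp add: mult_ac)
qed

text \<open>
  Applied to the components of the connection, of the parallel 3-form and of \<open>d\<alpha>\<close> in an orthonormal frame.
\<close>

lemma connection_terms_cancel:
  fixes c P :: "'i::finite \<Rightarrow> 'i \<Rightarrow> 'i \<Rightarrow> real" and A :: "'i \<Rightarrow> 'i \<Rightarrow> real"
  assumes c: "\<And>k r s. c k r s = c r k s"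
    and P1: "\<And>k r s. P k r s = - P r k s" and P2: "\<And>k r s. P k r s = - P k s r"
    and A: "\<And>r s. A r s = - A s r"
  shows "(\<Sum>k\<in>UNIV. - (\<Sum>r\<in>UNIV. \<Sum>s\<in>UNIV. (c k r s + c k s r) * (\<Sum>t\<in>UNIV. P k r t * A s t))
      - (\<Sum>r\<in>UNIV. \<Sum>s\<in>UNIV. (c k r s + c k s r) * (\<Sum>t\<in>UNIV. P k t r * A t s))
      + (\<Sum>r\<in>UNIV. \<Sum>s\<in>UNIV. ((\<Sum>a\<in>UNIV. c k k a * P a r s) + (\<Sum>a\<in>UNIV. c k r a * P k a s)
          + (\<Sum>a\<in>UNIV. c k s a * P k r a)) * A r s))
    = (\<Sum>k\<in>UNIV. \<Sum>a\<in>UNIV. c k k a * (\<Sum>r\<in>UNIV. \<Sum>s\<in>UNIV. P a r s * A r s))"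
proof -
  \<comment> \<open>The derivatives of the two inverse metrics contribute - (X + Z) each, the
    connection acting on the second and third slot of P contributes X each, and the first slot gives
    the right hand side. What is left is Z, whose sum over k vanishes because c is symmetric and P
    is skew in k and r.\<close>
  define X where "X k = (\<Sum>r\<in>UNIV. \<Sum>s\<in>UNIV. \<Sum>t\<in>UNIV. c k s r * P k r t * A s t)" for k
  define Z where "Z k = (\<Sum>r\<in>UNIV. \<Sum>s\<in>UNIV. \<Sum>t\<in>UNIV. c k r s * P k r t * A s t)" for k
  have 1: "(\<Sum>r\<in>UNIV. \<Sum>s\<in>UNIV. (c k r s + c k s r) * (\<Sum>t\<in>UNIV. P k r t * A s t)) = Z k + X k" for k
    by (simp add: X_def Z_def sum_distrib_left sum.distrib algebra_simps)
  have 2: "(\<Sum>t\<in>UNIV. P k t r * A t s) = (\<Sum>t\<in>UNIV. P k r t * A s t)" for k r s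
    by (rule sum.cong[OF refl]) (metis P2 A minus_mult_minus)
  have 3: "(\<Sum>r\<in>UNIV. \<Sum>s\<in>UNIV. (\<Sum>a\<in>UNIV. c k r a * P k a s) * A r s) = X k" for k
  proof -
    have "(\<Sum>r\<in>UNIV. \<Sum>s\<in>UNIV. (\<Sum>a\<in>UNIV. c k r a * P k a s) * A r s)
        = (\<Sum>r\<in>UNIV. \<Sum>s\<in>UNIV. \<Sum>a\<in>UNIV. c k r a * P k a s * A r s)"
      by (simp add: sum_distrib_right)
    also have "\<dots> = (\<Sum>r\<in>UNIV. \<Sum>a\<in>UNIV. \<Sum>s\<in>UNIV. c k r a * P k a s * A r s)"
      by (rule sum.cong[OF refl], rule sum.swap)
    also have "\<dots> = X k" unfolding X_def by (rule sum.swap)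
    finally show ?thesis .
  qed
  have 4: "(\<Sum>r\<in>UNIV. \<Sum>s\<in>UNIV. (\<Sum>a\<in>UNIV. c k s a * P k r a) * A r s) = X k" for k
  proof -
    have "(\<Sum>a\<in>UNIV. c k s a * P k r a) * A r s = (\<Sum>a\<in>UNIV. c k s a * P k a r) * A s r" for r s
      by (simp add: P2[of k r] A[of r s] sum_negf)
    then have "(\<Sum>r\<in>UNIV. \<Sum>s\<in>UNIV. (\<Sum>a\<in>UNIV. c k s a * P k r a) * A r s)
      = (\<Sum>r\<in>UNIV. \<Sum>s\<in>UNIV. (\<Sum>a\<in>UNIV. c k s a * P k a r) * A s r)" by simp
    also have "\<dots> = (\<Sum>s\<in>UNIV. \<Sum>r\<in>UNIV. (\<Sum>a\<in>UNIV. c k s a * P k a r) * A s r)" by (rule sum.swap)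
    finally show ?thesis by (simp add: 3)
  qed
  have 5: "(\<Sum>r\<in>UNIV. \<Sum>s\<in>UNIV. (\<Sum>a\<in>UNIV. c k k a * P a r s) * A r s)
      = (\<Sum>a\<in>UNIV. c k k a * (\<Sum>r\<in>UNIV. \<Sum>s\<in>UNIV. P a r s * A r s))" for k
  proof -
    have "(\<Sum>r\<in>UNIV. \<Sum>s\<in>UNIV. (\<Sum>a\<in>UNIV. c k k a * P a r s) * A r s)
        = (\<Sum>r\<in>UNIV. \<Sum>s\<in>UNIV. \<Sum>a\<in>UNIV. c k k a * P a r s * A r s)"
      by (simp add: sum_distrib_right)
    also have "\<dots> = (\<Sum>r\<in>UNIV. \<Sum>a\<in>UNIV. \<Sum>s\<in>UNIV. c k k a * P a r s * A r s)"
      by (rule sum.cong[OF refl], rule sum.swap)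
    also have "\<dots> = (\<Sum>a\<in>UNIV. \<Sum>r\<in>UNIV. \<Sum>s\<in>UNIV. c k k a * P a r s * A r s)" by (rule sum.swap)
    finally show ?thesis by (simp add: sum_distrib_left mult_ac)
  qed
  have "(\<Sum>k\<in>UNIV. Z k) = - (\<Sum>k\<in>UNIV. Z k)"
  proof -
    have "(\<Sum>k\<in>UNIV. Z k) = (\<Sum>k\<in>UNIV. \<Sum>r\<in>UNIV. - (\<Sum>s\<in>UNIV. \<Sum>t\<in>UNIV. c r k s * P r k t * A s t))"
      unfolding Z_def sum_negf[symmetric]
      by (intro sum.cong refl) (metis P1 c mult_minus_left mult_minus_right)
    also have "\<dots> = - (\<Sum>k\<in>UNIV. Z k)"
      unfolding Z_def by (subst sum.swap) (simp add: sum_negf)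
    finally show ?thesis .
  qed
  then have Z: "(\<Sum>k\<in>UNIV. Z k) = 0" by simp
  have 6: "(\<Sum>r\<in>UNIV. \<Sum>s\<in>UNIV. ((\<Sum>a\<in>UNIV. c k k a * P a r s) + (\<Sum>a\<in>UNIV. c k r a * P k a s)
          + (\<Sum>a\<in>UNIV. c k s a * P k r a)) * A r s)
      = (\<Sum>a\<in>UNIV. c k k a * (\<Sum>r\<in>UNIV. \<Sum>s\<in>UNIV. P a r s * A r s)) + X k + X k" for k
    by (simp only: distrib_right sum.distrib 3 4 5)
  show ?thesis
    unfolding 2 1 6 by (simp add: sum.distrib sum_subtractf sum_negf Z flip: sum_distrib_left)
qed


lemma bilinear_frame_sum2:
  fixes X Y :: "vec7 \<Rightarrow> vec7 \<Rightarrow> real" and n :: "7 \<Rightarrow> vec7"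
  assumes "\<And>v. linear (\<lambda>u. X u v)" "\<And>u. linear (\<lambda>v. X u v)" "\<And>v. linear (\<lambda>u. Y u v)" "\<And>u. linear (\<lambda>v. Y u v)"
  shows "(\<Sum>a\<in>UNIV. \<Sum>b\<in>UNIV. \<Sum>c\<in>UNIV. \<Sum>d\<in>UNIV.
      ((\<Sum>r\<in>UNIV. \<Sum>s\<in>UNIV. n r $ a * n s $ b * m r s) * (\<Sum>t\<in>UNIV. \<Sum>u\<in>UNIV. n t $ c * n u $ d * m' t u))
      * (X (axis a 1) (axis c 1) * Y (axis b 1) (axis d 1)))
    = (\<Sum>r\<in>UNIV. \<Sum>s\<in>UNIV. m r s * (\<Sum>t\<in>UNIV. \<Sum>u\<in>UNIV. m' t u * (X (n r) (n t) * Y (n s) (n u))))"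
proof -
  define M where "M a b = (\<Sum>r\<in>UNIV. \<Sum>s\<in>UNIV. n r $ a * n s $ b * m r s)" for a b
  define M' where "M' c d = (\<Sum>t\<in>UNIV. \<Sum>u\<in>UNIV. n t $ c * n u $ d * m' t u)" for c d
  have 1: "(\<Sum>c\<in>UNIV. \<Sum>d\<in>UNIV. M' c d * (X p (axis c 1) * Y q (axis d 1)))
      = (\<Sum>t\<in>UNIV. \<Sum>u\<in>UNIV. m' t u * (X p (n t) * Y q (n u)))" for p q
    unfolding M'_def by (rule bilinear_frame_sum) (rule linear_const_mult linear_mult_const assms)+
  have "(\<Sum>a\<in>UNIV. \<Sum>b\<in>UNIV. \<Sum>c\<in>UNIV. \<Sum>d\<in>UNIV. (M a b * M' c d) * (X (axis a 1) (axis c 1) * Y (axis b 1) (axis d 1)))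
    = (\<Sum>a\<in>UNIV. \<Sum>b\<in>UNIV. M a b * (\<Sum>c\<in>UNIV. \<Sum>d\<in>UNIV. M' c d * (X (axis a 1) (axis c 1) * Y (axis b 1) (axis d 1))))"
    by (simp only: sum_distrib_left mult.assoc)
  also have "\<dots> = (\<Sum>a\<in>UNIV. \<Sum>b\<in>UNIV. M a b *
      (\<Sum>t\<in>UNIV. \<Sum>u\<in>UNIV. m' t u * (X (axis a 1) (n t) * Y (axis b 1) (n u))))"
    by (simp only: 1)
  also have "\<dots> = (\<Sum>r\<in>UNIV. \<Sum>s\<in>UNIV. m r s * (\<Sum>t\<in>UNIV. \<Sum>u\<in>UNIV. m' t u * (X (n r) (n t) * Y (n s) (n u))))"
    unfolding M_def by (rule bilinear_frame_sum) (rule linear_compose_sum[OF ballI] linear_const_mult linear_mult_const assms)+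
  finally show ?thesis by (simp only: M_def M'_def)
qed

lemma sum_antisym_eq_0:
  fixes T :: "'i::finite \<Rightarrow> 'i \<Rightarrow> 'i \<Rightarrow> real"
  assumes "\<And>k r s. T k r s = - T r k s"
  shows "(\<Sum>k\<in>UNIV. \<Sum>r\<in>UNIV. \<Sum>s\<in>UNIV. T k r s) = 0"
proof -
  have "(\<Sum>k\<in>UNIV. \<Sum>r\<in>UNIV. \<Sum>s\<in>UNIV. T k r s) = (\<Sum>k\<in>UNIV. \<Sum>r\<in>UNIV. - (\<Sum>s\<in>UNIV. T r k s))"
    unfolding sum_negf[symmetric] by (intro sum.cong refl assms)
  also have "\<dots> = - (\<Sum>k\<in>UNIV. \<Sum>r\<in>UNIV. \<Sum>s\<in>UNIV. T k r s)"
    by (subst sum.swap) (simp add: sum_negf)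
  finally show ?thesis by simp
qed

section \<open>The Levi-Civita connection and the inverse metric in a chart\<close>

locale G2_domain =
  fixes U :: "vec7 set" and \<phi> :: "vec7 \<Rightarrow> cov"
  assumes open_U: "open U"
    and G2: "x \<in> U \<Longrightarrow> G2_form (\<phi> x)"
    and C1_phi: "C1_on U (\<lambda>x. \<phi> x vs)"
begin

abbreviation g :: "vec7 \<Rightarrow> vec7 \<Rightarrow> vec7 \<Rightarrow> real" where
  "g x \<equiv> G2_metric (\<phi> x)"

definition \<Gamma> :: "vec7 \<Rightarrow> vec7 \<Rightarrow> vec7 \<Rightarrow> vec7" where
  "\<Gamma> x u v = (\<Sum>l\<in>UNIV. ((pd (\<lambda>y. g y v (axis l 1)) x u + pd (\<lambda>y. g y u (axis l 1)) x v
      - pd (\<lambda>y. g y u v) x (axis l 1)) / 2) *\<^sub>R sharp_dx (g x) l)"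

definition h :: "vec7 \<Rightarrow> 7 \<Rightarrow> 7 \<Rightarrow> real" where
  "h x a b = matrix_inv (\<chi> k l. g x (axis k 1) (axis l 1)) $ a $ b"

lemma C1_g: "C1_on U (\<lambda>x. g x v w)"
  by (rule C1_on_G2_metric[OF open_U G2 C1_phi])

lemma C1_h: "C1_on U (\<lambda>x. h x a b)"
  unfolding h_def
  by (rule C1_on_matrix_inv[OF open_U]) (simp_all add: C1_g G2_form_gram_invertible G2)

lemma diff_g: "x \<in> U \<Longrightarrow> (\<lambda>y. g y v w) differentiable (at x)"
  by (rule C1_on_differentiable[OF C1_g])

lemma diff_h: "x \<in> U \<Longrightarrow> (\<lambda>y. h y a b) differentiable (at x)"
  by (rule C1_on_differentiable[OF C1_h])

lemma diff_phi: "x \<in> U \<Longrightarrow> (\<lambda>y. \<phi> y vs) differentiable (at x)"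
  by (rule C1_on_differentiable[OF C1_phi])

lemma linear_g: assumes "x \<in> U" shows "linear (\<lambda>v. g x v w)" "linear (g x v)"
  using G2_form_inner_product[OF G2[OF assms]] by (auto simp: inner_product_def bilinear_def)

lemma g_sym: "x \<in> U \<Longrightarrow> g x v w = g x w v"
  using G2_form_inner_product[OF G2] by (auto simp: inner_product_def)

lemma linear_pd_g:
  assumes "x \<in> U"
  shows "linear (\<lambda>v. pd (\<lambda>y. g y v w) x u)" "linear (\<lambda>v. pd (\<lambda>y. g y w v) x u)"
  by (rule linear_pd_param[OF open_U assms]; simp add: linear_g diff_g assms)+

lemma pd_g_sym: "x \<in> U \<Longrightarrow> pd (\<lambda>y. g y v w) x u = pd (\<lambda>y. g y w v) x u"
  by (rule pd_cong[OF open_U]) (auto intro: g_sym)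

lemma g_sharp: assumes "x \<in> U" shows "g x (sharp_dx (g x) l) w = w $ l"
proof -
  obtain n where n: "G2_frame (\<phi> x) n" using G2_form_frame[OF G2[OF assms]] by blast
  have s: "sharp_dx (g x) l = (\<Sum>r\<in>UNIV. n r $ l *\<^sub>R n r)"
    and w: "w = (\<Sum>i\<in>UNIV. g x w (n i) *\<^sub>R n i)" using n by (auto simp: G2_frame_def)
  have "g x (sharp_dx (g x) l) w = (\<Sum>r\<in>UNIV. n r $ l * g x w (n r))"
    unfolding s linear_sum[OF linear_g(1)[OF assms]] linear_cmul[OF linear_g(1)[OF assms]]
    using g_sym[OF assms] by simp
  also have "\<dots> = (\<Sum>i\<in>UNIV. g x w (n i) *\<^sub>R n i) $ l" by (simp add: mult.commute)
  finally show ?thesis by (simp only: w[symmetric])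
qed

text \<open>The Koszul formula for coordinate fields, whose brackets vanish.\<close>

lemma g_\<Gamma>:
  assumes "x \<in> U"
  shows "g x (\<Gamma> x u v) w = (pd (\<lambda>y. g y v w) x u + pd (\<lambda>y. g y u w) x v - pd (\<lambda>y. g y u v) x w) / 2"
proof -
  have "g x (\<Gamma> x u v) w = (\<Sum>l\<in>UNIV. w $ l * ((pd (\<lambda>y. g y v (axis l 1)) x u + pd (\<lambda>y. g y u (axis l 1)) x v
      - pd (\<lambda>y. g y u v) x (axis l 1)) / 2))"
    unfolding \<Gamma>_def linear_sum[OF linear_g(1)[OF assms]] linear_cmul[OF linear_g(1)[OF assms]] g_sharp[OF assms]
    by (simp add: mult.commute)
  also have "\<dots> = ((\<Sum>l\<in>UNIV. w $ l * pd (\<lambda>y. g y v (axis l 1)) x u)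
     + (\<Sum>l\<in>UNIV. w $ l * pd (\<lambda>y. g y u (axis l 1)) x v) - (\<Sum>l\<in>UNIV. w $ l * pd (\<lambda>y. g y u v) x (axis l 1))) / 2"
    by (simp add: sum.distrib sum_subtractf sum_divide_distrib algebra_simps add_divide_distrib diff_divide_distrib)
  also have "\<dots> = (pd (\<lambda>y. g y v w) x u + pd (\<lambda>y. g y u w) x v - pd (\<lambda>y. g y u v) x w) / 2"
    using linear_vec7_expand[OF linear_pd_g(2)[OF assms, of v u], of w]
      linear_vec7_expand[OF linear_pd_g(2)[OF assms, of u v], of w]
      linear_vec7_expand[OF linear_pd[OF diff_g[OF assms]], of u v w] by simp
  finally show ?thesis .
qed

text \<open>Metric compatibility of the connection.\<close>

lemma pd_g: "x \<in> U \<Longrightarrow> pd (\<lambda>y. g y v w) x u = g x (\<Gamma> x u v) w + g x (\<Gamma> x u w) v"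
  by (simp add: g_\<Gamma> pd_g_sym[of x w v] field_simps)

text \<open>Vanishing torsion.\<close>

lemma g_\<Gamma>_sym: "x \<in> U \<Longrightarrow> g x (\<Gamma> x u v) w = g x (\<Gamma> x v u) w"
  by (simp add: g_\<Gamma> pd_g_sym[of x u v] add.commute)

lemma h_frame:
  assumes "G2_frame (\<phi> x) n"
  shows "h x a b = (\<Sum>r\<in>UNIV. n r $ a * n r $ b)"
proof -
  have "h x a b = sharp_dx (g x) b $ a"
    by (simp add: h_def sharp_dx_def matrix_vector_mult_basis column_def)
  also have "\<dots> = (\<Sum>r\<in>UNIV. n r $ b *\<^sub>R n r) $ a"
    using assms by (simp add: G2_frame_def)
  finally show ?thesis by (simp add: mult.commute)
qed

lemma h_g_inverse:
  assumes "x \<in> U"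
  shows "(\<Sum>c\<in>UNIV. h x a c * g x (axis c 1) (axis d 1)) = (if a = d then 1 else 0)"
    "(\<Sum>c\<in>UNIV. g x (axis a 1) (axis c 1) * h x c d) = (if a = d then 1 else 0)"
proof -
  let ?G = "(\<chi> k l. g x (axis k 1) (axis l 1)) :: real^7^7"
  have "?G ** matrix_inv ?G = mat 1 \<and> matrix_inv ?G ** ?G = mat 1"
    using G2_form_gram_invertible[OF G2[OF assms]]
    unfolding matrix_inv_def invertible_def by (rule someI_ex)
  then have "(matrix_inv ?G ** ?G) $ a $ d = mat 1 $ a $ d" "(?G ** matrix_inv ?G) $ a $ d = mat 1 $ a $ d"
    by simp_all
  then show "(\<Sum>c\<in>UNIV. h x a c * g x (axis c 1) (axis d 1)) = (if a = d then 1 else 0)"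
    "(\<Sum>c\<in>UNIV. g x (axis a 1) (axis c 1) * h x c d) = (if a = d then 1 else 0)"
    by (simp_all add: matrix_matrix_mult_def h_def mat_def)
qed

text \<open>Differentiating h g = 1 gives dh = - h (dg) h; the two outer factors are then expanded
  in the frame.\<close>

lemma pd_h_frame:
  assumes x: "x \<in> U" and n: "G2_frame (\<phi> x) n"
  shows "pd (\<lambda>y. h y a b) x u
    = (\<Sum>r\<in>UNIV. \<Sum>s\<in>UNIV. n r $ a * n s $ b * (- pd (\<lambda>y. g y (n r) (n s)) x u))"
proof -
  let ?e = "\<lambda>c. axis c 1 :: vec7"
  have 1: "(\<Sum>c\<in>UNIV. pd (\<lambda>y. h y a c) x u * g x (?e c) (?e d)) = - (\<Sum>c\<in>UNIV. h x a c * pd (\<lambda>y. g y (?e c) (?e d)) x u)" for d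
  proof -
    have "pd (\<lambda>y. \<Sum>c\<in>UNIV. h y a c * g y (?e c) (?e d)) x u = pd (\<lambda>y. if a = d then 1 else 0) x u"
      by (rule pd_cong[OF open_U x]) (rule h_g_inverse)
    also have "\<dots> = 0" by simp
    also have "pd (\<lambda>y. \<Sum>c\<in>UNIV. h y a c * g y (?e c) (?e d)) x u
      = (\<Sum>c\<in>UNIV. pd (\<lambda>y. h y a c) x u * g x (?e c) (?e d) + h x a c * pd (\<lambda>y. g y (?e c) (?e d)) x u)"
      by (subst pd_sum) (simp_all add: pd_mult diff_h diff_g x)
    finally show ?thesis by (simp add: sum.distrib eq_neg_iff_add_eq_0)
  qed
  have "pd (\<lambda>y. h y a b) x u = (\<Sum>c\<in>UNIV. pd (\<lambda>y. h y a c) x u * (if c = b then 1 else 0))"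
    by (simp add: if_distrib[of "(*) _"] cong: if_cong)
  also have "\<dots> = (\<Sum>c\<in>UNIV. pd (\<lambda>y. h y a c) x u * (\<Sum>d\<in>UNIV. g x (?e c) (?e d) * h x d b))"
    by (simp only: h_g_inverse(2)[OF x])
  also have "\<dots> = (\<Sum>d\<in>UNIV. (\<Sum>c\<in>UNIV. pd (\<lambda>y. h y a c) x u * g x (?e c) (?e d)) * h x d b)"
    unfolding sum_distrib_left sum_distrib_right by (subst sum.swap) (simp add: mult.assoc)
  also have "\<dots> = - (\<Sum>d\<in>UNIV. \<Sum>c\<in>UNIV. h x a c * pd (\<lambda>y. g y (?e c) (?e d)) x u * h x d b)"
    unfolding 1 by (simp add: sum_negf sum_distrib_right)
  also have "(\<Sum>d\<in>UNIV. \<Sum>c\<in>UNIV. h x a c * pd (\<lambda>y. g y (?e c) (?e d)) x u * h x d b)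
      = (\<Sum>c\<in>UNIV. \<Sum>d\<in>UNIV. (h x a c * h x d b) * pd (\<lambda>y. g y (?e c) (?e d)) x u)"
    by (subst sum.swap) (simp add: mult_ac)
  also have "\<dots> = (\<Sum>c\<in>UNIV. \<Sum>d\<in>UNIV. (\<Sum>r\<in>UNIV. \<Sum>s\<in>UNIV. n r $ c * n s $ d * (n r $ a * n s $ b)) * pd (\<lambda>y. g y (?e c) (?e d)) x u)"
    unfolding h_frame[OF n] sum_product by (simp add: mult_ac)
  also have "\<dots> = (\<Sum>r\<in>UNIV. \<Sum>s\<in>UNIV. (n r $ a * n s $ b) * pd (\<lambda>y. g y (n r) (n s)) x u)"
    by (rule bilinear_frame_sum) (rule linear_pd_g[OF x])+
  finally show ?thesis by (simp add: sum_negf)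
qed


text \<open>
  The identity \<open>E\<close> in the proof is written with the inverse metric \<open>h\<close> in the coordinate basis, where it
  can be differentiated; the result \<open>D\<close> is evaluated in a constant frame that is orthonormal at \<open>x\<close> only.
\<close>

lemma laplace_equation:
  fixes \<alpha> :: "vec7 \<Rightarrow> vec7 \<Rightarrow> real" and f :: "vec7 \<Rightarrow> real" and Q :: "vec7 \<Rightarrow> bivec7"
  assumes par: "\<And>x u a b c. x \<in> U \<Longrightarrow> pd (\<lambda>y. \<phi> y [a, b, c]) x u
      = \<phi> x [\<Gamma> x u a, b, c] + \<phi> x [a, \<Gamma> x u b, c] + \<phi> x [a, b, \<Gamma> x u c]"
    and f: "smooth_on U f"
    and \<alpha>: "\<And>v. smooth_on U (\<lambda>x. \<alpha> x v)" "\<And>x. x \<in> U \<Longrightarrow> linear (\<alpha> x)"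
    and Qf: "\<And>x w. x \<in> U \<Longrightarrow> contract2 (Q x) (\<phi> x) [w] = pd f x w"
    and Q\<alpha>: "\<And>x u v. x \<in> U \<Longrightarrow> contract2 (Q x) (G2_star (\<phi> x)) [u, v]
      = pd (\<lambda>y. \<alpha> y v) x u - pd (\<lambda>y. \<alpha> y u) x v"
    and x: "x \<in> U" and n: "G2_frame (\<phi> x) n"
  shows "(\<Sum>k\<in>UNIV. pd (\<lambda>y. pd f y (n k)) x (n k)) = (\<Sum>k\<in>UNIV. pd f x (\<Gamma> x (n k) (n k)))"
proof -
  let ?e = "\<lambda>c. axis c 1 :: vec7"
  \<comment> \<open>A stands for d\<alpha>. It replaces the contraction of Q with the 4-form because
    its differentiability follows from that of \<alpha>, without any regularity of the star.\<close>
  define A where "A y u v = pd (\<lambda>z. \<alpha> z v) y u - pd (\<lambda>z. \<alpha> z u) y v" for y u v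
  have d\<alpha>: "(\<lambda>y. \<alpha> y v) differentiable (at y)" "(\<lambda>y. pd (\<lambda>z. \<alpha> z v) y u) differentiable (at y)"
    if "y \<in> U" for y u v
    using that \<alpha>(1) by (auto intro!: C1_on_differentiable[of U] smooth_on_C1_on smooth_on_pd)
  have dA: "(\<lambda>y. A y u v) differentiable (at y)" if "y \<in> U" for y u v
    unfolding A_def using d\<alpha>[OF that] by (intro differentiable_diff) auto
  have lA1: "linear (\<lambda>u. A y u v)" and lA2: "linear (\<lambda>v. A y u v)" if "y \<in> U" for y u v
    unfolding A_def
    by (intro linear_compose_sub linear_pd d\<alpha> linear_pd_param[OF open_U that] \<alpha>(2) that; assumption)+
  have A_sym: "A y u v = - A y v u" for y u v by (simp add: A_def)
  have lphi: "linear (\<lambda>a. \<phi> y [w, a, c])" "linear (\<lambda>c. \<phi> y [w, a, c])" if "y \<in> U" for y w a c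
    using alt_form_3_linear[OF G2_form_alt[OF G2[OF that]]] by auto
  have E: "(\<Sum>a\<in>UNIV. \<Sum>b\<in>UNIV. \<Sum>c\<in>UNIV. \<Sum>d\<in>UNIV.
      (h y a b * h y c d) * (\<phi> y [w, ?e a, ?e c] * A y (?e b) (?e d))) = 4 * pd f y w" if y: "y \<in> U" for y w
  proof -
    obtain m where m: "G2_frame (\<phi> y) m" using G2_form_frame[OF G2[OF y]] by blast
    have hm: "h y a b = (\<Sum>r\<in>UNIV. \<Sum>s\<in>UNIV. m r $ a * m s $ b * (if r = s then 1 else 0))" for a b
      by (simp add: h_frame[OF m] if_distrib[of "(*) _"] cong: if_cong)
    have "(\<Sum>a\<in>UNIV. \<Sum>b\<in>UNIV. \<Sum>c\<in>UNIV. \<Sum>d\<in>UNIV.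
        (h y a b * h y c d) * (\<phi> y [w, ?e a, ?e c] * A y (?e b) (?e d)))
      = (\<Sum>i\<in>UNIV. \<Sum>j\<in>UNIV. \<phi> y [w, m i, m j] * A y (m i) (m j))"
      unfolding hm
      by (subst bilinear_frame_sum2[where X = "\<lambda>p q. \<phi> y [w, p, q]"])
        (simp_all add: lphi lA1 lA2 y if_distrib[of "\<lambda>c. c * _"] cong: if_cong)
    also have "\<dots> = (\<Sum>i\<in>UNIV. \<Sum>j\<in>UNIV. \<phi> y [w, m i, m j] * contract2 (Q y) (G2_star (\<phi> y)) [m i, m j])"
      by (simp add: A_def Q\<alpha> y)
    also have "\<dots> = 4 * contract2 (Q y) (\<phi> y) [w]" using m by (simp add: G2_frame_def)
    finally show ?thesis by (simp add: Qf y)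
  qed
  define c where "c k r s = g x (\<Gamma> x (n k) (n r)) (n s)" for k r s
  define P where "P k r s = \<phi> x [n k, n r, n s]" for k r s
  have hn: "h x a b = (\<Sum>r\<in>UNIV. \<Sum>s\<in>UNIV. n r $ a * n s $ b * (if r = s then 1 else 0))" for a b
    by (simp add: h_frame[OF n] if_distrib[of "(*) _"] cong: if_cong)
  have ldphi: "linear (\<lambda>a. pd (\<lambda>y. \<phi> y [w, a, b]) x u)" "linear (\<lambda>b. pd (\<lambda>y. \<phi> y [w, a, b]) x u)" for w a b u
    by (rule linear_pd_param[OF open_U x]; simp add: lphi diff_phi x)+
  have ldA: "linear (\<lambda>a. pd (\<lambda>y. A y a b) x u)" "linear (\<lambda>b. pd (\<lambda>y. A y a b) x u)" for a b u
    by (rule linear_pd_param[OF open_U x]; simp add: lA1 lA2 dA x)+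
  \<comment> \<open>The four sums are the product rule applied to E: one for each inverse metric,
    one for \<phi>, one for d\<alpha>. Setting u = w = n k and summing over k takes the
    divergence.\<close>
  have D: "(\<Sum>r\<in>UNIV. \<Sum>s\<in>UNIV. - pd (\<lambda>y. g y (n r) (n s)) x u * (\<Sum>t\<in>UNIV. \<phi> x [w, n r, n t] * A x (n s) (n t)))
      + (\<Sum>r\<in>UNIV. \<Sum>s\<in>UNIV. - pd (\<lambda>y. g y (n r) (n s)) x u * (\<Sum>t\<in>UNIV. \<phi> x [w, n t, n r] * A x (n t) (n s)))
      + (\<Sum>r\<in>UNIV. \<Sum>s\<in>UNIV. pd (\<lambda>y. \<phi> y [w, n r, n s]) x u * A x (n r) (n s))
      + (\<Sum>r\<in>UNIV. \<Sum>s\<in>UNIV. \<phi> x [w, n r, n s] * pd (\<lambda>y. A y (n r) (n s)) x u)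
      = 4 * pd (\<lambda>y. pd f y w) x u" for u w
  proof -
    let ?hp = "\<lambda>a b. pd (\<lambda>y. h y a b) x u"
    let ?P = "\<lambda>a c. \<phi> x [w, ?e a, ?e c]" and ?P' = "\<lambda>a c. pd (\<lambda>y. \<phi> y [w, ?e a, ?e c]) x u"
    let ?A = "\<lambda>b d. A x (?e b) (?e d)" and ?A' = "\<lambda>b d. pd (\<lambda>y. A y (?e b) (?e d)) x u"
    note diffs = diff_h[OF x] diff_phi[OF x] dA[OF x]
    have "4 * pd (\<lambda>y. pd f y w) x u = pd (\<lambda>y. 4 * pd f y w) x u"
      using f x by (intro pd_cmult[symmetric] C1_on_differentiable[of U] smooth_on_C1_on smooth_on_pd)
    also have "\<dots> = pd (\<lambda>y. \<Sum>a\<in>UNIV. \<Sum>b\<in>UNIV. \<Sum>c\<in>UNIV. \<Sum>d\<in>UNIV.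
      (h y a b * h y c d) * (\<phi> y [w, ?e a, ?e c] * A y (?e b) (?e d))) x u"
      by (rule pd_cong[OF open_U x]) (rule E[symmetric])
    also have "\<dots> = (\<Sum>a\<in>UNIV. \<Sum>b\<in>UNIV. \<Sum>c\<in>UNIV. \<Sum>d\<in>UNIV.
        (?hp a b * h x c d + h x a b * ?hp c d) * (?P a c * ?A b d)
        + (h x a b * h x c d) * (?P' a c * ?A b d + ?P a c * ?A' b d))"
      by (simp add: pd_sum pd_mult diffs)
    also have "\<dots> = (\<Sum>a\<in>UNIV. \<Sum>b\<in>UNIV. \<Sum>c\<in>UNIV. \<Sum>d\<in>UNIV. (?hp a b * h x c d) * (?P a c * ?A b d))
      + (\<Sum>a\<in>UNIV. \<Sum>b\<in>UNIV. \<Sum>c\<in>UNIV. \<Sum>d\<in>UNIV. (h x a b * ?hp c d) * (?P a c * ?A b d))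
      + (\<Sum>a\<in>UNIV. \<Sum>b\<in>UNIV. \<Sum>c\<in>UNIV. \<Sum>d\<in>UNIV. (h x a b * h x c d) * (?P' a c * ?A b d))
      + (\<Sum>a\<in>UNIV. \<Sum>b\<in>UNIV. \<Sum>c\<in>UNIV. \<Sum>d\<in>UNIV. (h x a b * h x c d) * (?P a c * ?A' b d))"
      by (simp only: distrib_left distrib_right sum.distrib add.assoc)
    also have "(\<Sum>a\<in>UNIV. \<Sum>b\<in>UNIV. \<Sum>c\<in>UNIV. \<Sum>d\<in>UNIV. (?hp a b * h x c d) * (?P a c * ?A b d))
      = (\<Sum>r\<in>UNIV. \<Sum>s\<in>UNIV. - pd (\<lambda>y. g y (n r) (n s)) x u * (\<Sum>t\<in>UNIV. \<phi> x [w, n r, n t] * A x (n s) (n t)))"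
      unfolding hn pd_h_frame[OF x n]
      by (subst bilinear_frame_sum2[where X = "\<lambda>p q. \<phi> x [w, p, q]"])
        (simp_all add: lphi lA1 lA2 x if_distrib[of "\<lambda>c. c * _"] cong: if_cong)
    also have "(\<Sum>a\<in>UNIV. \<Sum>b\<in>UNIV. \<Sum>c\<in>UNIV. \<Sum>d\<in>UNIV. (h x a b * ?hp c d) * (?P a c * ?A b d))
      = (\<Sum>t\<in>UNIV. \<Sum>r\<in>UNIV. \<Sum>s\<in>UNIV. - pd (\<lambda>y. g y (n r) (n s)) x u * (\<phi> x [w, n t, n r] * A x (n t) (n s)))"
      unfolding hn pd_h_frame[OF x n]
      by (subst bilinear_frame_sum2[where X = "\<lambda>p q. \<phi> x [w, p, q]"])
        (simp_all add: lphi lA1 lA2 x if_distrib[of "\<lambda>c. c * _"] cong: if_cong)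
    also have "\<dots> = (\<Sum>r\<in>UNIV. \<Sum>s\<in>UNIV. - pd (\<lambda>y. g y (n r) (n s)) x u * (\<Sum>t\<in>UNIV. \<phi> x [w, n t, n r] * A x (n t) (n s)))"
      unfolding sum_distrib_left
      by (subst sum.swap, rule sum.cong[OF refl], rule sum.swap)
    also have "(\<Sum>a\<in>UNIV. \<Sum>b\<in>UNIV. \<Sum>c\<in>UNIV. \<Sum>d\<in>UNIV. (h x a b * h x c d) * (?P' a c * ?A b d))
      = (\<Sum>r\<in>UNIV. \<Sum>s\<in>UNIV. pd (\<lambda>y. \<phi> y [w, n r, n s]) x u * A x (n r) (n s))"
      unfolding hn
      by (subst bilinear_frame_sum2[where X = "\<lambda>p q. pd (\<lambda>y. \<phi> y [w, p, q]) x u"])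
        (simp_all add: ldphi lA1 lA2 x if_distrib[of "\<lambda>c. c * _"] cong: if_cong)
    also have "(\<Sum>a\<in>UNIV. \<Sum>b\<in>UNIV. \<Sum>c\<in>UNIV. \<Sum>d\<in>UNIV. (h x a b * h x c d) * (?P a c * ?A' b d))
      = (\<Sum>r\<in>UNIV. \<Sum>s\<in>UNIV. \<phi> x [w, n r, n s] * pd (\<lambda>y. A y (n r) (n s)) x u)"
      unfolding hn
      by (subst bilinear_frame_sum2[where X = "\<lambda>p q. \<phi> x [w, p, q]" and Y = "\<lambda>p q. pd (\<lambda>y. A y p q) x u"])
        (simp_all add: lphi ldA x if_distrib[of "\<lambda>c. c * _"] cong: if_cong)
    finally show ?thesis by simp
  qed
  have expand: "v = (\<Sum>a\<in>UNIV. g x v (n a) *\<^sub>R n a)" for v using n by (simp add: G2_frame_def)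
  have frame_sum: "F (\<Gamma> x (n k) (n r)) = (\<Sum>a\<in>UNIV. c k r a * F (n a))" if "linear F" for F :: "vec7 \<Rightarrow> real" and k r
  proof -
    have "F (\<Gamma> x (n k) (n r)) = F (\<Sum>a\<in>UNIV. c k r a *\<^sub>R n a)"
      unfolding c_def by (simp only: expand[of "\<Gamma> x (n k) (n r)", symmetric])
    then show ?thesis by (simp add: linear_sum[OF that] linear_cmul[OF that])
  qed
  note alt = G2_form_alt[OF G2[OF x]]
  have P1: "P k r s = - P r k s" and P2: "P k r s = - P k s r" for k r s
    unfolding P_def by (rule alt_form_3_swap12[OF alt], rule alt_form_3_swap23[OF alt])
  have dphi: "pd (\<lambda>y. \<phi> y [n k, n r, n s]) x (n k)
      = (\<Sum>a\<in>UNIV. c k k a * P a r s) + (\<Sum>a\<in>UNIV. c k r a * P k a s) + (\<Sum>a\<in>UNIV. c k s a * P k r a)" for k r s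
    unfolding par[OF x] P_def by (simp add: frame_sum[OF alt_form_3_linear(1)[OF alt]]
      frame_sum[OF alt_form_3_linear(2)[OF alt]] frame_sum[OF alt_form_3_linear(3)[OF alt]])
  have dg: "pd (\<lambda>y. g y (n r) (n s)) x (n k) = c k r s + c k s r" for k r s
    by (simp add: pd_g[OF x] c_def)
  have c_sym: "c k r s = c r k s" for k r s unfolding c_def by (rule g_\<Gamma>_sym[OF x])
  have PA: "(\<Sum>r\<in>UNIV. \<Sum>s\<in>UNIV. P a r s * A x (n r) (n s)) = 4 * pd f x (n a)" for a
  proof -
    have "(\<Sum>r\<in>UNIV. \<Sum>s\<in>UNIV. P a r s * A x (n r) (n s))
        = (\<Sum>r\<in>UNIV. \<Sum>s\<in>UNIV. \<phi> x [n a, n r, n s] * contract2 (Q x) (G2_star (\<phi> x)) [n r, n s])"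
      by (simp add: A_def P_def Q\<alpha> x)
    also have "\<dots> = 4 * contract2 (Q x) (\<phi> x) [n a]" using n by (simp add: G2_frame_def)
    finally show ?thesis by (simp add: Qf x)
  qed
  \<comment> \<open>Second derivatives of \<alpha>, symmetric in k and r, paired with P, which is
    skew in them. Both halves of the derivative of d\<alpha> reduce to this sum, the second by
    exchanging r and s.\<close>
  define B where "B k r s = pd (\<lambda>y. pd (\<lambda>z. \<alpha> z (n s)) y (n r)) x (n k)" for k r s
  have B: "B k r s = B r k s" for k r s
    unfolding B_def by (rule pd_swap[OF open_U \<alpha>(1) x])
  have "(\<Sum>k\<in>UNIV. \<Sum>r\<in>UNIV. \<Sum>s\<in>UNIV. P k r s * B k r s) = 0"
  proof (rule sum_antisym_eq_0)
    show "P k r s * B k r s = - (P r k s * B r k s)" for k r s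
      by (simp add: B[of k r s] P1[of k r s])
  qed
  moreover have "(\<Sum>k\<in>UNIV. \<Sum>r\<in>UNIV. \<Sum>s\<in>UNIV. P k r s * B k s r)
      = - (\<Sum>k\<in>UNIV. \<Sum>r\<in>UNIV. \<Sum>s\<in>UNIV. P k r s * B k r s)"
  proof -
    have "P k r s * B k s r = - (P k s r * B k s r)" for k r s
      by (subst P2) simp
    then have "(\<Sum>k\<in>UNIV. \<Sum>r\<in>UNIV. \<Sum>s\<in>UNIV. P k r s * B k s r)
        = (\<Sum>k\<in>UNIV. \<Sum>r\<in>UNIV. \<Sum>s\<in>UNIV. - (P k s r * B k s r))"
      by simp
    also have "\<dots> = (\<Sum>k\<in>UNIV. \<Sum>s\<in>UNIV. \<Sum>r\<in>UNIV. - (P k s r * B k s r))"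
      by (rule sum.cong[OF refl], rule sum.swap)
    finally show ?thesis by (simp add: sum_negf)
  qed
  ultimately have PdA: "(\<Sum>k\<in>UNIV. \<Sum>r\<in>UNIV. \<Sum>s\<in>UNIV. P k r s * pd (\<lambda>y. A y (n r) (n s)) x (n k)) = 0"
    unfolding A_def by (simp add: pd_diff d\<alpha> x B_def[symmetric] right_diff_distrib sum_subtractf)
  have Dk: "4 * pd (\<lambda>y. pd f y (n k)) x (n k) = - (\<Sum>r\<in>UNIV. \<Sum>s\<in>UNIV. (c k r s + c k s r) * (\<Sum>t\<in>UNIV. P k r t * A x (n s) (n t)))
      - (\<Sum>r\<in>UNIV. \<Sum>s\<in>UNIV. (c k r s + c k s r) * (\<Sum>t\<in>UNIV. P k t r * A x (n t) (n s)))
      + (\<Sum>r\<in>UNIV. \<Sum>s\<in>UNIV. ((\<Sum>a\<in>UNIV. c k k a * P a r s) + (\<Sum>a\<in>UNIV. c k r a * P k a s)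
          + (\<Sum>a\<in>UNIV. c k s a * P k r a)) * A x (n r) (n s))
      + (\<Sum>r\<in>UNIV. \<Sum>s\<in>UNIV. P k r s * pd (\<lambda>y. A y (n r) (n s)) x (n k))" for k
    using D[where u = "n k" and w = "n k"]
    unfolding dg dphi P_def[symmetric] by (simp only: mult_minus_left sum_negf diff_conv_add_uminus)
  have "4 * (\<Sum>k\<in>UNIV. pd (\<lambda>y. pd f y (n k)) x (n k))
      = (\<Sum>k\<in>UNIV. 4 * pd (\<lambda>y. pd f y (n k)) x (n k))"
    by (simp add: sum_distrib_left)
  also have "\<dots> = (\<Sum>k\<in>UNIV. - (\<Sum>r\<in>UNIV. \<Sum>s\<in>UNIV. (c k r s + c k s r) * (\<Sum>t\<in>UNIV. P k r t * A x (n s) (n t)))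
      - (\<Sum>r\<in>UNIV. \<Sum>s\<in>UNIV. (c k r s + c k s r) * (\<Sum>t\<in>UNIV. P k t r * A x (n t) (n s)))
      + (\<Sum>r\<in>UNIV. \<Sum>s\<in>UNIV. ((\<Sum>a\<in>UNIV. c k k a * P a r s) + (\<Sum>a\<in>UNIV. c k r a * P k a s)
          + (\<Sum>a\<in>UNIV. c k s a * P k r a)) * A x (n r) (n s)))
      + (\<Sum>k\<in>UNIV. \<Sum>r\<in>UNIV. \<Sum>s\<in>UNIV. P k r s * pd (\<lambda>y. A y (n r) (n s)) x (n k))"
    unfolding Dk by (rule sum.distrib)
  \<comment> \<open>The connection terms that survive contain P contracted with d\<alpha>, which is
    4 df by \<open>PA\<close>; they become the first-order part of the Laplacian.\<close>
  also have "\<dots> = (\<Sum>k\<in>UNIV. \<Sum>a\<in>UNIV. c k k a * (\<Sum>r\<in>UNIV. \<Sum>s\<in>UNIV. P a r s * A x (n r) (n s)))"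
    unfolding PdA
    by (simp only: add_0_right, rule connection_terms_cancel) (rule c_sym P1 P2 A_sym)+
  also have "\<dots> = (\<Sum>k\<in>UNIV. 4 * pd f x (\<Gamma> x (n k) (n k)))"
  proof (rule sum.cong[OF refl])
    fix k
    have "linear (pd f x)"
      using f x by (intro linear_pd C1_on_differentiable[of U] smooth_on_C1_on)
    from frame_sum[OF this, of k k]
    show "(\<Sum>a\<in>UNIV. c k k a * (\<Sum>r\<in>UNIV. \<Sum>s\<in>UNIV. P a r s * A x (n r) (n s))) = 4 * pd f x (\<Gamma> x (n k) (n k))"
      by (simp add: PA sum_distrib_left mult_ac)
  qed
  finally show ?thesis by (simp flip: sum_distrib_left)
qed

end

section \<open>The strong maximum principle\<close>

text \<open>If c were positive, G' would be positive just to the right of 0, and the mean value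
  theorem would produce a larger value there.\<close>

lemma second_derivative_test_max:
  fixes G :: "real \<Rightarrow> real"
  assumes "d > 0" and G: "\<And>s. \<bar>s\<bar> < d \<Longrightarrow> DERIV G s :> G' s" and G': "DERIV G' 0 :> c"
    and max: "\<And>s. \<bar>s\<bar> < d \<Longrightarrow> G s \<le> G 0"
  shows "G' 0 = 0" "c \<le> 0"
proof -
  show G0: "G' 0 = 0"
    using DERIV_local_max[OF G[of 0] assms(1)] max assms(1) by auto
  show "c \<le> 0"
  proof (rule ccontr)
    assume "\<not> c \<le> 0"
    then obtain e where e: "e > 0" "\<And>s. 0 < s \<Longrightarrow> s < e \<Longrightarrow> G' 0 < G' s"
      using DERIV_pos_inc_right[OF G'] by auto
    define s where "s = min e d / 2"
    have s: "0 < s" "s < e" "s < d" using e assms(1) by (auto simp: s_def)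
    obtain t where "0 < t" "t < s" "G s - G 0 = s * G' t"
      using MVT2[OF s(1), of G G'] G s by auto
    then have "G s - G 0 > 0" using e(2)[of t] G0 s by simp
    then show False using max[of s] s by simp
  qed
qed

text \<open>A small multiple of a barrier is added to f so that the sum has an interior maximum x
  near q, where the second derivative test contradicts the equation. The frame n may depend on x in
  any way; continuity is asked only of S, tr and b, the quantities left after summation over
  n.\<close>

lemma hopf_touching_ball:
  fixes f :: "'a::euclidean_space \<Rightarrow> real" and b :: "'a \<Rightarrow> 'a" and S :: "'a \<Rightarrow> 'a \<Rightarrow> real"
  assumes U: "open U" "q \<in> U" and f: "smooth_on U f"
    and cont: "continuous_on U tr" "continuous_on U b" "continuous_on U (\<lambda>x. S x (x - y))"
    and pos: "S q (q - y) > 0"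
    and pde: "\<And>x. x \<in> U \<Longrightarrow> \<exists>n::'i::finite \<Rightarrow> 'a. (\<Sum>k\<in>UNIV. pd (\<lambda>z. pd f z (n k)) x (n k)) = pd f x (b x)
      \<and> (\<forall>v. (\<Sum>k\<in>UNIV. (n k \<bullet> v)\<^sup>2) = S x v) \<and> (\<Sum>k\<in>UNIV. n k \<bullet> n k) = tr x"
    and max: "\<And>x. x \<in> U \<Longrightarrow> f x \<le> f q"
    and touch: "\<And>x. x \<in> U \<Longrightarrow> x \<noteq> q \<Longrightarrow> dist y x \<le> dist y q \<Longrightarrow> f x < f q"
  shows False
proof -
  \<comment> \<open>\<kappa> is half the value of S at q, and K exceeds both the trace and the drift
    there, so these bounds persist on a neighbourhood.\<close>
  define \<kappa> where "\<kappa> = S q (q - y) / 2"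
  define K where "K = \<bar>tr q\<bar> + norm (b q) + 1"
  have \<kappa>: "\<kappa> > 0" using pos by (simp add: \<kappa>_def)
  have K: "K > 0" by (simp add: K_def add_nonneg_pos)
  have "\<forall>\<^sub>F x in at q within U. S x (x - y) > \<kappa>"
    using cont(3) U(2) \<kappa> by (intro order_tendstoD(1)[of _ "S q (q - y)"]) (auto simp: continuous_on_def \<kappa>_def)
  moreover have "\<forall>\<^sub>F x in at q within U. \<bar>tr x\<bar> < K"
    using cont(1) U(2) by (intro order_tendstoD(2)[of _ "\<bar>tr q\<bar>"]) (auto simp: continuous_on_def K_def intro!: tendsto_intros add_nonneg_pos)
  moreover have "\<forall>\<^sub>F x in at q within U. norm (b x) < K"
    using cont(2) U(2) by (intro order_tendstoD(2)[of _ "norm (b q)"]) (auto simp: continuous_on_def K_def intro!: tendsto_intros add_nonneg_pos)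
  ultimately have "\<forall>\<^sub>F x in at q within U. S x (x - y) > \<kappa> \<and> \<bar>tr x\<bar> < K \<and> norm (b x) < K"
    by (intro eventually_conj)
  then obtain d where d: "d > 0" "\<And>x. x \<in> U \<Longrightarrow> x \<noteq> q \<Longrightarrow> dist x q < d \<Longrightarrow> S x (x - y) > \<kappa> \<and> \<bar>tr x\<bar> < K \<and> norm (b x) < K"
    unfolding eventually_at by auto
  obtain r where r: "r > 0" "ball q r \<subseteq> U" using U open_contains_ball by blast
  define \<rho> where "\<rho> = min r d / 2"
  have \<rho>: "\<rho> > 0" "\<rho> < r" "\<rho> < d" using r d by (auto simp: \<rho>_def)
  have cbU: "cball q \<rho> \<subseteq> U" using \<rho> r by (auto simp: subset_iff)
  have bounds: "S x (x - y) > \<kappa>" "tr x \<le> K" "norm (b x) \<le> K" if "x \<in> cball q \<rho>" for x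
  proof -
    have "x \<in> U" using that cbU by blast
    then have "S x (x - y) > \<kappa> \<and> \<bar>tr x\<bar> < K \<and> norm (b x) < K"
      using d(2)[of x] that \<rho> \<kappa> by (cases "x = q") (auto simp: \<kappa>_def K_def dist_commute add_nonneg_pos)
    then show "S x (x - y) > \<kappa>" "tr x \<le> K" "norm (b x) \<le> K" by auto
  qed
  define Z where "Z = dist q y + \<rho>"
  \<comment> \<open>Z bounds the distance to y on the small ball. The choice gives 2 a S > 2 K (1 +
    Z), which outweighs the drift term, at most Z K, and the trace, at most K.\<close>
  define a where "a = K * (1 + Z) / \<kappa>"
  have Z: "Z > 0" using \<rho> by (simp add: Z_def add_nonneg_pos)
  have a: "a > 0" using K Z \<kappa> by (simp add: a_def)
  \<comment> \<open>Hopf's barrier: for this \<open>a\<close> it is a strict subsolution near \<open>q\<close>, and it is negative outside the ball around \<open>y\<close>\<close>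
  define w where "w x = exp (- a * ((x - y) \<bullet> (x - y))) - exp (- a * ((q - y) \<bullet> (q - y)))" for x
  have w_q: "w q = 0" by (simp add: w_def)
  have w_le: "w x \<le> 1" for x
  proof -
    have "exp (- a * ((x - y) \<bullet> (x - y))) \<le> 1" using a by simp
    then show ?thesis unfolding w_def by (smt (verit) exp_gt_zero)
  qed
  have w_neg: "w x < 0" if "dist y x > dist y q" for x
  proof -
    have "norm (q - y) ^ 2 < norm (x - y) ^ 2"
      using that by (intro power_strict_mono) (auto simp: dist_norm norm_minus_commute)
    then have "(q - y) \<bullet> (q - y) < (x - y) \<bullet> (x - y)" by (simp add: power2_norm_eq_inner)
    then show ?thesis using a by (simp add: w_def)
  qed
  have contf: "continuous_on (cball q \<rho>) f"
    using C1_on_continuous[OF smooth_on_C1_on[OF f]] cbU continuous_on_subset by blast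
  \<comment> \<open>The part of the small sphere inside the touching ball. There f stays below f q
    by a uniform \<delta>, by compactness; on the rest of the sphere the barrier is
    negative.\<close>
  define C where "C = sphere q \<rho> \<inter> cball y (dist y q)"
  have "\<exists>\<delta>>0. \<forall>x\<in>C. f x \<le> f q - \<delta>"
  proof (cases "C = {}")
    case True
    then show ?thesis by (intro exI[of _ 1]) auto
  next
    case False
    have "compact C" by (simp add: C_def compact_Int)
    moreover have "continuous_on C f" using contf by (rule continuous_on_subset) (auto simp: C_def)
    ultimately obtain m where m: "m \<in> C" "\<And>x. x \<in> C \<Longrightarrow> f x \<le> f m"
      using continuous_attains_sup[of C f] False by auto
    have "f m < f q" using m(1) \<rho> cbU by (intro touch) (auto simp: C_def)
    then show ?thesis using m(2) by (intro exI[of _ "f q - f m"]) auto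
  qed
  then obtain \<delta> where \<delta>: "\<delta> > 0" "\<And>x. x \<in> C \<Longrightarrow> f x \<le> f q - \<delta>" by blast
  \<comment> \<open>Any \<epsilon> below \<delta> works on C, because w is at most 1.\<close>
  define \<epsilon> where "\<epsilon> = \<delta> / 2"
  have \<epsilon>: "\<epsilon> > 0" "\<epsilon> < \<delta>" using \<delta> by (auto simp: \<epsilon>_def)
  define F where "F x = f x + \<epsilon> * w x" for x
  have F_sphere: "F x < f q" if "x \<in> sphere q \<rho>" for x
  proof (cases "x \<in> C")
    case True
    have "\<epsilon> * w x \<le> \<epsilon> * 1" using w_le[of x] \<epsilon> by (intro mult_left_mono) auto
    then show ?thesis using \<delta>(2)[OF True] \<epsilon> unfolding F_def by linarith
  next
    case False
    then have "w x < 0" using that by (intro w_neg) (auto simp: C_def)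
    then have "\<epsilon> * w x < 0" using \<epsilon> by (simp add: mult_pos_neg)
    moreover have "f x \<le> f q" using that cbU by (intro max) auto
    ultimately show ?thesis by (simp add: F_def)
  qed
  have "continuous_on (cball q \<rho>) F"
    unfolding F_def w_def by (intro continuous_intros contf)
  then obtain x where x: "x \<in> cball q \<rho>" "\<And>z. z \<in> cball q \<rho> \<Longrightarrow> F z \<le> F x"
    using continuous_attains_sup[of "cball q \<rho>" F] \<rho> by auto
  have "F q \<le> F x" using x(2)[of q] \<rho> by simp
  then have "F x \<ge> f q" by (simp add: F_def w_q)
  then have xin: "x \<in> ball q \<rho>" using F_sphere[of x] x(1) by (auto simp: less_le)
  have xU: "x \<in> U" using x(1) cbU by blast
  define z where "z = x - y"
  define E where "E = exp (- a * (z \<bullet> z))"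
  obtain t where t: "t > 0" "ball x t \<subseteq> ball q \<rho>" using xin open_contains_ball[of "ball q \<rho>"] open_ball by blast
  \<comment> \<open>The second derivative test on the line through x in direction v; the terms with
    E are the first and second derivative of the barrier.\<close>
  have line: "pd f x v - 2 * a * \<epsilon> * E * (z \<bullet> v) = 0 \<and>
      pd (\<lambda>x. pd f x v) x v + \<epsilon> * E * (4 * a\<^sup>2 * (z \<bullet> v)\<^sup>2 - 2 * a * (v \<bullet> v)) \<le> 0" for v
  proof -
    \<comment> \<open>The summand 1 covers v = 0.\<close>
    define c where "c = t / (norm v + 1)"
    have c: "c > 0" using t by (simp add: c_def add_nonneg_pos)
    have in_ball: "x + s *\<^sub>R v \<in> ball q \<rho>" if "\<bar>s\<bar> < c" for s
    proof -
      have "\<bar>s\<bar> * norm v \<le> \<bar>s\<bar> * (norm v + 1)" by (simp add: mult_left_mono)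
      also have "\<dots> < c * (norm v + 1)"
        using that by (intro mult_strict_right_mono) (auto simp: add_nonneg_pos)
      also have "\<dots> = t" by (simp add: c_def add_nonneg_eq_0_iff)
      finally show ?thesis using t by (auto simp: dist_norm subset_iff)
    qed
    then have in_U: "x + s *\<^sub>R v \<in> U" if "\<bar>s\<bar> < c" for s using that cbU by fastforce
    define e where "e s = exp (- a * (z \<bullet> z + 2 * s * (z \<bullet> v) + s\<^sup>2 * (v \<bullet> v)))" for s
    define G where "G s = F (x + s *\<^sub>R v)" for s
    define G' where "G' s = pd f (x + s *\<^sub>R v) v + \<epsilon> * (e s * (- a * (2 * (z \<bullet> v) + 2 * s * (v \<bullet> v))))" for s
    have dline: "((\<lambda>s. x + s *\<^sub>R v) has_derivative (\<lambda>d. d *\<^sub>R v)) (at s)" for s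
      by (auto intro!: derivative_eq_intros)
    have dh: "DERIV (\<lambda>s. H (x + s *\<^sub>R v)) s :> pd H (x + s *\<^sub>R v) v"
      if H: "C1_on U H" and s: "\<bar>s\<bar> < c" for H :: "'a \<Rightarrow> real" and s
    proof -
      note D = C1_on_deriv[OF H in_U[OF s]]
      have "((\<lambda>s. H (x + s *\<^sub>R v)) has_derivative (\<lambda>d. pd H (x + s *\<^sub>R v) (d *\<^sub>R v))) (at s)"
        by (rule has_derivative_compose[OF dline D])
      moreover have "(\<lambda>d. pd H (x + s *\<^sub>R v) (d *\<^sub>R v)) = (*) (pd H (x + s *\<^sub>R v) v)"
        using linear_cmul[OF has_derivative_linear[OF D]] by (simp add: fun_eq_iff)
      ultimately show ?thesis by (simp add: has_field_derivative_def)
    qed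
    have de: "DERIV e s :> e s * (- a * (2 * (z \<bullet> v) + 2 * s * (v \<bullet> v)))" for s
      unfolding e_def by (auto intro!: derivative_eq_intros)
    have G_eq: "G s = f (x + s *\<^sub>R v) + \<epsilon> * (e s - exp (- a * ((q - y) \<bullet> (q - y))))" for s
    proof -
      have "x + s *\<^sub>R v - y = z + s *\<^sub>R v" by (simp add: z_def)
      moreover have "(z + s *\<^sub>R v) \<bullet> (z + s *\<^sub>R v) = z \<bullet> z + 2 * s * (z \<bullet> v) + s\<^sup>2 * (v \<bullet> v)"
        by (simp add: inner_add_left inner_add_right inner_commute power2_eq_square)
      ultimately show ?thesis by (simp only: G_def F_def w_def e_def)
    qed
    have dG: "DERIV G s :> G' s" if "\<bar>s\<bar> < c" for s
      unfolding G_eq G'_def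
      by (rule derivative_eq_intros dh[OF smooth_on_C1_on[OF f] that] de refl)+ simp
    have dG': "DERIV G' 0 :> pd (\<lambda>x. pd f x v) x v + \<epsilon> * E * (4 * a\<^sup>2 * (z \<bullet> v)\<^sup>2 - 2 * a * (v \<bullet> v))"
    proof -
      have "DERIV (\<lambda>s. pd f (x + s *\<^sub>R v) v) 0 :> pd (\<lambda>x. pd f x v) x v"
        using dh[OF smooth_on_C1_on[OF smooth_on_pd[OF f]], of 0] c by simp
      then show ?thesis
        unfolding G'_def
        by (auto intro!: derivative_eq_intros de simp: e_def E_def algebra_simps power2_eq_square)
    qed
    have maxG: "G s \<le> G 0" if "\<bar>s\<bar> < c" for s
      using x(2)[of "x + s *\<^sub>R v"] in_ball[OF that] by (simp add: G_def)
    from second_derivative_test_max[OF c dG dG' maxG]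
    show ?thesis by (simp add: G'_def e_def E_def algebra_simps)
  qed
  \<comment> \<open>Summation over n turns the second derivatives of f into its derivative along b
    x, which the first-order condition expresses through the barrier. Only coefficients of the
    equation remain.\<close>
  obtain n :: "'i \<Rightarrow> 'a" where n: "(\<Sum>k\<in>UNIV. pd (\<lambda>z. pd f z (n k)) x (n k)) = pd f x (b x)"
    "\<And>v. (\<Sum>k\<in>UNIV. (n k \<bullet> v)\<^sup>2) = S x v" "(\<Sum>k\<in>UNIV. n k \<bullet> n k) = tr x"
    using pde[OF xU] by blast
  have "(\<Sum>k\<in>UNIV. pd (\<lambda>x. pd f x (n k)) x (n k) + \<epsilon> * E * (4 * a\<^sup>2 * (z \<bullet> n k)\<^sup>2 - 2 * a * (n k \<bullet> n k))) \<le> 0"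
    by (rule sum_nonpos) (use line in blast)
  also have "(\<Sum>k\<in>UNIV. pd (\<lambda>x. pd f x (n k)) x (n k) + \<epsilon> * E * (4 * a\<^sup>2 * (z \<bullet> n k)\<^sup>2 - 2 * a * (n k \<bullet> n k)))
    = pd f x (b x) + \<epsilon> * E * (4 * a\<^sup>2 * S x z - 2 * a * tr x)"
    by (simp add: sum.distrib n(1) n(3)[symmetric] n(2)[symmetric] sum_subtractf inner_commute flip: sum_distrib_left)
  also have "pd f x (b x) = 2 * a * \<epsilon> * E * (z \<bullet> b x)" using line[of "b x"] by simp
  also have "2 * a * \<epsilon> * E * (z \<bullet> b x) + \<epsilon> * E * (4 * a\<^sup>2 * S x z - 2 * a * tr x)
      = (2 * a * \<epsilon> * E) * (z \<bullet> b x + 2 * a * S x z - tr x)"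
    by (simp add: algebra_simps power2_eq_square)
  finally have "z \<bullet> b x + 2 * a * S x z - tr x \<le> 0"
    using a \<epsilon> by (simp add: mult_le_0_iff E_def)
  moreover have "\<bar>z \<bullet> b x\<bar> \<le> Z * K"
  proof -
    have "norm z \<le> Z"
      using x(1) dist_triangle[of x y q] by (simp add: z_def Z_def dist_norm norm_minus_commute)
    then show ?thesis
      using Cauchy_Schwarz_ineq2[of z "b x"] mult_mono[of "norm z" Z "norm (b x)" K] bounds(3)[OF x(1)] Z by simp
  qed
  moreover have "a * \<kappa> = K * (1 + Z)" using \<kappa> by (simp add: a_def)
  moreover have "a * S x z > a * \<kappa>" using bounds(1)[OF x(1)] a by (simp add: z_def)
  moreover have "a * \<kappa> > 0" using a \<kappa> by simp
  ultimately show False using bounds(2)[OF x(1)] by (simp add: algebra_simps)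
qed

text \<open>Suppose f x is not the maximum and let q be the nearest point to x where it is attained.
  A ball through q that meets the maximum set in q alone puts \<open>hopf_touching_ball\<close> in
  force.\<close>

lemma strong_maximum_principle_ball:
  fixes f :: "'a::euclidean_space \<Rightarrow> real" and b :: "'a \<Rightarrow> 'a" and S :: "'a \<Rightarrow> 'a \<Rightarrow> real"
  assumes U: "open U" and f: "smooth_on U f"
    and cont: "continuous_on U tr" "continuous_on U b" "\<And>y. continuous_on U (\<lambda>x. S x (x - y))"
    and pos: "\<And>x v. x \<in> U \<Longrightarrow> v \<noteq> 0 \<Longrightarrow> S x v > 0"
    and pde: "\<And>x. x \<in> U \<Longrightarrow> \<exists>n::'i::finite \<Rightarrow> 'a. (\<Sum>k\<in>UNIV. pd (\<lambda>z. pd f z (n k)) x (n k)) = pd f x (b x)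
      \<and> (\<forall>v. (\<Sum>k\<in>UNIV. (n k \<bullet> v)\<^sup>2) = S x v) \<and> (\<Sum>k\<in>UNIV. n k \<bullet> n k) = tr x"
    and p: "cball p (2 * r) \<subseteq> U" and max: "\<And>x. x \<in> U \<Longrightarrow> f x \<le> f p" and x: "x \<in> ball p r"
  shows "f x = f p"
proof (rule ccontr)
  assume ne: "f x \<noteq> f p"
  have r: "r > 0" using x by (simp add: dist_pos_lt le_less_trans[OF zero_le_dist])
  have pU: "p \<in> U" using p r by auto
  have xU: "x \<in> U" using x p r by (auto simp: subset_iff)
  \<comment> \<open>The cut-off at 2 * r loses nothing: q is within r of x because p belongs to T,
    so every point closer to x than q is within 2 * r of p.\<close>
  define T where "T = {z \<in> cball p (2 * r). f z = f p}"
  have contf: "continuous_on (cball p (2 * r)) f"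
    using C1_on_continuous[OF smooth_on_C1_on[OF f]] p continuous_on_subset by blast
  have "closed T" unfolding T_def
    by (rule continuous_closed_preimage_constant[OF contf]) simp
  moreover have "p \<in> T" using r by (simp add: T_def)
  ultimately obtain q where q: "q \<in> T" "\<And>z. z \<in> T \<Longrightarrow> dist x q \<le> dist x z"
    using distance_attains_inf[of T x] by blast
  have fq: "f q = f p" using q(1) by (simp add: T_def)
  have qx: "q \<noteq> x" using fq ne by auto
  have dxq: "dist x q < r" using q(2)[OF \<open>p \<in> T\<close>] x by (simp add: dist_commute)
  \<comment> \<open>The sphere around x through q might contain further maximum points. The ball of
    half the radius around the midpoint touches that sphere from inside at q only.\<close>
  define y where "y = midpoint x q"
  have yq: "dist y q = dist x q / 2" and yx: "dist x y = dist x q / 2"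
    by (simp_all add: y_def dist_midpoint)
  have inside: "dist x z < dist x q" if "dist y z \<le> dist y q" "z \<noteq> q" for z
  proof (rule ccontr)
    assume "\<not> dist x z < dist x q"
    then have "dist x z = dist x y + dist y z" "dist y z = dist x y"
      using dist_triangle[of x z y] that yq yx by linarith+
    then have n: "norm (x - z) = norm (x - y) + norm (y - z)" "norm (y - z) = norm (x - y)"
      by (simp_all add: dist_norm)
    then have "norm (x - y) *\<^sub>R (y - z) = norm (y - z) *\<^sub>R (x - y)"
      using norm_triangle_eq[of "x - y" "y - z"] by simp
    moreover have "norm (x - y) \<noteq> 0"
      using yx qx by (metis dist_eq_0_iff dist_norm divide_eq_0_iff zero_neq_numeral)
    ultimately have "y - z = x - y" using n(2) by simp
    moreover have "x + q = y + y" using midpoint_eq_iff y_def by metis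
    ultimately have "z = q" by (metis add_diff_cancel_left' add_diff_eq diff_diff_eq2)
    then show False using that by simp
  qed
  have qU: "q \<in> U" using q(1) p by (auto simp: T_def)
  show False
  proof (rule hopf_touching_ball[where U = U and f = f and b = b and S = S and tr = tr and q = q and y = y])
    show "S q (q - y) > 0" using yq qx by (intro pos qU) auto
    show "f z \<le> f q" if "z \<in> U" for z using max[OF that] fq by simp
    show "f z < f q" if "z \<in> U" "z \<noteq> q" "dist y z \<le> dist y q" for z
    proof -
      have d: "dist x z < dist x q" using inside that by blast
      then have "dist p z \<le> 2 * r"
        using dist_triangle[of p z x] x dxq by (simp add: dist_commute)
      moreover have "z \<notin> T" using q(2)[of z] d by auto
      ultimately have "f z \<noteq> f p" by (simp add: T_def)
      then show ?thesis using max[OF that(1)] fq by simp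
    qed
  qed (use U qU f cont pde in auto)
qed

section \<open>The Laplacian as an elliptic operator with continuous coefficients\<close>

context G2_domain
begin

text \<open>The trace of the Christoffel symbols, taken in coordinates so that continuity is
  visible; \<open>drift_frame\<close> gives its form in an adapted frame.\<close>

definition drift :: "vec7 \<Rightarrow> vec7" where
  "drift x = (\<Sum>a\<in>UNIV. \<Sum>b\<in>UNIV. h x a b *\<^sub>R \<Gamma> x (axis a 1) (axis b 1))"

lemma sharp_dx_h: "sharp_dx (g x) l = (\<chi> a. h x a l)"
  by (simp add: h_def sharp_dx_def matrix_vector_mult_basis column_def)

lemma continuous_h: "continuous_on U (\<lambda>x. h x a b)"
  by (rule C1_on_continuous[OF C1_h])

lemma continuous_\<Gamma>: "continuous_on U (\<lambda>x. \<Gamma> x u v)"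
  unfolding \<Gamma>_def sharp_dx_h
  by (intro continuous_intros continuous_on_vec_lambda continuous_h C1_on_pd C1_g) auto

lemma continuous_drift: "continuous_on U drift"
  unfolding drift_def by (intro continuous_intros continuous_h continuous_\<Gamma>)

lemma linear_\<Gamma>: assumes "x \<in> U" shows "linear (\<lambda>u. \<Gamma> x u v $ i)" "linear (\<lambda>v. \<Gamma> x u v $ i)"
proof -
  show "linear (\<lambda>u. \<Gamma> x u v $ i)" "linear (\<lambda>v. \<Gamma> x u v $ i)"
    unfolding \<Gamma>_def sum_component vector_scaleR_component real_scaleR_def
    by (intro linear_compose_sum ballI linear_mult_const linear_mult_const[where c = "1 / 2", simplified] linear_compose_sub linear_compose_add
        linear_pd_g[OF assms] linear_pd diff_g[OF assms])+
qed

lemma drift_frame: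
  assumes x: "x \<in> U" and n: "G2_frame (\<phi> x) n"
  shows "drift x = (\<Sum>k\<in>UNIV. \<Gamma> x (n k) (n k))"
proof -
  have hn: "h x a b = (\<Sum>r\<in>UNIV. \<Sum>s\<in>UNIV. n r $ a * n s $ b * (if r = s then 1 else 0))" for a b
    by (simp add: h_frame[OF n] if_distrib[of "(*) _"] cong: if_cong)
  have "drift x $ i = (\<Sum>k\<in>UNIV. \<Gamma> x (n k) (n k)) $ i" for i
  proof -
    have "drift x $ i = (\<Sum>a\<in>UNIV. \<Sum>b\<in>UNIV. h x a b * \<Gamma> x (axis a 1) (axis b 1) $ i)"
      by (simp add: drift_def)
    also have "\<dots> = (\<Sum>r\<in>UNIV. \<Sum>s\<in>UNIV. (if r = s then 1 else 0) * \<Gamma> x (n r) (n s) $ i)"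
      unfolding hn by (rule bilinear_frame_sum) (rule linear_\<Gamma>[OF x])+
    also have "\<dots> = (\<Sum>k\<in>UNIV. \<Gamma> x (n k) (n k)) $ i"
      by (simp add: if_distrib[of "\<lambda>c. c * _"] cong: if_cong)
    finally show ?thesis .
  qed
  then show ?thesis by (simp add: vec_eq_iff)
qed

text \<open>The principal symbol of the Laplacian is the inverse metric, hence continuous in x
  although the frames are chosen point by point.\<close>

lemma h_quadratic_frame:
  assumes n: "G2_frame (\<phi> x) n"
  shows "(\<Sum>k\<in>UNIV. (n k \<bullet> v)\<^sup>2) = (\<Sum>a\<in>UNIV. \<Sum>b\<in>UNIV. h x a b * (v $ a * v $ b))"
proof -
  have hn: "h x a b = (\<Sum>r\<in>UNIV. \<Sum>s\<in>UNIV. n r $ a * n s $ b * (if r = s then 1 else 0))" for a b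
    by (simp add: h_frame[OF n] if_distrib[of "(*) _"] cong: if_cong)
  have l: "linear (\<lambda>u. (u \<bullet> v) * c)" "linear (\<lambda>u. c * (u \<bullet> v))" for c and v :: vec7
    by (auto intro!: linearI simp: inner_add_left algebra_simps)
  have "(\<Sum>a\<in>UNIV. \<Sum>b\<in>UNIV. h x a b * (v $ a * v $ b))
      = (\<Sum>a\<in>UNIV. \<Sum>b\<in>UNIV. h x a b * ((axis a 1 \<bullet> v) * (axis b 1 \<bullet> v)))"
    by (simp add: inner_axis')
  also have "\<dots> = (\<Sum>r\<in>UNIV. \<Sum>s\<in>UNIV. (if r = s then 1 else 0) * ((n r \<bullet> v) * (n s \<bullet> v)))"
    unfolding hn by (rule bilinear_frame_sum) (rule l)+
  also have "\<dots> = (\<Sum>k\<in>UNIV. (n k \<bullet> v)\<^sup>2)"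
    by (simp add: if_distrib[of "\<lambda>c. c * _"] power2_eq_square cong: if_cong)
  finally show ?thesis ..
qed

lemma harmonic_strong_maximum:
  fixes f :: "vec7 \<Rightarrow> real"
  assumes f: "smooth_on U f"
    and harm: "\<And>x n. x \<in> U \<Longrightarrow> G2_frame (\<phi> x) n \<Longrightarrow>
      (\<Sum>k\<in>UNIV. pd (\<lambda>y. pd f y (n k)) x (n k)) = (\<Sum>k\<in>UNIV. pd f x (\<Gamma> x (n k) (n k)))"
    and p: "cball p (2 * r) \<subseteq> U" and max: "\<And>x. x \<in> U \<Longrightarrow> f x \<le> f p" and x: "x \<in> ball p r"
  shows "f x = f p"
proof (rule strong_maximum_principle_ball[where U = U and f = f and b = drift
    and S = "\<lambda>x v. \<Sum>a\<in>UNIV. \<Sum>b\<in>UNIV. h x a b * (v $ a * v $ b)" and tr = "\<lambda>x. \<Sum>a\<in>UNIV. h x a a" and p = p and r = r])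
  show "\<exists>n::7 \<Rightarrow> vec7. (\<Sum>k\<in>UNIV. pd (\<lambda>z. pd f z (n k)) x (n k)) = pd f x (drift x)
      \<and> (\<forall>v. (\<Sum>k\<in>UNIV. (n k \<bullet> v)\<^sup>2) = (\<Sum>a\<in>UNIV. \<Sum>b\<in>UNIV. h x a b * (v $ a * v $ b)))
      \<and> (\<Sum>k\<in>UNIV. n k \<bullet> n k) = (\<Sum>a\<in>UNIV. h x a a)" if x: "x \<in> U" for x
  proof -
    obtain n where n: "G2_frame (\<phi> x) n" using G2_form_frame[OF G2[OF x]] by blast
    have "linear (pd f x)"
      using f x by (intro linear_pd C1_on_differentiable[of U] smooth_on_C1_on)
    then have 1: "(\<Sum>k\<in>UNIV. pd (\<lambda>z. pd f z (n k)) x (n k)) = pd f x (drift x)"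
      by (simp add: harm[OF x n] drift_frame[OF x n] linear_sum)
    have 2: "(\<Sum>k\<in>UNIV. n k \<bullet> n k) = (\<Sum>a\<in>UNIV. h x a a)"
      unfolding h_frame[OF n] inner_vec_def inner_real_def by (rule sum.swap)
    show ?thesis using 1 2 h_quadratic_frame[OF n] by blast
  qed
  show "(\<Sum>a\<in>UNIV. \<Sum>b\<in>UNIV. h x a b * (v $ a * v $ b)) > 0" if x: "x \<in> U" and v: "v \<noteq> 0" for x v
  proof -
    obtain n where n: "G2_frame (\<phi> x) n" using G2_form_frame[OF G2[OF x]] by blast
    have "(\<Sum>k\<in>UNIV. (n k \<bullet> v)\<^sup>2) \<noteq> 0"
    proof
      assume "(\<Sum>k\<in>UNIV. (n k \<bullet> v)\<^sup>2) = 0"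
      then have z: "n k \<bullet> v = 0" for k by (simp add: sum_nonneg_eq_0_iff)
      have "v = (\<Sum>k\<in>UNIV. g x v (n k) *\<^sub>R n k)" using n by (simp add: G2_frame_def)
      then have "v \<bullet> v = (\<Sum>k\<in>UNIV. g x v (n k) *\<^sub>R n k) \<bullet> v" by simp
      also have "\<dots> = 0" by (simp add: inner_sum_left z)
      finally show False using v by simp
    qed
    then have "(\<Sum>k\<in>UNIV. (n k \<bullet> v)\<^sup>2) > 0" by (simp add: less_le sum_nonneg)
    then show ?thesis by (simp add: h_quadratic_frame[OF n])
  qed
  show "continuous_on U (\<lambda>x. \<Sum>a\<in>UNIV. \<Sum>b\<in>UNIV. h x a b * ((x - y) $ a * (x - y) $ b))" for y
    by (intro continuous_intros continuous_h)
  show "continuous_on U (\<lambda>x. \<Sum>a\<in>UNIV. h x a a)" by (intro continuous_intros continuous_h)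
qed (use f open_U continuous_drift p max x in auto)

end

section \<open>Globalisation\<close>

lemma Ck_on_subset: "Ck_on k S f \<Longrightarrow> T \<subseteq> S \<Longrightarrow> Ck_on k T f"
  by (induction k arbitrary: f) (auto intro: continuous_on_subset)

lemma smooth_on_subset: "smooth_on S f \<Longrightarrow> T \<subseteq> S \<Longrightarrow> smooth_on T f"
  unfolding smooth_on_def using Ck_on_subset by blast

locale smooth_chart =
  fixes M :: "'a topology" and c :: "'a chart"
  assumes chart: "chart_on M c"
begin

abbreviation dom :: "'a set" where "dom \<equiv> chart_dom c"
abbreviation img :: "vec7 set" where "img \<equiv> coord c ` dom"

lemma openin_dom: "openin M dom" and open_img: "open img"
  using chart by (auto simp: chart_on_def)

lemma topspace_dom: "topspace (subtopology M dom) = dom"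
  using openin_subset[OF openin_dom] by auto

lemma inj_coord: "inj_on (coord c) dom"
  using chart homeomorphic_imp_injective_map topspace_dom unfolding chart_on_def by metis

lemma param_coord: "p \<in> dom \<Longrightarrow> param c (coord c p) = p"
  unfolding param_def by (rule the_inv_into_f_f[OF inj_coord])

lemma coord_param: "x \<in> img \<Longrightarrow> coord c (param c x) = x" and param_dom: "x \<in> img \<Longrightarrow> param c x \<in> dom"
  by (auto simp: param_coord)

lemma continuous_coord: "continuous_map (subtopology M dom) (top_of_set img) (coord c)"
  using chart homeomorphic_imp_continuous_map unfolding chart_on_def by blast

text \<open>The homeomorphism supplies some continuous inverse, which agrees with
  \<open>the_inv_into\<close> on the image.\<close>

lemma continuous_param: "continuous_map (top_of_set img) (subtopology M dom) (param c)"
proof -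
  obtain g where g: "homeomorphic_maps (subtopology M dom) (top_of_set img) (coord c) g"
    using chart homeomorphic_map_maps unfolding chart_on_def by blast
  then have cont: "continuous_map (top_of_set img) (subtopology M dom) g"
    and inv: "\<And>p. p \<in> dom \<Longrightarrow> g (coord c p) = p"
    using openin_subset[OF openin_dom] by (auto simp: homeomorphic_maps_def)
  show ?thesis
    by (rule continuous_map_eq[OF cont]) (auto simp: param_coord inv)
qed

lemma openin_preimage:
  assumes "open S" shows "openin M {p \<in> dom. coord c p \<in> S}"
proof -
  have "openin (subtopology M dom) {p \<in> topspace (subtopology M dom). coord c p \<in> img \<inter> S}"
    by (rule openin_continuous_map_preimage[OF continuous_coord]) (use assms in \<open>auto simp: openin_open_Int\<close>)
  moreover have "{p \<in> topspace (subtopology M dom). coord c p \<in> img \<inter> S} = {p \<in> dom. coord c p \<in> S}"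
    using topspace_dom by auto
  ultimately show ?thesis using openin_trans_full openin_dom by metis
qed

lemma connectedin_param_image:
  assumes "connected S" "S \<subseteq> img" shows "connectedin M (param c ` S)"
proof -
  have "connectedin (top_of_set img) S"
    using assms by (simp add: connectedin_subtopology)
  then have "connectedin (subtopology M dom) (param c ` S)"
    by (rule connectedin_continuous_map_image[OF continuous_param])
  then show ?thesis by (simp add: connectedin_subtopology)
qed

lemma chart_deriv_param: "x \<in> img \<Longrightarrow> chart_deriv c (param c x) u h = pd (\<lambda>y. h (param c y)) x u"
  by (simp add: chart_deriv_def coord_param)

end

lemma ext_d_function_form:
  "ext_d (function_form f) c p vs = (if length vs = 1 then chart_deriv c p (hd vs) f else 0)"
proof (cases "length vs = 1")
  case True
  then obtain v where "vs = [v]" by (auto simp: length_Suc_conv)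
  then show ?thesis by (simp add: ext_d_def function_form_def)
next
  case False
  \<comment> \<open>Removing one entry leaves the empty list only if there was exactly one;
    otherwise the zero function is differentiated.\<close>
  have "chart_deriv c p (vs ! i) (\<lambda>q. function_form f c q (take i vs @ drop (Suc i) vs)) = 0"
    if "i < length vs" for i
  proof -
    have "(take i vs @ drop (Suc i) vs = []) = False" using that False by auto
    then show ?thesis
      by (simp only: function_form_def chart_deriv_def if_False frechet_derivative_const)
  qed
  then show ?thesis using False by (simp add: ext_d_def)
qed

lemma ext_d_1_form:
  "ext_d \<alpha> c p [u, v] = chart_deriv c p u (\<lambda>q. \<alpha> c q [v]) - chart_deriv c p v (\<lambda>q. \<alpha> c q [u])"
  by (simp add: ext_d_def)

locale rochesterian_pair =
  fixes M :: "'a topology" and A :: "'a chart set" and \<phi> :: "'a cov_field" and Q :: "'a bivec_field"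
    and f :: "'a \<Rightarrow> real" and \<alpha> :: "'a cov_field"
  assumes G2: "G2_manifold M A \<phi>"
    and f: "smooth_function A f" "field_eq A (contract2_field Q \<phi>) (ext_d (function_form f))"
    and \<alpha>: "smooth_form A 1 \<alpha>" "field_eq A (contract2_field Q (G2_star_field \<phi>)) (ext_d \<alpha>)"
begin

lemma smooth_chart: "c \<in> A \<Longrightarrow> smooth_chart M c"
  using G2 by (simp add: G2_manifold_def smooth_manifold7_def smooth_chart_def)

lemma topspace_charts: "topspace M = (\<Union>c\<in>A. chart_dom c)"
  using G2 by (simp add: G2_manifold_def smooth_manifold7_def)

text \<open>
  \<open>U\<close> need not be the whole image of the chart: a chart domain may meet several components of \<open>M\<close>.
\<close>

lemma strong_maximum:
  assumes c: "c \<in> A" and U: "open U" "U \<subseteq> coord c ` chart_dom c"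
    and p: "cball x0 (2 * r) \<subseteq> U" and max: "\<And>x. x \<in> U \<Longrightarrow> f (param c x) \<le> f (param c x0)"
    and x: "x \<in> ball x0 r"
  shows "f (param c x) = f (param c x0)"
proof -
  interpret smooth_chart M c by (rule smooth_chart[OF c])
  have str: "smooth_form A 3 \<phi>" "\<And>p. p \<in> dom \<Longrightarrow> G2_form (\<phi> c p)"
    and par: "parallel A (G2_metric_field \<phi>) \<phi>"
    using G2 c by (auto simp: G2_manifold_def G2_structure_def)
  have "smooth_on img (\<lambda>x. \<phi> c (param c x) vs)" for vs
    using str(1) c by (simp add: smooth_form_def)
  then have C1phi: "C1_on U (\<lambda>x. \<phi> c (param c x) vs)" for vs
    by (rule smooth_on_C1_on[OF smooth_on_subset[OF _ U(2)]])
  interpret G2_domain U "\<lambda>x. \<phi> c (param c x)"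
    by unfold_locales (use U C1phi str(2) param_dom in \<open>auto simp: subset_iff\<close>)
  have \<Gamma>: "christoffel (G2_metric_field \<phi>) c (param c x) u v = \<Gamma> x u v" if "x \<in> U" for x u v
    using that U(2) by (simp add: christoffel_def \<Gamma>_def chart_deriv_param subset_iff G2_metric_field_def)
  have par': "pd (\<lambda>y. \<phi> c (param c y) [u1, u2, u3]) x u = \<phi> c (param c x) [\<Gamma> x u u1, u2, u3]
      + \<phi> c (param c x) [u1, \<Gamma> x u u2, u3] + \<phi> c (param c x) [u1, u2, \<Gamma> x u u3]"
    if x: "x \<in> U" for x u u1 u2 u3
  proof -
    have "cov_deriv (G2_metric_field \<phi>) \<phi> c (param c x) u [u1, u2, u3] = 0"
      using par c x U(2) param_dom by (auto simp: parallel_def subset_iff)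
    then show ?thesis
      using x U(2) by (simp add: cov_deriv_def \<Gamma> chart_deriv_param subset_iff eval_nat_numeral lessThan_Suc)
  qed
  define F where "F x = f (param c x)" for x
  have smF: "smooth_on U F"
    unfolding F_def using f(1) c U(2) by (auto simp: smooth_function_def intro: smooth_on_subset)
  have sma: "smooth_on U (\<lambda>x. \<alpha> c (param c x) [v])" for v
  proof (rule smooth_on_subset[OF _ U(2)])
    show "smooth_on img (\<lambda>x. \<alpha> c (param c x) [v])" using \<alpha>(1) c by (simp add: smooth_form_def)
  qed
  have lina: "linear (\<lambda>v. \<alpha> c (param c x) [v])" if "x \<in> U" for x
  proof -
    have "alt_form 1 (\<alpha> c (param c x))"
      using \<alpha>(1) c U(2) that param_dom by (auto simp: smooth_form_def subset_iff)
    from alt_form_linear[OF this, of "[0]" 0] show ?thesis by simp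
  qed
  have Qf: "contract2 (Q c (param c x)) (\<phi> c (param c x)) [w] = pd F x w" if "x \<in> U" for x w
  proof -
    have "x \<in> img" using that U(2) by blast
    moreover from this have "contract2_field Q \<phi> c (param c x) = ext_d (function_form f) c (param c x)"
      using f(2) c param_dom by (simp add: field_eq_def)
    ultimately show ?thesis
      by (simp add: contract2_field_def ext_d_function_form chart_deriv_param F_def[abs_def])
  qed
  have Qa: "contract2 (Q c (param c x)) (G2_star (\<phi> c (param c x))) [u, v]
      = pd (\<lambda>y. \<alpha> c (param c y) [v]) x u - pd (\<lambda>y. \<alpha> c (param c y) [u]) x v" if "x \<in> U" for x u v
  proof -
    have "x \<in> img" using that U(2) by blast
    moreover from this have "contract2_field Q (G2_star_field \<phi>) c (param c x) = ext_d \<alpha> c (param c x)"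
      using \<alpha>(2) c param_dom by (simp add: field_eq_def)
    ultimately show ?thesis
      by (simp add: contract2_field_def G2_star_field_def ext_d_1_form chart_deriv_param)
  qed
  have "F x = F x0"
  proof (rule harmonic_strong_maximum[OF smF _ p _ x])
    show "(\<Sum>k\<in>UNIV. pd (\<lambda>y. pd F y (n k)) x (n k)) = (\<Sum>k\<in>UNIV. pd F x (\<Gamma> x (n k) (n k)))"
      if "x \<in> U" "G2_frame (\<phi> c (param c x)) n" for x n
      by (rule laplace_equation[OF par' smF sma lina Qf Qa that])
  qed (use max in \<open>simp add: F_def\<close>)
  then show ?thesis by (simp add: F_def)
qed

lemma continuous_f: "continuous_map M euclideanreal f"
proof (rule pasting_lemma[where I = A and T = chart_dom and f = "\<lambda>_. f"])
  fix c assume c: "c \<in> A"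
  interpret smooth_chart M c by (rule smooth_chart[OF c])
  show "openin M (chart_dom c)" by (rule openin_dom)
  have "smooth_on img (\<lambda>x. f (param c x))" using f(1) c by (simp add: smooth_function_def)
  then have "continuous_map (top_of_set img) euclideanreal (\<lambda>x. f (param c x))"
    by (simp add: C1_on_continuous smooth_on_C1_on)
  from continuous_map_compose[OF continuous_coord this]
  show "continuous_map (subtopology M (chart_dom c)) euclideanreal f"
    by (rule continuous_map_eq) (simp add: topspace_dom param_coord)
qed (auto simp: topspace_charts)

text \<open>A ball is connected, so its image stays in the component of p. The factor 3 leaves room
  for the closed ball of radius 2 * r in \<open>strong_maximum\<close>.\<close>

lemma chart_ball:
  assumes c: "c \<in> A" and p: "p \<in> chart_dom c"
  obtains r where "r > 0" "ball (coord c p) (3 * r) \<subseteq> coord c ` chart_dom c"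
    "param c ` ball (coord c p) (3 * r) \<subseteq> connected_component_of_set M p"
proof -
  interpret smooth_chart M c by (rule smooth_chart[OF c])
  obtain s where s: "s > 0" "ball (coord c p) s \<subseteq> img"
    using open_img p open_contains_ball by (metis imageI)
  have "connectedin M (param c ` ball (coord c p) s)"
    by (rule connectedin_param_image) (use s convex_connected in auto)
  moreover have "p \<in> param c ` ball (coord c p) s"
    using s(1) param_coord[OF p] by (metis centre_in_ball imageI)
  ultimately have "param c ` ball (coord c p) s \<subseteq> connected_component_of_set M p"
    by (rule connected_component_of_maximal)
  then show ?thesis using s by (intro that[of "s / 3"]) auto
qed

text \<open>A component of a compact space is closed, hence compact, so f attains a maximum on it.
  Near a maximum point the comparison runs over a chart ball inside the component, as the value of f
  on other components may be larger.\<close>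

lemma constant_on_component:
  assumes "compact_space M" and p: "p \<in> topspace M" and q: "q \<in> connected_component_of_set M p"
  shows "f q = f p"
proof -
  define C where "C = connected_component_of_set M p"
  have pC: "p \<in> C" using p by (simp add: C_def connected_component_of_refl)
  have "compactin M C"
    using closedin_compact_space[OF assms(1)] closedin_connected_component_of C_def by metis
  then have "compact (f ` C)"
    using image_compactin[OF _ continuous_f] by fastforce
  then obtain m where m: "m \<in> C" "\<And>x. x \<in> C \<Longrightarrow> f x \<le> f m"
    using compact_attains_sup[of "f ` C"] pC by auto
  define V where "V = {x \<in> C. f x = f m}"
  have "openin M V"
  proof (subst openin_subopen, intro ballI)
    fix v assume v: "v \<in> V"
    then have vC: "v \<in> C" "f v = f m" by (auto simp: V_def)
    then have Cv: "connected_component_of_set M v = C"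
      using connected_component_of_equiv[of M p v] by (simp add: C_def)
    have "v \<in> topspace M"
      using connected_component_of_subset_topspace[of M p] vC(1) unfolding C_def by (rule subsetD)
    then obtain c where c: "c \<in> A" "v \<in> chart_dom c" using topspace_charts by blast
    interpret smooth_chart M c by (rule smooth_chart[OF c(1)])
    obtain r where r: "r > 0" "ball (coord c v) (3 * r) \<subseteq> img" "param c ` ball (coord c v) (3 * r) \<subseteq> C"
      using chart_ball[OF c] Cv by metis
    \<comment> \<open>Constancy is obtained only on the ball of radius r, while the comparison of
      values uses the whole ball of radius 3 * r.\<close>
    let ?W = "{x \<in> dom. coord c x \<in> ball (coord c v) r}"
    have "f x = f m" "x \<in> C" if x: "x \<in> ?W" for x
    proof -
      have "f (param c (coord c x)) = f (param c (coord c v))"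
      proof (rule strong_maximum[OF c(1) _ r(2)])
        show "cball (coord c v) (2 * r) \<subseteq> ball (coord c v) (3 * r)" using r(1) by auto
        show "f (param c y) \<le> f (param c (coord c v))" if "y \<in> ball (coord c v) (3 * r)" for y
        proof -
          have "param c y \<in> C" using r(3) that by blast
          then show ?thesis using m(2) vC(2) param_coord[OF c(2)] by simp
        qed
      qed (use x in auto)
      then show "f x = f m" using x vC c by (simp add: param_coord)
      have "coord c x \<in> ball (coord c v) (3 * r)" using x r(1) by auto
      then have "param c (coord c x) \<in> C" using r(3) by blast
      then show "x \<in> C" using x by (simp add: param_coord)
    qed
    then have "?W \<subseteq> V" by (auto simp: V_def)
    moreover have "openin M ?W" by (rule openin_preimage) simp
    moreover have "v \<in> ?W" using c r by simp
    ultimately show "\<exists>T. openin M T \<and> v \<in> T \<and> T \<subseteq> V" by blast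
  qed
  moreover have "closedin M V"
  proof -
    have "closedin M {x \<in> topspace M. f x \<in> {f m}}"
      by (rule closedin_continuous_map_preimage[OF continuous_f]) simp
    moreover have "V = C \<inter> {x \<in> topspace M. f x \<in> {f m}}"
      using connected_component_of_subset_topspace[of M p] by (auto simp: V_def C_def)
    ultimately show ?thesis
      using closedin_connected_component_of C_def by (metis closedin_Int)
  qed
  moreover have "connectedin M C" unfolding C_def by (rule connectedin_connected_component_of)
  ultimately have "C \<subseteq> V \<or> disjnt C V" using connectedin_clopen_cases by blast
  then have "C \<subseteq> V" using m(1) by (auto simp: V_def disjnt_def)
  then have "f x = f m" if "x \<in> C" for x using that by (auto simp: V_def)
  then show ?thesis using pC q by (metis C_def)
qed

text \<open>The derivative of f at p depends only on f near p, and the image of a small chart ball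
  lies in the component of p, where f is constant.\<close>

lemma contract2_field_zero:
  assumes "compact_space M"
  shows "field_eq A (contract2_field Q \<phi>) zero_field"
  unfolding field_eq_def
proof (intro ballI ext)
  fix c p vs assume c: "c \<in> A" and p: "p \<in> chart_dom c"
  interpret smooth_chart M c by (rule smooth_chart[OF c])
  obtain r where r: "r > 0" "ball (coord c p) (3 * r) \<subseteq> img"
    "param c ` ball (coord c p) (3 * r) \<subseteq> connected_component_of_set M p"
    using chart_ball[OF c p] by metis
  have pM: "p \<in> topspace M" using c p topspace_charts by blast
  have "pd (\<lambda>x. f (param c x)) (coord c p) v = pd (\<lambda>x. f p) (coord c p) v" for v
  proof (rule pd_cong[of "ball (coord c p) (3 * r)"])
    fix x assume "x \<in> ball (coord c p) (3 * r)"
    then have "param c x \<in> connected_component_of_set M p" using r(3) by blast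
    then show "f (param c x) = f p" by (rule constant_on_component[OF assms pM])
  qed (use r in auto)
  then have "chart_deriv c p v f = 0" for v by (simp add: chart_deriv_def)
  moreover have "contract2_field Q \<phi> c p = ext_d (function_form f) c p"
    using f(2) c p by (simp add: field_eq_def)
  ultimately show "contract2_field Q \<phi> c p vs = zero_field c p vs"
    by (simp add: ext_d_function_form zero_field_def)
qed

end

theorem proposition1p3:
  fixes M :: "'a topology" and A :: "'a chart set"
    and \<phi> :: "'a cov_field" and Q :: "'a bivec_field"
  assumes "closed_G2_manifold M A \<phi>"
    and "smooth_bivector_field A Q"
    and "Rochesterian A \<phi> Q"
    and "coRochesterian A \<phi> Q"
  shows "field_eq A (contract2_field Q \<phi>) zero_field"
proof -
  obtain f where f: "smooth_function A f" "field_eq A (contract2_field Q \<phi>) (ext_d (function_form f))"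
    using assms(3) by (auto simp: Rochesterian_def)
  obtain \<alpha> where \<alpha>: "smooth_form A 1 \<alpha>" "field_eq A (contract2_field Q (G2_star_field \<phi>)) (ext_d \<alpha>)"
    using assms(4) by (auto simp: coRochesterian_def)
  have M: "G2_manifold M A \<phi>" "compact_space M"
    using assms(1) by (auto simp: closed_G2_manifold_def)
  interpret rochesterian_pair M A \<phi> Q f \<alpha>
    by unfold_locales (fact M f \<alpha>)+
  show ?thesis by (rule contract2_field_zero[OF M(2)])
qed

end
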